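(* Let $\mathfrak{s}\in\{+1,-1\}$ and let $\Gamma$ be a contour of sign $\mathfrak{s}$ (as defined in the context) such that $$\|B_\Gamma\|_{\mathsf{E}_{D_\Gamma}}\,\|C_\Gamma\|_{\mathsf{E}_{D_\Gamma}}<\frac{d(\Gamma)^2}{4},\qquad d(\Gamma)=\operatorname{dist}(\sigma_A,\Gamma).$$ Let $X_\Gamma$ and $Y_\Gamma$ be the solutions of the deformed Riccati equations specified in the context, and on $\mathfrak{H}_A\oplus\mathfrak{H}_{D,\Gamma}$ let $$L_\Gamma=\begin{pmatrix}A&B_\Gamma\\ C_\Gamma&D_\Gamma\end{pmatrix},\qquad Q_\Gamma=\begin{pmatrix}0&Y_\Gamma\\ X_\Gamma&0\end{pmatrix}.$$ Then $L_\Gamma$ admits the block diagonalization $$L_\Gamma=(I+Q_\Gamma)\begin{pmatrix}Z_A^{\mathfrak{s}}&0\\0&Z_{D,\Gamma}\end{pmatrix}(I+Q_\Gamma)^{-1}=(I-Q_\Gamma)^{-1}\begin{pmatrix}\widetilde Z_A&0\\0&\widetilde Z_D\end{pmatrix}(I-Q_\Gamma)$$ (in particular $I\pm Q_\Gamma$ are boundedly invertible), where $$Z_A^{\mathfrak{s}}=A+B_\Gamma X_\Gamma,\quad Z_{D,\Gamma}=D_\Gamma+C_\Gamma Y_\Gamma,\quad \widetilde Z_A=A-Y_\Gamma C_\Gamma,\quad \widetilde Z_D=D_\Gamma-X_\Gamma B_\Gamma.$$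
   Context: Notation. $\mathcal{B}(\mathfrak{L},\mathfrak{M})$ is the space of bounded linear operators between Hilbert spaces; $\sigma_S$ is the spectrum of $S$; $\mathbb{C}^{\pm}=\{z\in\mathbb{C}:\pm\operatorname{Im}z>0\}$; $\Delta=(\alpha,\beta)$ with $-\infty<\alpha<\beta<\infty$. Superscripts $+1,-1$ are identified with $+,-$. Standing setting. $\mathfrak{H}_A$ and $\mathfrak{h}$ are Hilbert spaces; $A\in\mathcal{B}(\mathfrak{H}_A)$ is self-adjoint with $\sigma_A\subset\Delta$. The functions $\mathfrak{b}:\Delta\to\mathcal{B}(\mathfrak{h},\mathfrak{H}_A)$ and $\mathfrak{c}:\Delta\to\mathcal{B}(\mathfrak{H}_A,\mathfrak{h})$ are real analytic on $\Delta$ and admit analytic continuation (denoted by the same letters) to a domain $\mathcal{D}\subset\mathbb{C}$ with $\Delta\subset\mathcal{D}$ and $\alpha,\beta\notin\mathcal{D}$. Put $\mathcal{D}^{\pm}=\mathcal{D}\cap\mathbb{C}^{\pm}$. There are constants $c>0$, $0\le\nu_{\mathfrak b}<1/2$, $0\le\nu_{\mathfrak c}<1/2$ such that, for each $\omega\in\{\alpha,\beta\}$, $\|\mathfrak{b}(\mu)\|\le c|\mu-\omega|^{-\nu_{\mathfrak b}}$ and $\|\mathfrak{c}(\mu)\|\le c|\mu-\omega|^{-\nu_{\mathfrak c}}$ for all $\mu\in\mathcal{D}$ in some open complex neighborhood of $\omega$. Contours. For $\mathfrak{s}=\pm1$, a contour of sign $\mathfrak{s}$ is a piecewise smooth Jordan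 arc $\Gamma$ with end points $\alpha,\beta$ (oriented from $\alpha$ to $\beta$), obtained from $\Delta$ by a continuous deformation with fixed end points and lying, except for its end points, in $\mathcal{D}^{\mathfrak{s}}\cup\Delta$; the region enclosed by the closed curve formed by $\Delta$ and $\Gamma$ is contained in $\mathcal{D}^{\mathfrak{s}}$. Deformed operators. $\mathfrak{H}_{D,\Gamma}=L^2(\Gamma\to\mathfrak{h})$ is the Hilbert space of $\mathfrak{h}$-valued functions on $\Gamma$ with inner product $\langle f,g\rangle=\int_\Gamma|d\lambda|\,\langle f(\lambda),g(\lambda)\rangle_{\mathfrak h}$. The operators $D_\Gamma\in\mathcal{B}(\mathfrak{H}_{D,\Gamma})$, $C_\Gamma\in\mathcal{B}(\mathfrak{H}_A,\mathfrak{H}_{D,\Gamma})$, $B_\Gamma\in\mathcal{B}(\mathfrak{H}_{D,\Gamma},\mathfrak{H}_A)$ are $$(D_\Gamma f)(\lambda)=\lambda f(\lambda),\qquad (C_\Gamma f_A)(\lambda)=\mathfrak{c}(\lambda)f_A,\qquad B_\Gamma f=\int_\Gamma d\lambda\,\mathfrak{b}(\lambda)f(\lambda),$$ where $d\lambda$ is the complex line element. $D_\Gamma$ is normal with spectrum $\overline\Gamma=\Gamma\cup\{\alpha,\beta\}$ and spectral measure $(\mathsf{E}_{D_\Gamma}(\delta)f)(\lambda)=\chi_\delta(\lambda)f(\lambda)$, $\delta\subset\overline\Gamma$ Borel. $\mathsf{E}$-norm. For $S\in\mathcal{B}(\mathfrak{H}_A,\mathfrak{H}_{D,\Gamma})$,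 $$\|S\|_{\mathsf{E}_{D_\Gamma}}=\Bigl(\sup_{\{\delta_j\}}\sum_j\|S^*\mathsf{E}_{D_\Gamma}(\delta_j)S\|\Bigr)^{1/2},$$ the supremum being over finite or countable systems of mutually disjoint Borel subsets $\delta_j$ of $\sigma_{D_\Gamma}$. For $T\in\mathcal{B}(\mathfrak{H}_{D,\Gamma},\mathfrak{H}_A)$, $\|T\|_{\mathsf{E}_{D_\Gamma}}:=\|T^*\|_{\mathsf{E}_{D_\Gamma}}$. The solutions $X_\Gamma$, $Y_\Gamma$. Write $d=d(\Gamma)$, $b=\|B_\Gamma\|_{\mathsf{E}_{D_\Gamma}}$, $c_0=\|C_\Gamma\|_{\mathsf{E}_{D_\Gamma}}$. Under the condition $bc_0<d^2/4$: $X_\Gamma\in\mathcal{B}(\mathfrak{H}_A,\mathfrak{H}_{D,\Gamma})$ is the unique solution of $XA-D_\Gamma X+XB_\Gamma X=C_\Gamma$ with $\|X\|<b^{-1}(d-\sqrt{bc_0})$, and it satisfies $\|X_\Gamma\|_{\mathsf{E}_{D_\Gamma}}\le b^{-1}\bigl(\frac d2-\sqrt{\frac{d^2}4-bc_0}\bigr)$; $Y_\Gamma\in\mathcal{B}(\mathfrak{H}_{D,\Gamma},\mathfrak{H}_A)$ is the unique solution of $YD_\Gamma-AY+YC_\Gamma Y=B_\Gamma$ with $\|Y\|<c_0^{-1}(d-\sqrt{bc_0})$, and it satisfies $\|Y_\Gamma\|_{\mathsf{E}_{D_\Gamma}}\le c_0^{-1}\bigl(\frac d2-\sqrt{\frac{d^2}4-bc_0}\bigr)$.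 If $B_\Gamma=0$ (respectively $C_\Gamma=0$) the corresponding equation for $X$ (respectively $Y$) is linear, and $X_\Gamma$ (respectively $Y_\Gamma$) is its unique bounded solution. *)

theory Defs
  imports "HOL-Analysis.Analysis"
begin

section \<open>Complex Hilbert spaces\<close>

text \<open>
  Complex inner product spaces as a type class on top of the class of real inner product spaces:
  the complex structure extends the real one, and the real inner product is the real part of the
  complex one, so that \<open>(norm x)\<^sup>2 = \<langle>x, x\<rangle>\<close> and all of the library's metric
  and topological notions refer to the norm of the complex space.  The inner product is linear in
  the first argument.
\<close>

class complex_inner = real_inner +
  fixes scaleC :: "complex \<Rightarrow> 'a \<Rightarrow> 'a"  (infixr \<open>*\<^sub>C\<close> 75)
    and cinner :: "'a \<Rightarrow> 'a \<Rightarrow> complex"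
  assumes scaleC_add_right: "z *\<^sub>C (x + y) = z *\<^sub>C x + z *\<^sub>C y"
    and scaleC_add_left: "(z + w) *\<^sub>C x = z *\<^sub>C x + w *\<^sub>C x"
    and scaleC_scaleC: "z *\<^sub>C w *\<^sub>C x = (z * w) *\<^sub>C x"
    and scaleC_of_real: "complex_of_real r *\<^sub>C x = r *\<^sub>R x"
    and cinner_commute: "cinner x y = cnj (cinner y x)"
    and cinner_add_left: "cinner (x + y) u = cinner x u + cinner y u"
    and cinner_scaleC_left: "cinner (z *\<^sub>C x) y = z * cinner x y"
    and Re_cinner: "Re (cinner x y) = inner x y"

class chilbert_space = complex_inner + complete_space

text \<open>
  The space \<open>L\<^sup>2(\<Gamma> \<rightarrow> \<hh>)\<close> depends on the contour and hence cannot be a type.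
  The following record describes a (pre-)Hilbert space with an explicit carrier; operators between
  such spaces are functions of which only the values on the carrier matter.
\<close>

record 'v hilb =
  hcarrier :: "'v set"
  hzero :: 'v
  hadd :: "'v \<Rightarrow> 'v \<Rightarrow> 'v"
  hscale :: "complex \<Rightarrow> 'v \<Rightarrow> 'v"
  hip :: "'v \<Rightarrow> 'v \<Rightarrow> complex"

definition hnorm :: "'v hilb \<Rightarrow> 'v \<Rightarrow> real" where
  "hnorm H x = sqrt (Re (hip H x x))"

definition whole :: "'a::complex_inner hilb" where
  "whole = \<lparr>hcarrier = UNIV, hzero = 0, hadd = (+), hscale = scaleC, hip = cinner\<rparr>"

definition hsum :: "'v hilb \<Rightarrow> 'w hilb \<Rightarrow> ('v \<times> 'w) hilb" where
  "hsum H K =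
     \<lparr>hcarrier = hcarrier H \<times> hcarrier K,
      hzero = (hzero H, hzero K),
      hadd = (\<lambda>(x, y) (x', y'). (hadd H x x', hadd K y y')),
      hscale = (\<lambda>z (x, y). (hscale H z x, hscale K z y)),
      hip = (\<lambda>(x, y) (x', y'). hip H x x' + hip K y y')\<rparr>"


section \<open>Bounded operators\<close>

definition bounded_ops :: "'v hilb \<Rightarrow> 'w hilb \<Rightarrow> ('v \<Rightarrow> 'w) set" where
  "bounded_ops H K =
     {T. (\<forall>x\<in>hcarrier H. T x \<in> hcarrier K)
       \<and> (\<forall>x\<in>hcarrier H. \<forall>y\<in>hcarrier H. T (hadd H x y) = hadd K (T x) (T y))
       \<and> (\<forall>z. \<forall>x\<in>hcarrier H. T (hscale H z x) = hscale K z (T x))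
       \<and> (\<exists>M. \<forall>x\<in>hcarrier H. hnorm K (T x) \<le> M * hnorm H x)}"

definition opnorm :: "'v hilb \<Rightarrow> 'w hilb \<Rightarrow> ('v \<Rightarrow> 'w) \<Rightarrow> real" where
  "opnorm H K T = (SUP x\<in>{x \<in> hcarrier H. hnorm H x \<le> 1}. hnorm K (T x))"

definition adjoint_op :: "'v hilb \<Rightarrow> 'w hilb \<Rightarrow> ('v \<Rightarrow> 'w) \<Rightarrow> 'w \<Rightarrow> 'v" where
  "adjoint_op H K T =
     (SOME T'. T' \<in> bounded_ops K H \<and>
        (\<forall>x\<in>hcarrier H. \<forall>y\<in>hcarrier K. hip K (T x) y = hip H x (T' y)))"

definition op_add :: "'w hilb \<Rightarrow> ('v \<Rightarrow> 'w) \<Rightarrow> ('v \<Rightarrow> 'w) \<Rightarrow> 'v \<Rightarrow> 'w" where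
  "op_add K S T = (\<lambda>x. hadd K (S x) (T x))"

definition op_diff :: "'w hilb \<Rightarrow> ('v \<Rightarrow> 'w) \<Rightarrow> ('v \<Rightarrow> 'w) \<Rightarrow> 'v \<Rightarrow> 'w" where
  "op_diff K S T = (\<lambda>x. hadd K (S x) (hscale K (-1) (T x)))"

definition op_zero :: "'w hilb \<Rightarrow> 'v \<Rightarrow> 'w" where
  "op_zero K = (\<lambda>_. hzero K)"

definition op_eq :: "'v hilb \<Rightarrow> ('v \<Rightarrow> 'w) \<Rightarrow> ('v \<Rightarrow> 'w) \<Rightarrow> bool" where
  "op_eq H S T \<longleftrightarrow> (\<forall>x\<in>hcarrier H. S x = T x)"

definition op_inv :: "'v hilb \<Rightarrow> ('v \<Rightarrow> 'v) \<Rightarrow> 'v \<Rightarrow> 'v" where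
  "op_inv H T = inv_into (hcarrier H) T"

definition boundedly_invertible :: "'v hilb \<Rightarrow> ('v \<Rightarrow> 'v) \<Rightarrow> bool" where
  "boundedly_invertible H T \<longleftrightarrow>
     T \<in> bounded_ops H H \<and> bij_betw T (hcarrier H) (hcarrier H) \<and> op_inv H T \<in> bounded_ops H H"

definition op_spectrum :: "'v hilb \<Rightarrow> ('v \<Rightarrow> 'v) \<Rightarrow> complex set" where
  "op_spectrum H T = {z. \<not> boundedly_invertible H (op_diff H T (hscale H z))}"

definition self_adjoint_op :: "'v hilb \<Rightarrow> ('v \<Rightarrow> 'v) \<Rightarrow> bool" where
  "self_adjoint_op H T \<longleftrightarrow>
     T \<in> bounded_ops H H \<and> (\<forall>x\<in>hcarrier H. \<forall>y\<in>hcarrier H. hip H (T x) y = hip H x (T y))"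

text \<open>\<open>block_op H K P Q R S\<close> is the operator matrix with rows \<open>(P, Q)\<close> and
  \<open>(R, S)\<close> on \<open>hsum H K\<close>.\<close>

definition block_op ::
  "'v hilb \<Rightarrow> 'w hilb \<Rightarrow> ('v \<Rightarrow> 'v) \<Rightarrow> ('w \<Rightarrow> 'v) \<Rightarrow> ('v \<Rightarrow> 'w) \<Rightarrow> ('w \<Rightarrow> 'w)
     \<Rightarrow> 'v \<times> 'w \<Rightarrow> 'v \<times> 'w" where
  "block_op H K P Q R S = (\<lambda>(x, y). (hadd H (P x) (Q y), hadd K (R x) (S y)))"

text \<open>
  \<open>X \<in> \<B>(H, K)\<close> solves \<open>X A - D X + X B X = C\<close>.  The second Riccati equation
  \<open>Y D - A Y + Y C Y = B\<close> for \<open>Y \<in> \<B>(K, H)\<close> is \<open>riccati_solution K H D C B A Y\<close>.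
\<close>

definition riccati_solution ::
  "'v hilb \<Rightarrow> 'w hilb \<Rightarrow> ('v \<Rightarrow> 'v) \<Rightarrow> ('w \<Rightarrow> 'v) \<Rightarrow> ('v \<Rightarrow> 'w) \<Rightarrow> ('w \<Rightarrow> 'w)
     \<Rightarrow> ('v \<Rightarrow> 'w) \<Rightarrow> bool" where
  "riccati_solution H K A B C D X \<longleftrightarrow>
     X \<in> bounded_ops H K \<and>
     op_eq H (op_add K (op_diff K (X \<circ> A) (D \<circ> X)) (X \<circ> B \<circ> X)) C"


section \<open>Operator-valued holomorphic functions\<close>

text \<open>
  The library's bounded linear functions are real-linear; their norm is the operator norm.  For
  functions whose values are complex-linear, complex differentiability in the operator norm is
  Frechet differentiability with a derivative that is homogeneous over \<open>\<complex>\<close>.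
\<close>

definition op_holomorphic_on ::
  "(complex \<Rightarrow> 'a::complex_inner \<Rightarrow>\<^sub>L 'b::complex_inner) \<Rightarrow> complex set \<Rightarrow> bool" where
  "op_holomorphic_on F S \<longleftrightarrow>
     (\<forall>z\<in>S. blinfun_apply (F z) \<in> bounded_ops whole whole) \<and>
     (\<forall>z\<in>S. \<exists>L. (F has_derivative L) (at z) \<and>
        (\<forall>v w x. blinfun_apply (L (v * w)) x = v *\<^sub>C blinfun_apply (L w) x))"


section \<open>Contours\<close>

definition signed_part :: "complex set \<Rightarrow> real \<Rightarrow> complex set" where
  "signed_part D s = {z \<in> D. s * Im z > 0}"

definition open_interval :: "real \<Rightarrow> real \<Rightarrow> complex set" where
  "open_interval \<alpha> \<beta> = complex_of_real ` {\<alpha><..<\<beta>}"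

text \<open>
  On each closed piece the path is continuously differentiable up to the end points with
  nonvanishing derivative.  This is stricter than the library's \<^const>\<open>valid_path\<close>, which
  constrains neither the length nor the behaviour of the derivative at the break points.
\<close>

definition piecewise_smooth :: "(real \<Rightarrow> complex) \<Rightarrow> bool" where
  "piecewise_smooth \<gamma> \<longleftrightarrow>
     path \<gamma> \<and>
     (\<exists>P. finite P \<and> {0, 1} \<subseteq> P \<and> P \<subseteq> {0..1} \<and>
       (\<forall>s\<in>P. \<forall>t\<in>P. s < t \<and> {s<..<t} \<inter> P = {} \<longrightarrow>
         (\<exists>\<gamma>'. continuous_on {s..t} \<gamma>' \<and>
            (\<forall>x\<in>{s..t}. (\<gamma> has_vector_derivative \<gamma>' x) (at x within {s..t}) \<and> \<gamma>' x \<noteq> 0))))"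

text \<open>
  The contour is given by a parametrization over \<open>[0, 1]\<close>; its path image contains the end
  points.  The region enclosed by the interval and the contour is the union of the bounded
  components of the complement of the closed curve they form.
\<close>

definition contour_of_sign ::
  "complex set \<Rightarrow> real \<Rightarrow> real \<Rightarrow> real \<Rightarrow> (real \<Rightarrow> complex) \<Rightarrow> bool" where
  "contour_of_sign D \<alpha> \<beta> s \<gamma> \<longleftrightarrow>
     arc \<gamma> \<and> piecewise_smooth \<gamma> \<and>
     pathstart \<gamma> = complex_of_real \<alpha> \<and> pathfinish \<gamma> = complex_of_real \<beta> \<and>
     \<gamma> ` {0<..<1} \<subseteq> signed_part D s \<union> open_interval \<alpha> \<beta> \<and>
     homotopic_paths
       (signed_part D s \<union> open_interval \<alpha> \<beta> \<union> {complex_of_real \<alpha>, complex_of_real \<beta>})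
       (linepath (complex_of_real \<alpha>) (complex_of_real \<beta>)) \<gamma> \<and>
     inside (closed_segment (complex_of_real \<alpha>) (complex_of_real \<beta>) \<union> path_image \<gamma>)
       \<subseteq> signed_part D s"

definition path_deriv :: "(real \<Rightarrow> complex) \<Rightarrow> real \<Rightarrow> complex" where
  "path_deriv \<gamma> t = vector_derivative \<gamma> (at t within {0..1})"

text \<open>The measure \<open>|d\<lambda>|\<close> on the contour.\<close>

definition arclength :: "(real \<Rightarrow> complex) \<Rightarrow> complex measure" where
  "arclength \<gamma> =
     distr (density (restrict_space lborel {0..1}) (\<lambda>t. ennreal (norm (path_deriv \<gamma> t)))) borel \<gamma>"


section \<open>The space of square-integrable functions on a contour\<close>

text \<open>Measurability in the sense of Bochner, since the target space need not be separable.\<close>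

definition strongly_measurable :: "'m measure \<Rightarrow> ('m \<Rightarrow> 'h::topological_space) \<Rightarrow> bool" where
  "strongly_measurable M f \<longleftrightarrow>
     (\<exists>s. (\<forall>n. simple_function M (s n)) \<and> (\<forall>x\<in>space M. (\<lambda>n. s n x) \<longlonglongrightarrow> f x))"

definition square_integrable :: "'m measure \<Rightarrow> ('m \<Rightarrow> 'h::real_normed_vector) \<Rightarrow> bool" where
  "square_integrable M f \<longleftrightarrow>
     strongly_measurable M f \<and> integrable M (\<lambda>x. (norm (f x))\<^sup>2)"

text \<open>
  The strongly measurable functions in the class of \<open>f\<close> modulo equality almost everywhere.
  The function \<open>f\<close> itself may be arbitrary on a null set, such as the complement of
  the contour or its two end points.
\<close>

definition ae_class ::
  "(real \<Rightarrow> complex) \<Rightarrow> (complex \<Rightarrow> 'h::topological_space) \<Rightarrow> (complex \<Rightarrow> 'h) set" where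
  "ae_class \<gamma> f =
     {g. strongly_measurable (arclength \<gamma>) g \<and> (AE z in arclength \<gamma>. g z = f z)}"

definition rep :: "(complex \<Rightarrow> 'h) set \<Rightarrow> complex \<Rightarrow> 'h" where
  "rep F = (SOME f. f \<in> F)"

definition L2 :: "(real \<Rightarrow> complex) \<Rightarrow> (complex \<Rightarrow> 'h::complex_inner) set hilb" where
  "L2 \<gamma> =
     \<lparr>hcarrier = ae_class \<gamma> ` {f. square_integrable (arclength \<gamma>) f},
      hzero = ae_class \<gamma> (\<lambda>_. 0),
      hadd = (\<lambda>F G. ae_class \<gamma> (\<lambda>z. rep F z + rep G z)),
      hscale = (\<lambda>w F. ae_class \<gamma> (\<lambda>z. w *\<^sub>C rep F z)),
      hip = (\<lambda>F G. LINT z|arclength \<gamma>. cinner (rep F z) (rep G z))\<rparr>"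


section \<open>The deformed operators\<close>

definition D_op ::
  "(real \<Rightarrow> complex) \<Rightarrow> (complex \<Rightarrow> 'h::complex_inner) set \<Rightarrow> (complex \<Rightarrow> 'h) set" where
  "D_op \<gamma> F = ae_class \<gamma> (\<lambda>z. z *\<^sub>C rep F z)"

definition C_op ::
  "(real \<Rightarrow> complex) \<Rightarrow> (complex \<Rightarrow> 'a::complex_inner \<Rightarrow>\<^sub>L 'h::complex_inner)
     \<Rightarrow> 'a \<Rightarrow> (complex \<Rightarrow> 'h) set" where
  "C_op \<gamma> \<cc> x = ae_class \<gamma> (\<lambda>z. blinfun_apply (\<cc> z) x)"

text \<open>The vector-valued analogue of the library's contour integral.\<close>

definition B_op ::
  "(real \<Rightarrow> complex) \<Rightarrow> (complex \<Rightarrow> 'h::complex_inner \<Rightarrow>\<^sub>L 'a::complex_inner)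
     \<Rightarrow> (complex \<Rightarrow> 'h) set \<Rightarrow> 'a" where
  "B_op \<gamma> \<bb> F =
     integral {0..1} (\<lambda>t. path_deriv \<gamma> t *\<^sub>C blinfun_apply (\<bb> (\<gamma> t)) (rep F (\<gamma> t)))"


section \<open>The norm with respect to the spectral measure\<close>

definition spectral_measure ::
  "(real \<Rightarrow> complex) \<Rightarrow> complex set \<Rightarrow> (complex \<Rightarrow> 'h::complex_inner) set \<Rightarrow> (complex \<Rightarrow> 'h) set" where
  "spectral_measure \<gamma> \<delta> F = ae_class \<gamma> (\<lambda>z. indicator \<delta> z *\<^sub>R rep F z)"

definition borel_systems :: "(real \<Rightarrow> complex) \<Rightarrow> (nat \<Rightarrow> complex set) set" where
  "borel_systems \<gamma> =
     {\<delta>. (\<forall>j. \<delta> j \<in> sets borel \<and> \<delta> j \<subseteq> path_image \<gamma>) \<and> disjoint_family \<delta>}"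

definition ennreal_sqrt :: "ennreal \<Rightarrow> ennreal" where
  "ennreal_sqrt x = (if x = \<infinity> then \<infinity> else ennreal (sqrt (enn2real x)))"

text \<open>
  The spectrum of \<open>D_op \<gamma>\<close> is the path image of \<open>\<gamma>\<close>.  A finite system of sets is a
  sequence that is eventually empty.
\<close>

definition E_norm ::
  "(real \<Rightarrow> complex) \<Rightarrow> ('a::complex_inner \<Rightarrow> (complex \<Rightarrow> 'h::complex_inner) set) \<Rightarrow> ennreal" where
  "E_norm \<gamma> S =
     ennreal_sqrt (SUP \<delta>\<in>borel_systems \<gamma>. \<Sum>j.
       ennreal (opnorm whole whole
         (adjoint_op whole (L2 \<gamma>) S \<circ> spectral_measure \<gamma> (\<delta> j) \<circ> S)))"

definition E_norm_dual ::
  "(real \<Rightarrow> complex) \<Rightarrow> ((complex \<Rightarrow> 'h::complex_inner) set \<Rightarrow> 'a::complex_inner) \<Rightarrow> ennreal" where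
  "E_norm_dual \<gamma> T = E_norm \<gamma> (adjoint_op (L2 \<gamma>) whole T)"

end

theory Submission
  imports Defs
begin

text \<open>
  Write \<open>d\<close> for the distance of the contour from the spectrum of \<open>A\<close>, and \<open>b\<close>, \<open>c\<close> for the norms of
  \<open>B\<close>, \<open>C\<close> with respect to the spectral measure.  The Riccati equations say exactly that \<open>I + Q\<close> and \<open>I - Q\<close>
  intertwine the block operator with the diagonal ones, so everything rests on the
  invertibility of \<open>I + Q\<close> and \<open>I - Q\<close>.  By the Schur complement formula both follow from that of \<open>I - Y X\<close>
  on the complete space of \<open>A\<close>, and for this it is enough that \<open>\<parallel>Y X\<parallel> < 1\<close>
  (\<open>Riccati_block_diagonalization\<close>).

  The bounds that single out the solutions are weaker than what is needed: \<open>b \<parallel>X\<parallel> < d - sqrt (b * c)\<close>, and the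
  same for \<open>Y\<close>.  They improve themselves.  Written as \<open>X (A + B X) - D X = C\<close>, the equation is linear
  in \<open>X\<close>.  For points \<open>\<mu>\<close> of the contour \<open>A - \<mu>\<close> is bounded below by \<open>d\<close>
  (\<open>self_adjoint_resolvent_bound\<close>) and \<open>\<parallel>B X\<parallel> \<le> b \<parallel>X\<parallel>\<close>, so the resolvent of \<open>A + B X\<close> at \<open>\<mu>\<close> has norm at
  most \<open>1 / (d - b \<parallel>X\<parallel>) < 1 / sqrt (b * c)\<close>.  The linear equation then gives \<open>\<parallel>X\<parallel> \<le> c / (d - b \<parallel>X\<parallel>) < c / sqrt (b * c)\<close>,
  and symmetrically \<open>\<parallel>Y\<parallel> < b / sqrt (b * c)\<close>; the product of the bounds is \<open>1\<close>
  (\<open>YX_strict_contraction\<close>).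

  The estimate of the solution of the linear equation by \<open>c\<close> times the resolvent norm
  (\<open>Sylvester_column_bound\<close>, \<open>Sylvester_row_bound\<close>) is where the spectral measure enters.
  On the spectral subspace of a small piece of the contour \<open>D\<close> is nearly a scalar \<open>\<mu>\<close>, so there \<open>X\<close> is nearly
  \<open>C\<close> times the resolvent at \<open>\<mu>\<close>.  Squaring, summing over the pieces and refining the partition yields the claim,
  because the squared norms of the pieces of \<open>C\<close> sum up to at most \<open>c\<^sup>2\<close>.

  The second half of the text verifies the concrete facts on which this rests: the
  square-integrable functions on the contour form an inner product space on which multiplication
  by indicator functions gives such partitions, the singularities at the end points
  are square integrable, and the deformed operators are bounded and have adjoints.  For the operator
  \<open>B\<close> this includes the existence of the gauge integral that defines it
  (\<open>strongly_measurable_integrable_on\<close>).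
\<close>

section \<open>Complex inner products and spaces with explicit carrier\<close>

instance chilbert_space \<subseteq> banach ..

lemma cinner_add_right: "cinner x (y + z) = cinner x y + cinner x (z::'a::complex_inner)"
  by (metis cinner_commute cinner_add_left complex_cnj_add)

lemma cinner_scaleC_right: "cinner x (w *\<^sub>C y) = cnj w * cinner x (y::'a::complex_inner)"
  by (metis cinner_commute cinner_scaleC_left complex_cnj_mult)

lemma scaleR_eq_scaleC: "r *\<^sub>R x = complex_of_real r *\<^sub>C (x::'a::complex_inner)"
  by (simp add: scaleC_of_real)

lemma scaleC_zero_left [simp]: "0 *\<^sub>C (x::'a::complex_inner) = 0"
  using scaleC_of_real[of 0 x] by simp

lemma scaleC_one [simp]: "1 *\<^sub>C (x::'a::complex_inner) = x"
  using scaleC_of_real[of 1 x] by simp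

lemma scaleC_minus_one: "(-1) *\<^sub>C (x::'a::complex_inner) = - x"
  using scaleC_of_real[of "-1" x] by simp

lemma scaleC_zero_right [simp]: "z *\<^sub>C (0::'a::complex_inner) = 0"
  using scaleC_add_right[of z 0 0] by simp

lemma scaleC_minus_left: "(- z) *\<^sub>C (x::'a::complex_inner) = - (z *\<^sub>C x)"
  by (metis mult_minus1 scaleC_minus_one scaleC_scaleC)

lemma scaleC_minus_right: "z *\<^sub>C (- x) = - (z *\<^sub>C (x::'a::complex_inner))"
  by (metis add_eq_0_iff scaleC_add_right scaleC_zero_right)

lemma scaleC_diff_right: "z *\<^sub>C (x - y) = z *\<^sub>C x - z *\<^sub>C (y::'a::complex_inner)"
  by (metis diff_conv_add_uminus scaleC_add_right scaleC_minus_right)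

lemma scaleC_diff_left: "(z - w) *\<^sub>C (y::'a::complex_inner) = z *\<^sub>C y - w *\<^sub>C y"
  by (metis diff_conv_add_uminus scaleC_add_left scaleC_minus_left)

lemma cinner_zero_left [simp]: "cinner 0 (x::'a::complex_inner) = 0"
  using cinner_add_left[of 0 0 x] by simp

lemma cinner_zero_right [simp]: "cinner (x::'a::complex_inner) 0 = 0"
  using cinner_add_right[of x 0 0] by simp

lemma cinner_minus_left: "cinner (- x) (y::'a::complex_inner) = - cinner x y"
  by (metis add_eq_0_iff cinner_add_left cinner_zero_left)

lemma cinner_minus_right: "cinner x (- y) = - cinner x (y::'a::complex_inner)"
  by (metis add_eq_0_iff cinner_add_right cinner_zero_right)

lemma cinner_diff_left: "cinner (x - z) (y::'a::complex_inner) = cinner x y - cinner z y"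
  by (metis cinner_add_left cinner_minus_left diff_conv_add_uminus)

lemma cinner_diff_right: "cinner x (y - z) = cinner x y - cinner x (z::'a::complex_inner)"
  by (metis cinner_add_right cinner_minus_right diff_conv_add_uminus)

lemma cinner_self: "cinner x (x::'a::complex_inner) = complex_of_real ((norm x)\<^sup>2)"
proof (rule complex_eqI)
  have "Im (cinner x x) = - Im (cinner x x)"
    using arg_cong[OF cinner_commute[of x x], of Im] by simp
  then show "Im (cinner x x) = Im (complex_of_real ((norm x)\<^sup>2))" by simp
qed (simp add: Re_cinner power2_norm_eq_inner)

text \<open>Vectors are equal when their inner products with all vectors agree.  This axiom stands in for the
  vector space laws: every identity between vectors becomes one between complex numbers.\<close>

locale prehilbert =
  fixes H :: "'v hilb"
  assumes zero_closed [simp]: "hzero H \<in> hcarrier H"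
    and add_closed [simp]: "x \<in> hcarrier H \<Longrightarrow> y \<in> hcarrier H \<Longrightarrow> hadd H x y \<in> hcarrier H"
    and scale_closed [simp]: "x \<in> hcarrier H \<Longrightarrow> hscale H z x \<in> hcarrier H"
    and hip_zero_left [simp]: "y \<in> hcarrier H \<Longrightarrow> hip H (hzero H) y = 0"
    and hip_add_left [simp]: "x \<in> hcarrier H \<Longrightarrow> x' \<in> hcarrier H \<Longrightarrow> y \<in> hcarrier H \<Longrightarrow>
           hip H (hadd H x x') y = hip H x y + hip H x' y"
    and hip_scale_left [simp]: "x \<in> hcarrier H \<Longrightarrow> y \<in> hcarrier H \<Longrightarrow>
           hip H (hscale H z x) y = z * hip H x y"
    and hip_commute: "x \<in> hcarrier H \<Longrightarrow> y \<in> hcarrier H \<Longrightarrow> hip H x y = cnj (hip H y x)"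
    and hip_self_nonneg: "x \<in> hcarrier H \<Longrightarrow> 0 \<le> Re (hip H x x)"
    and hip_separates: "x \<in> hcarrier H \<Longrightarrow> y \<in> hcarrier H \<Longrightarrow>
           (\<And>z. z \<in> hcarrier H \<Longrightarrow> hip H x z = hip H y z) \<Longrightarrow> x = y"
begin

lemma hip_add_right [simp]:
  "x \<in> hcarrier H \<Longrightarrow> x' \<in> hcarrier H \<Longrightarrow> y \<in> hcarrier H \<Longrightarrow>
     hip H y (hadd H x x') = hip H y x + hip H y x'"
  by (metis add_closed complex_cnj_add hip_add_left hip_commute)

lemma hip_scale_right [simp]:
  "x \<in> hcarrier H \<Longrightarrow> y \<in> hcarrier H \<Longrightarrow> hip H y (hscale H z x) = cnj z * hip H y x"
  by (metis complex_cnj_mult hip_commute hip_scale_left scale_closed)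

lemma hip_zero_right [simp]: "y \<in> hcarrier H \<Longrightarrow> hip H y (hzero H) = 0"
  by (metis complex_cnj_zero hip_commute hip_zero_left zero_closed)

lemma hip_self: "x \<in> hcarrier H \<Longrightarrow> hip H x x = complex_of_real ((hnorm H x)\<^sup>2)"
  by (metis complex_cnj_cancel_iff complex_is_Real_iff Reals_cnj_iff hip_commute hip_self_nonneg hnorm_def
      of_real_Re real_sqrt_pow2)

lemma hnorm_nonneg [simp]: "x \<in> hcarrier H \<Longrightarrow> 0 \<le> hnorm H x"
  by (simp add: hnorm_def hip_self_nonneg)

lemma hnorm_zero [simp]: "hnorm H (hzero H) = 0"
  by (simp add: hnorm_def)

lemma hnorm_power2: "x \<in> hcarrier H \<Longrightarrow> (hnorm H x)\<^sup>2 = Re (hip H x x)"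
  by (simp add: hnorm_def hip_self_nonneg)

lemma hnorm_scale [simp]: "x \<in> hcarrier H \<Longrightarrow> hnorm H (hscale H z x) = cmod z * hnorm H x"
proof -
  assume x: "x \<in> hcarrier H"
  have "(hnorm H (hscale H z x))\<^sup>2 = Re (z * cnj z * hip H x x)"
    using x by (simp add: hnorm_power2 algebra_simps)
  also have "\<dots> = (cmod z * hnorm H x)\<^sup>2"
    using x by (simp add: hip_self complex_norm_square[symmetric] power_mult_distrib flip: of_real_mult of_real_power)
  finally show ?thesis using x by (simp add: power2_eq_iff_nonneg)
qed

lemma Cauchy_Schwarz:
  assumes x: "x \<in> hcarrier H" and y: "y \<in> hcarrier H"
  shows "cmod (hip H x y) \<le> hnorm H x * hnorm H y"
proof -
  define a where "a = hip H x y"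
  have yx: "hip H y x = cnj a" unfolding a_def by (rule hip_commute[OF y x])
  have key: "0 \<le> (hnorm H x)\<^sup>2 - 2 * Re (cnj w * a) + (cmod w)\<^sup>2 * (hnorm H y)\<^sup>2" for w
  proof -
    have "0 \<le> Re (hip H (hadd H x (hscale H (-w) y)) (hadd H x (hscale H (-w) y)))"
      using x y by (intro hip_self_nonneg) auto
    also have "hip H (hadd H x (hscale H (-w) y)) (hadd H x (hscale H (-w) y)) =
        hip H x x - cnj w * a - cnj (cnj w * a) + w * cnj w * hip H y y"
      using x y by (simp add: yx a_def[symmetric] algebra_simps)
    finally show ?thesis
      using x y by (simp add: hip_self complex_norm_square[symmetric] algebra_simps flip: of_real_mult of_real_power)
  qed
  show ?thesis
  proof (cases "hnorm H y = 0")
    case True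
    have k2: "2 * t * (cmod a)\<^sup>2 \<le> (hnorm H x)\<^sup>2" for t
      using key[of "t *\<^sub>R a"] True
      by (simp add: cmod_def scaleR_conv_of_real power2_eq_square algebra_simps)
    have "cmod a = 0"
    proof (rule ccontr)
      assume n: "cmod a \<noteq> 0"
      have "2 * (((hnorm H x)\<^sup>2 + 1) / (2 * (cmod a)\<^sup>2)) * (cmod a)\<^sup>2 = (hnorm H x)\<^sup>2 + 1"
        using n by (simp add: field_simps)
      with k2[of "((hnorm H x)\<^sup>2 + 1) / (2 * (cmod a)\<^sup>2)"] show False by linarith
    qed
    then show ?thesis using True by (simp add: a_def)
  next
    case False
    define N where "N = (hnorm H y)\<^sup>2"
    have N: "N > 0" using False by (simp add: N_def)
    have "Re (cnj (a / N) * a) = (cmod a)\<^sup>2 / N"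
      by (simp add: cmod_def power2_eq_square add_divide_distrib)
    moreover have "(cmod (a / N))\<^sup>2 * N = (cmod a)\<^sup>2 / N"
      using N by (simp add: norm_divide power_divide power2_eq_square)
    ultimately have "(cmod a)\<^sup>2 / N \<le> (hnorm H x)\<^sup>2"
      using key[of "a / N"] unfolding N_def[symmetric] by linarith
    then have "(cmod a)\<^sup>2 \<le> (hnorm H x * hnorm H y)\<^sup>2"
      using N by (simp add: field_simps N_def)
    then show ?thesis using x y by (simp add: a_def power2_le_iff_abs_le)
  qed
qed

lemma hnorm_triangle:
  assumes x: "x \<in> hcarrier H" and y: "y \<in> hcarrier H"
  shows "hnorm H (hadd H x y) \<le> hnorm H x + hnorm H y"
proof -
  have "(hnorm H (hadd H x y))\<^sup>2 = Re (hip H x x + (hip H x y + cnj (hip H x y)) + hip H y y)"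
    using x y by (simp add: hnorm_power2 hip_commute[OF y x])
  also have "\<dots> \<le> (hnorm H x)\<^sup>2 + 2 * (hnorm H x * hnorm H y) + (hnorm H y)\<^sup>2"
    using x y Cauchy_Schwarz[OF x y] complex_Re_le_cmod[of "hip H x y"] by (simp add: hip_self)
  also have "\<dots> = (hnorm H x + hnorm H y)\<^sup>2" by (simp add: power2_eq_square algebra_simps)
  finally show ?thesis using x y by (simp add: power2_le_iff_abs_le)
qed

end

lemma prehilbert_whole: "prehilbert (whole :: 'a::complex_inner hilb)"
proof
  fix x y :: 'a
  assume *: "\<And>z. z \<in> hcarrier (whole::'a hilb) \<Longrightarrow> hip whole x z = hip whole y z"
  have "cinner (x - y) (x - y) = 0" using *[of "x - y"] by (simp add: whole_def cinner_diff_left)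
  then show "x = y" by (simp add: cinner_self)
qed (auto simp: whole_def cinner_add_left cinner_scaleC_left Re_cinner intro: cinner_commute)

lemma hnorm_whole [simp]: "hnorm whole (x::'a::complex_inner) = norm x"
  by (simp add: hnorm_def whole_def Re_cinner norm_eq_sqrt_inner)

lemma whole_simps [simp]: "hcarrier whole = UNIV" "hzero whole = 0" "hadd whole = (+)"
   "hscale whole = scaleC" "hip whole = cinner"
  by (simp_all add: whole_def)

lemma norm_scaleC [simp]: "norm (z *\<^sub>C x) = cmod z * norm (x::'a::complex_inner)"
  using prehilbert.hnorm_scale[OF prehilbert_whole, of x z] by simp

lemma norm_cinner: "cmod (cinner x y) \<le> norm x * norm (y::'a::complex_inner)"
  using prehilbert.Cauchy_Schwarz[OF prehilbert_whole, of x y] by simp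

lemma cinner_eqI: "(\<And>z. cinner x z = cinner y z) \<Longrightarrow> x = (y::'a::complex_inner)"
  using prehilbert.hip_separates[OF prehilbert_whole, of x y] by simp

lemma bounded_bilinear_cinner: "bounded_bilinear (cinner :: 'a::complex_inner \<Rightarrow> _)"
proof
  show "\<exists>K. \<forall>a b. norm (cinner a (b::'a)) \<le> norm a * norm b * K"
    by (intro exI[of _ 1]) (simp add: norm_cinner)
qed (simp_all add: cinner_add_left cinner_add_right scaleR_eq_scaleC cinner_scaleC_left
       cinner_scaleC_right scaleR_conv_of_real)

lemma bounded_bilinear_scaleC: "bounded_bilinear (scaleC :: complex \<Rightarrow> 'a::complex_inner \<Rightarrow> _)"
proof
  show "\<exists>K. \<forall>a b. norm (scaleC a (b::'a)) \<le> norm a * norm b * K"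
    by (intro exI[of _ 1]) simp
qed (simp_all add: scaleC_add_left scaleC_add_right scaleR_eq_scaleC scaleC_scaleC
       scaleR_conv_of_real mult.commute)

lemma prehilbert_hsum:
  assumes "prehilbert H" "prehilbert K"
  shows "prehilbert (hsum H K)"
proof -
  interpret H: prehilbert H by fact
  interpret K: prehilbert K by fact
  show ?thesis
  proof
    fix p q assume p: "p \<in> hcarrier (hsum H K)" and q: "q \<in> hcarrier (hsum H K)"
      and *: "\<And>z. z \<in> hcarrier (hsum H K) \<Longrightarrow> hip (hsum H K) p z = hip (hsum H K) q z"
    obtain x y x' y' where [simp]: "p = (x, y)" "q = (x', y')" by (cases p, cases q)
    have c: "x \<in> hcarrier H" "x' \<in> hcarrier H" "y \<in> hcarrier K" "y' \<in> hcarrier K"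
      using p q by (auto simp: hsum_def)
    have "x = x'"
    proof (rule H.hip_separates)
      fix z assume "z \<in> hcarrier H"
      with *[of "(z, hzero K)"] c show "hip H x z = hip H x' z" by (simp add: hsum_def)
    qed (use c in auto)
    moreover have "y = y'"
    proof (rule K.hip_separates)
      fix z assume "z \<in> hcarrier K"
      with *[of "(hzero H, z)"] c show "hip K y z = hip K y' z" by (simp add: hsum_def)
    qed (use c in auto)
    ultimately show "p = q" by simp
  next
    fix x y assume "x \<in> hcarrier (hsum H K)" "y \<in> hcarrier (hsum H K)"
    then show "hip (hsum H K) x y = cnj (hip (hsum H K) y x)"
      by (auto simp: hsum_def intro!: arg_cong2[of _ _ _ _ "(+)"] H.hip_commute K.hip_commute)
  qed (auto simp: hsum_def algebra_simps H.hip_self_nonneg K.hip_self_nonneg)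
qed

lemma opnorm_nonneg_and_bound:
  assumes "prehilbert H" "prehilbert K" and T: "T \<in> bounded_ops H K"
  shows opnorm_nonneg: "0 \<le> opnorm H K T"
    and opnorm_bound: "x \<in> hcarrier H \<Longrightarrow> hnorm K (T x) \<le> opnorm H K T * hnorm H x"
proof -
  interpret H: prehilbert H by fact
  interpret K: prehilbert K by fact
  obtain M where M: "\<And>x. x \<in> hcarrier H \<Longrightarrow> hnorm K (T x) \<le> M * hnorm H x"
    and cl: "\<And>x. x \<in> hcarrier H \<Longrightarrow> T x \<in> hcarrier K"
    and sc: "\<And>x z. x \<in> hcarrier H \<Longrightarrow> T (hscale H z x) = hscale K z (T x)"
    using T unfolding bounded_ops_def by blast
  have bdd: "bdd_above ((\<lambda>x. hnorm K (T x)) ` {x \<in> hcarrier H. hnorm H x \<le> 1})"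
  proof (rule bdd_aboveI2)
    fix x assume "x \<in> {x \<in> hcarrier H. hnorm H x \<le> 1}"
    then have x: "x \<in> hcarrier H" "hnorm H x \<le> 1" by auto
    have "M * hnorm H x \<le> \<bar>M\<bar> * 1" using x by (intro mult_mono) auto
    with M[OF x(1)] show "hnorm K (T x) \<le> \<bar>M\<bar>" by simp
  qed
  have up: "hnorm K (T x) \<le> opnorm H K T" if "x \<in> hcarrier H" "hnorm H x \<le> 1" for x
    unfolding opnorm_def using that by (intro cSUP_upper[OF _ bdd]) auto
  show nn: "0 \<le> opnorm H K T"
    using up[of "hzero H"] K.hnorm_nonneg[OF cl[of "hzero H"]] by (simp add: order_trans)
  show "hnorm K (T x) \<le> opnorm H K T * hnorm H x" if x: "x \<in> hcarrier H"
  proof (cases "hnorm H x = 0")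
    case True then show ?thesis using M[OF x] by simp
  next
    case False
    with x have p: "hnorm H x > 0" using H.hnorm_nonneg[OF x] by linarith
    have "hnorm K (T (hscale H (complex_of_real (1 / hnorm H x)) x)) \<le> opnorm H K T"
      using x p by (intro up) (auto simp: norm_divide)
    then show ?thesis using x p by (simp add: sc cl norm_divide field_simps)
  qed
qed

lemma opnorm_le:
  assumes "prehilbert H" "M \<ge> 0" "\<And>x. x \<in> hcarrier H \<Longrightarrow> hnorm K (T x) \<le> M * hnorm H x"
  shows "opnorm H K T \<le> M"
proof -
  interpret H: prehilbert H by fact
  show ?thesis
    unfolding opnorm_def
  proof (rule cSUP_least)
    show "{x \<in> hcarrier H. hnorm H x \<le> 1} \<noteq> {}"
      using H.zero_closed by (auto intro!: exI[of _ "hzero H"])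
    fix x assume "x \<in> {x \<in> hcarrier H. hnorm H x \<le> 1}"
    then have x: "x \<in> hcarrier H" "hnorm H x \<le> 1" by auto
    have "M * hnorm H x \<le> M * 1" using x assms by (intro mult_left_mono) auto
    with assms(3)[OF x(1)] show "hnorm K (T x) \<le> M" by simp
  qed
qed

section \<open>Riesz representation and adjoints\<close>

lemma bounded_opsD:
  assumes "T \<in> bounded_ops H K"
  shows bounded_ops_closed: "x \<in> hcarrier H \<Longrightarrow> T x \<in> hcarrier K"
    and bounded_ops_add: "x \<in> hcarrier H \<Longrightarrow> y \<in> hcarrier H \<Longrightarrow> T (hadd H x y) = hadd K (T x) (T y)"
    and bounded_ops_scale: "x \<in> hcarrier H \<Longrightarrow> T (hscale H z x) = hscale K z (T x)"
    and bounded_ops_bound: "\<exists>M. \<forall>x\<in>hcarrier H. hnorm K (T x) \<le> M * hnorm H x"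
  using assms unfolding bounded_ops_def by blast+

lemma bounded_opsI:
  assumes "\<And>x. x \<in> hcarrier H \<Longrightarrow> T x \<in> hcarrier K"
    and "\<And>x y. x \<in> hcarrier H \<Longrightarrow> y \<in> hcarrier H \<Longrightarrow> T (hadd H x y) = hadd K (T x) (T y)"
    and "\<And>x z. x \<in> hcarrier H \<Longrightarrow> T (hscale H z x) = hscale K z (T x)"
    and "\<And>x. x \<in> hcarrier H \<Longrightarrow> hnorm K (T x) \<le> M * hnorm H x"
  shows "T \<in> bounded_ops H K"
  using assms unfolding bounded_ops_def by blast

lemma parallelogram: "(norm (x - y))\<^sup>2 = 2 * (norm x)\<^sup>2 + 2 * (norm y)\<^sup>2 - (norm (x + y :: 'a::real_inner))\<^sup>2"
  by (simp add: power2_norm_eq_inner algebra_simps inner_commute)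

lemma power2_norm_diff: "(norm (x - y))\<^sup>2 = (norm x)\<^sup>2 - 2 * inner x y + (norm (y :: 'a::real_inner))\<^sup>2"
  by (simp add: power2_norm_eq_inner algebra_simps inner_commute)

text \<open>The representing vector minimizes \<open>\<parallel>x\<parallel>\<^sup>2 - 2 \<phi> x\<close>.  A minimizing sequence is Cauchy by the
  parallelogram law, and the minimality at \<open>v + t x\<close> for a small multiple \<open>t\<close> gives the representation.\<close>

lemma Riesz_real:
  fixes \<phi> :: "'a::{real_inner, complete_space} \<Rightarrow> real"
  assumes "bounded_linear \<phi>"
  obtains v where "\<And>x. \<phi> x = inner x v"
proof -
  interpret bounded_linear \<phi> by fact
  obtain K where K: "K > 0" "\<And>x. norm (\<phi> x) \<le> norm x * K" using pos_bounded by blast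
  define J where "J x = (norm x)\<^sup>2 - 2 * \<phi> x" for x
  have lb: "- K\<^sup>2 \<le> J x" for x
  proof -
    have "2 * \<phi> x \<le> 2 * (norm x * K)" using K(2)[of x] by auto
    moreover have "0 \<le> (norm x - K)\<^sup>2" by simp
    ultimately show ?thesis by (simp add: J_def power2_eq_square algebra_simps)
  qed
  define m where "m = (INF x. J x)"
  have bb: "bdd_below (range J)" using lb by (intro bdd_belowI2)
  have mle: "m \<le> J x" for x unfolding m_def by (rule cINF_lower[OF bb]) simp
  have "\<exists>x. J x < m + 1 / real (Suc n)" for n
  proof -
    have "(INF x. J x) < m + 1 / real (Suc n)" by (simp add: m_def)
    then show ?thesis using cINF_less_iff[OF _ bb] by auto
  qed
  then obtain u where u: "\<And>n. J (u n) < m + 1 / real (Suc n)" by metis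
  \<comment> \<open>The parallelogram law bounds the distance of two almost minimizers; their midpoint cannot undercut \<open>m\<close>.\<close>
  have cl: "(norm (x - y))\<^sup>2 \<le> 2 * (J x - m) + 2 * (J y - m)" for x y
  proof -
    have "J ((1/2) *\<^sub>R (x + y)) = (norm (x + y))\<^sup>2 / 4 - \<phi> x - \<phi> y"
      by (simp add: J_def scale add power_divide add_divide_distrib)
    with mle[of "(1/2) *\<^sub>R (x + y)"] have "4 * m \<le> (norm (x + y))\<^sup>2 - 4 * \<phi> x - 4 * \<phi> y" by simp
    then show ?thesis unfolding parallelogram J_def by simp
  qed
  have aux: "N \<le> 2 * (p - m) + 2 * (q - m) \<Longrightarrow> p < m + E / 4 \<Longrightarrow> q < m + E / 4 \<Longrightarrow> N < E" for N p q E :: real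
    by (simp add: field_simps)
  have "Cauchy u"
  proof (rule metric_CauchyI)
    fix e :: real assume e: "e > 0"
    obtain N where N: "1 / real (Suc N) < e\<^sup>2 / 4" using reals_Archimedean[of "e\<^sup>2/4"] e
      by (auto simp: inverse_eq_divide)
    have "dist (u i) (u j) < e" if ij: "i \<ge> N" "j \<ge> N" for i j
    proof -
      have "1 / real (Suc i) \<le> 1 / real (Suc N)" "1 / real (Suc j) \<le> 1 / real (Suc N)"
        using ij by (auto intro!: divide_left_mono)
      then have "J (u i) < m + e\<^sup>2 / 4" "J (u j) < m + e\<^sup>2 / 4"
        using u[of i] u[of j] N by (auto intro: less_trans dest: order_le_less_trans)
      then have "(norm (u i - u j))\<^sup>2 < e\<^sup>2"
        using cl[of "u i" "u j"] aux by blast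
      then show ?thesis using e by (simp add: dist_norm power2_less_imp_less)
    qed
    then show "\<exists>M. \<forall>m\<ge>M. \<forall>n\<ge>M. dist (u m) (u n) < e" by blast
  qed
  then obtain v where v: "u \<longlonglongrightarrow> v" using Cauchy_convergent_iff convergent_def by blast
  have "(\<lambda>n. J (u n)) \<longlonglongrightarrow> J v" unfolding J_def by (intro tendsto_intros v tendsto)
  moreover have "(\<lambda>n. m + 1 / real (Suc n)) \<longlonglongrightarrow> m + 0"
    by (intro tendsto_intros LIMSEQ_Suc[OF lim_1_over_n])
  ultimately have "J v \<le> m + 0"
    by (rule LIMSEQ_le) (use u less_imp_le in blast)
  then have Jv: "J v \<le> J x" for x using mle[of x] by simp
  have "\<phi> x = inner x v" for x
  proof (rule ccontr)
    define a where "a = inner x v - \<phi> x"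
    assume "\<phi> x \<noteq> inner x v"
    then have a: "a \<noteq> 0" by (simp add: a_def)
    define q where "q = (norm x)\<^sup>2 + 1"
    have q: "q > 0" by (simp add: q_def add_nonneg_pos)
    have ex: "J (v + t *\<^sub>R x) = J v + 2 * t * a + t\<^sup>2 * (norm x)\<^sup>2" for t
      using power2_norm_diff[of v "- (t *\<^sub>R x)"]
      by (simp add: J_def a_def add scale inner_commute power_mult_distrib algebra_simps)
    \<comment> \<open>Almost the minimizer of the right-hand side of \<open>ex\<close>; \<open>q > 0\<close> also for \<open>x = 0\<close>.\<close>
    define t where "t = - (a / q)"
    have "0 \<le> 2 * t * a + t\<^sup>2 * (norm x)\<^sup>2" using Jv[of "v + t *\<^sub>R x"] ex[of t] by simp
    also have "\<dots> \<le> 2 * t * a + t\<^sup>2 * q" by (simp add: q_def mult_left_mono)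
    also have "\<dots> = - (a\<^sup>2 / q)" using q by (simp add: t_def power2_eq_square field_simps)
    also have "\<dots> < 0" using a q by simp
    finally show False by simp
  qed
  then show ?thesis using that by blast
qed

text \<open>The real part of \<open>\<phi>\<close> is represented first; its value at \<open>- \<i> x\<close> is the imaginary part of \<open>\<phi> x\<close>.\<close>

lemma Riesz:
  fixes \<phi> :: "'a::chilbert_space \<Rightarrow> complex"
  assumes add: "\<And>x y. \<phi> (x + y) = \<phi> x + \<phi> y" and scale: "\<And>z x. \<phi> (z *\<^sub>C x) = z * \<phi> x"
    and bd: "\<And>x. cmod (\<phi> x) \<le> M * norm x"
  obtains v where "\<And>x. \<phi> x = cinner x v"
proof -
  have "bounded_linear (\<lambda>x. Re (\<phi> x))"
  proof (rule bounded_linear_intro)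
    show "norm (Re (\<phi> x)) \<le> norm x * M" for x
      using bd[of x] abs_Re_le_cmod[of "\<phi> x"] by (simp add: mult.commute)
  qed (simp_all add: add scaleR_eq_scaleC scale)
  then obtain v where v: "\<And>x. Re (\<phi> x) = inner x v" using Riesz_real by blast
  have "\<phi> x = cinner x v" for x
  proof (rule complex_eqI)
    show "Re (\<phi> x) = Re (cinner x v)" by (simp add: v Re_cinner)
    show "Im (\<phi> x) = Im (cinner x v)"
      using v[of "(- \<i>) *\<^sub>C x"] by (simp add: scale cinner_scaleC_left flip: Re_cinner)
  qed
  then show ?thesis using that by blast
qed

text \<open>For fixed \<open>y\<close> the functional \<open>x \<mapsto> \<langle>T x, y\<rangle>\<close> is represented by a vector of
  the complete domain.\<close>

lemma adjoint_exists:
  fixes T :: "'a::chilbert_space \<Rightarrow> 'w"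
  assumes K: "prehilbert K" and T: "T \<in> bounded_ops whole K"
  obtains T' where "T' \<in> bounded_ops K whole"
     "\<And>x y. y \<in> hcarrier K \<Longrightarrow> hip K (T x) y = cinner x (T' y)"
proof -
  interpret K: prehilbert K by fact
  note Tc [simp] = bounded_ops_closed[OF T, simplified]
  note Ta = bounded_ops_add[OF T, simplified]
  note Ts = bounded_ops_scale[OF T, simplified]
  define M where "M = opnorm whole K T"
  have M: "hnorm K (T x) \<le> M * norm x" "M \<ge> 0" for x
    using opnorm_bound[OF prehilbert_whole K T] opnorm_nonneg[OF prehilbert_whole K T] by (auto simp: M_def)
  have "\<exists>v. \<forall>x. hip K (T x) y = cinner x v" if y: "y \<in> hcarrier K" for y
  proof -
    have "cmod (hip K (T x) y) \<le> M * hnorm K y * norm x" for x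
      using K.Cauchy_Schwarz[of "T x" y] y mult_right_mono[OF M(1)[of x], of "hnorm K y"]
      by (simp add: mult_ac)
    then show ?thesis
      using y by - (rule Riesz[of "\<lambda>x. hip K (T x) y" "M * hnorm K y"], auto simp: Ta Ts)
  qed
  then obtain T' where T': "\<And>x y. y \<in> hcarrier K \<Longrightarrow> hip K (T x) y = cinner x (T' y)" by metis
  have T'2: "cinner (T' y) x = cnj (hip K (T x) y)" if "y \<in> hcarrier K" for x y
    by (metis T' cinner_commute that)
  have "T' \<in> bounded_ops K whole"
  proof (rule bounded_opsI)
    fix x y z assume x: "x \<in> hcarrier K"
    { assume y: "y \<in> hcarrier K"
      show "T' (hadd K x y) = hadd whole (T' x) (T' y)"
        by (rule cinner_eqI) (use x y in \<open>simp add: cinner_add_left T'2\<close>) }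
    show "T' (hscale K z x) = hscale whole z (T' x)"
      by (rule cinner_eqI) (use x in \<open>simp add: cinner_scaleC_left T'2\<close>)
    have "(norm (T' x))\<^sup>2 = cmod (hip K (T (T' x)) x)"
      using x by (simp add: T' cinner_self norm_power del: of_real_power)
    also have "\<dots> \<le> (M * norm (T' x)) * hnorm K x"
 
      using x by (intro order_trans[OF K.Cauchy_Schwarz] mult_right_mono M(1)) auto
    finally have "norm (T' x) * norm (T' x) \<le> M * hnorm K x * norm (T' x)"
      by (simp add: power2_eq_square mult_ac)
    then show "hnorm whole (T' x) \<le> M * hnorm K x"
      using x M(2) by (cases "T' x = 0") auto
  qed auto
  then show ?thesis using that T' by blast
qed

lemma adjoint_op:
  assumes "T' \<in> bounded_ops K H"
     "\<And>x y. x \<in> hcarrier H \<Longrightarrow> y \<in> hcarrier K \<Longrightarrow> hip K (T x) y = hip H x (T' y)"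
  shows "adjoint_op H K T \<in> bounded_ops K H"
    and "x \<in> hcarrier H \<Longrightarrow> y \<in> hcarrier K \<Longrightarrow> hip K (T x) y = hip H x (adjoint_op H K T y)"
proof -
  have "\<exists>T'. T' \<in> bounded_ops K H \<and>
        (\<forall>x\<in>hcarrier H. \<forall>y\<in>hcarrier K. hip K (T x) y = hip H x (T' y))" using assms by blast
  from someI_ex[OF this] show "adjoint_op H K T \<in> bounded_ops K H"
    "x \<in> hcarrier H \<Longrightarrow> y \<in> hcarrier K \<Longrightarrow> hip K (T x) y = hip H x (adjoint_op H K T y)"
    unfolding adjoint_op_def by blast+
qed

section \<open>The resolvent of a self-adjoint operator\<close>

lemma boundedly_invertible_bounded_below:
  fixes T :: "'a::complex_inner \<Rightarrow> 'a"
  assumes "boundedly_invertible whole T"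
  obtains k where "k > 0" "\<And>u. k * norm u \<le> norm (T u)"
proof -
  let ?S = "op_inv whole T"
  have S: "?S \<in> bounded_ops whole whole" and b: "bij T"
    using assms by (auto simp: boundedly_invertible_def)
  obtain M where M: "\<And>x. norm (?S x) \<le> M * norm x" using bounded_ops_bound[OF S] by auto
  have ST: "?S (T u) = u" for u using b by (simp add: op_inv_def bij_is_inj)
  have "norm u \<le> (\<bar>M\<bar> + 1) * norm (T u)" for u
  proof -
    have "norm u \<le> M * norm (T u)" using M[of "T u"] by (simp add: ST)
    also have "\<dots> \<le> (\<bar>M\<bar> + 1) * norm (T u)" by (intro mult_right_mono) auto
    finally show ?thesis .
  qed
  then show ?thesis by (intro that[of "1 / (\<bar>M\<bar> + 1)"]) (auto simp: field_simps)
qed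

text \<open>This is the Cauchy-Schwarz inequality of the semidefinite form \<open>inner (P x) y\<close>, in the guise
  of its nonnegativity at \<open>u - P u / M\<close>.\<close>

lemma positive_operator_norm_le:
  fixes P :: "'a::complex_inner \<Rightarrow> 'a"
  assumes add: "\<And>x y. P (x + y) = P x + P y" and scale: "\<And>r x. P (r *\<^sub>R x) = r *\<^sub>R P x"
    and sym: "\<And>x y. inner (P x) y = inner x (P y)" and pos: "\<And>x. 0 \<le> inner (P x) x"
    and bd: "\<And>x. norm (P x) \<le> M * norm x" and "M > 0"
  shows "(norm (P u))\<^sup>2 \<le> M * inner (P u) u"
proof -
  define w where "w = P u"
  \<comment> \<open>The minimizer of the quadratic bound on the right-hand side below.\<close>
  define t where "t = - (1 / M)"
  have "0 \<le> inner (P (u + t *\<^sub>R w)) (u + t *\<^sub>R w)" by (rule pos)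
  also have "\<dots> = inner w u + 2 * t * (norm w)\<^sup>2 + t\<^sup>2 * inner (P w) w"
    using sym[of w u, symmetric]
    by (simp add: add scale w_def[symmetric] inner_add_left inner_add_right power2_norm_eq_inner inner_commute
        power2_eq_square[of t] algebra_simps)
  also have "inner (P w) w \<le> M * (norm w)\<^sup>2"
    using Cauchy_Schwarz_ineq2[of "P w" w] mult_right_mono[OF bd[of w], of "norm w"]
    by (simp add: power2_eq_square mult_ac)
  then have "t\<^sup>2 * inner (P w) w \<le> t\<^sup>2 * (M * (norm w)\<^sup>2)" by (simp add: mult_left_mono)
  also have "t\<^sup>2 * (M * (norm w)\<^sup>2) = (norm w)\<^sup>2 / M"
    using \<open>M > 0\<close> by (simp add: t_def power2_eq_square)
  finally have "0 \<le> inner w u - (norm w)\<^sup>2 / M" by (simp add: t_def)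
  then show ?thesis using \<open>M > 0\<close> by (simp add: w_def field_simps)
qed

text \<open>Since the spectrum is real, only the real part \<open>a\<close> of \<open>\<mu>\<close> matters up to the Pythagorean theorem.  Let
  \<open>T = A - a\<close> and let \<open>m\<close> be the infimum of \<open>\<parallel>T u\<parallel>\<close> over unit vectors.  Then \<open>a + m\<close> or \<open>a - m\<close> is in the
  spectrum: otherwise \<open>P = T\<^sup>2 - m\<^sup>2 = (T - m) (T + m)\<close> is bounded below, but \<open>P\<close> is positive, and
  \<open>\<parallel>P u\<parallel>\<^sup>2 \<le> \<parallel>P\<parallel> (\<parallel>T u\<parallel>\<^sup>2 - m\<^sup>2 \<parallel>u\<parallel>\<^sup>2)\<close> would increase \<open>m\<close>.\<close>

lemma self_adjoint_resolvent_bound: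
  fixes A :: "'a::chilbert_space \<Rightarrow> 'a"
  assumes A: "self_adjoint_op whole A" and real_spec: "op_spectrum whole A \<subseteq> \<real>"
    and dist: "\<And>z. z \<in> op_spectrum whole A \<Longrightarrow> d \<le> dist \<mu> z" and "d \<ge> 0"
  shows "d * norm u \<le> norm (A u - \<mu> *\<^sub>C u)"
proof -
  have Ab: "A \<in> bounded_ops whole whole" and sa: "\<And>x y. cinner (A x) y = cinner x (A y)"
    using A by (auto simp: self_adjoint_op_def)
  note Aa = bounded_ops_add[OF Ab, simplified]
  note As = bounded_ops_scale[OF Ab, simplified]
  have Am: "A (x - y) = A x - A y" for x y
    using Aa[of x "-y"] As[of "-1" y] by (simp add: scaleC_minus_one)
  obtain MA where MA: "\<And>x. norm (A x) \<le> MA * norm x" using bounded_ops_bound[OF Ab] by auto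
  define a where "a = Re \<mu>"
  define T where "T x = A x - a *\<^sub>R x" for x
  have Ta: "T (x + y) = T x + T y" "T (x - y) = T x - T y" for x y
     by (simp_all add: T_def Aa Am algebra_simps)
  have Ts: "T (r *\<^sub>R x) = r *\<^sub>R T x" for r x
     by (simp add: T_def scaleR_eq_scaleC As scaleC_diff_right scaleC_scaleC mult.commute)
  have Tsym: "inner (T x) y = inner x (T y)" for x y
    using arg_cong[OF sa[of x y], of Re] by (simp add: T_def inner_diff_left inner_diff_right Re_cinner)
  define MT where "MT = \<bar>MA\<bar> + \<bar>a\<bar>"
  have MT: "norm (T x) \<le> MT * norm x" for x
  proof -
    have "norm (T x) \<le> norm (A x) + \<bar>a\<bar> * norm x" unfolding T_def by (metis norm_triangle_ineq4 norm_scaleR)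
    also have "norm (A x) \<le> \<bar>MA\<bar> * norm x" by (rule order_trans[OF MA]) (simp add: mult_right_mono)
    finally show ?thesis by (simp add: MT_def algebra_simps)
  qed
  define m where "m = (INF u\<in>{u. norm u = 1}. norm (T u))"
  show ?thesis
  proof (cases "u = 0")
    case False
    have bb: "bdd_below ((\<lambda>u. norm (T u)) ` {u. norm u = 1})" by (rule bdd_belowI2[of _ 0]) simp
    have ne: "{u::'a. norm u = 1} \<noteq> {}" using False by (auto intro!: exI[of _ "u /\<^sub>R norm u"])
    have m0: "m \<ge> 0" unfolding m_def by (rule cINF_greatest[OF ne]) simp
    have mT: "m * norm x \<le> norm (T x)" for x
    proof (cases "x = 0")
      case F: False
      have "m \<le> norm (T (x /\<^sub>R norm x))" unfolding m_def by (rule cINF_lower[OF bb]) (use F in simp)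
      then show ?thesis using F by (simp add: Ts field_simps)
    qed simp
    define P where "P x = T (T x) - (m\<^sup>2) *\<^sub>R x" for x
    have Pform: "inner (P x) x = (norm (T x))\<^sup>2 - m\<^sup>2 * (norm x)\<^sup>2" for x
      by (simp add: P_def inner_diff_left Tsym power2_norm_eq_inner)
    \<comment> \<open>The summand \<open>1\<close> keeps the bound positive.\<close>
    define MP where "MP = MT\<^sup>2 + m\<^sup>2 + 1"
    have MP: "MP > 0" unfolding MP_def by (simp add: add_nonneg_pos)
    have Pn: "(norm (P x))\<^sup>2 \<le> MP * inner (P x) x" for x
    proof (rule positive_operator_norm_le)
      fix x y r
      show "P (x + y) = P x + P y" "P (r *\<^sub>R x) = r *\<^sub>R P x"
        by (simp_all add: P_def Ta Ts algebra_simps)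
      show "inner (P x) y = inner x (P y)" by (simp add: P_def algebra_simps Tsym)
      show "0 \<le> inner (P x) x" using mT[of x] m0
        by (simp add: Pform power_mult_distrib[symmetric] power_mono)
      have "norm (P x) \<le> norm (T (T x)) + m\<^sup>2 * norm x" unfolding P_def
        using norm_triangle_ineq4[of "T (T x)" "m\<^sup>2 *\<^sub>R x"] by simp
      also have "norm (T (T x)) \<le> MT * (MT * norm x)"
        by (rule order_trans[OF MT]) (intro mult_left_mono MT, simp add: MT_def)
      finally have "norm (P x) \<le> MT\<^sup>2 * norm x + m\<^sup>2 * norm x" by (simp add: power2_eq_square mult.assoc)
      then show "norm (P x) \<le> MP * norm x" unfolding MP_def distrib_right using norm_ge_zero[of x] by linarith
    qed (rule MP)
    have inv: "\<exists>k>0. \<forall>u. k * norm u \<le> norm (T u - r *\<^sub>R u)" if "complex_of_real (a + r) \<notin> op_spectrum whole A" for r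
    proof -
      have "boundedly_invertible whole (op_diff whole A (hscale whole (complex_of_real (a + r))))"
        using that by (simp add: op_spectrum_def)
      from boundedly_invertible_bounded_below[OF this] obtain k where "k > 0"
         "\<And>u. k * norm u \<le> norm (op_diff whole A (hscale whole (complex_of_real (a + r))) u)" by metis
      then show ?thesis
        by (intro exI[of _ k]) (simp add: op_diff_def scaleC_minus_one T_def scaleC_of_real algebra_simps del: of_real_add)
    qed
    have "complex_of_real (a + m) \<in> op_spectrum whole A \<or> complex_of_real (a + (- m)) \<in> op_spectrum whole A"
    proof (rule ccontr)
      assume n: "\<not> ?thesis"
      obtain k where k: "k > 0" "\<And>u. k * norm u \<le> norm (T u - m *\<^sub>R u)" using inv[of m] n by blast
      obtain l where l: "l > 0" "\<And>u. l * norm u \<le> norm (T u - (-m) *\<^sub>R u)" using inv[of "-m"] n by blast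
      have Pk: "k * l * norm x \<le> norm (P x)" for x
      proof -
        have "P x = T (T x - (-m) *\<^sub>R x) - m *\<^sub>R (T x - (-m) *\<^sub>R x)"
          by (simp add: P_def Ta Ts algebra_simps power2_eq_square)
        then have "k * norm (T x - (-m) *\<^sub>R x) \<le> norm (P x)" using k(2) by metis
        moreover have "k * (l * norm x) \<le> k * norm (T x - (-m) *\<^sub>R x)" using k l(2) by (intro mult_left_mono) auto
        ultimately show ?thesis by (simp add: mult_ac)
      qed
      \<comment> \<open>A lower bound for \<open>\<parallel>T v\<parallel>\<close> on unit vectors that exceeds the infimum \<open>m\<close>.\<close>
      define q where "q = sqrt (m\<^sup>2 + (k * l)\<^sup>2 / MP)"
      have "q \<le> m" unfolding m_def
      proof (rule cINF_greatest[OF ne])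
        fix v :: 'a assume "v \<in> {u. norm u = 1}"
        then have v: "norm v = 1" by simp
        have "(k * l)\<^sup>2 \<le> (norm (P v))\<^sup>2" using Pk[of v] k l v by (intro power_mono) auto
        also have "\<dots> \<le> MP * ((norm (T v))\<^sup>2 - m\<^sup>2)" using Pn[of v] v by (simp add: Pform)
        finally have "m\<^sup>2 + (k * l)\<^sup>2 / MP \<le> (norm (T v))\<^sup>2" using MP by (simp add: field_simps)
        then show "q \<le> norm (T v)" unfolding q_def by (intro real_le_lsqrt) auto
      qed
      then have "m\<^sup>2 + (k * l)\<^sup>2 / MP \<le> m\<^sup>2" unfolding q_def by (rule sqrt_le_D)
      moreover have "(k * l)\<^sup>2 / MP > 0" using k l MP by simp
      ultimately show False by simp
    qed
    then obtain r where r: "complex_of_real (a + r) \<in> op_spectrum whole A" "\<bar>r\<bar> = m"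
    proof (elim disjE)
      assume "complex_of_real (a + m) \<in> op_spectrum whole A" then show ?thesis using m0 that[of m] by simp
    next
      assume "complex_of_real (a + - m) \<in> op_spectrum whole A" then show ?thesis using m0 that[of "-m"] by simp
    qed
    have "d \<le> cmod (\<mu> - complex_of_real (a + r))" using dist[OF r(1)] by (simp add: dist_norm)
    also have "\<dots> = sqrt (m\<^sup>2 + (Im \<mu>)\<^sup>2)" by (simp add: cmod_def a_def flip: r(2))
    finally have dm: "d\<^sup>2 \<le> m\<^sup>2 + (Im \<mu>)\<^sup>2"
      using \<open>d \<ge> 0\<close> power_mono[of d "sqrt (m\<^sup>2 + (Im \<mu>)\<^sup>2)" 2] by simp
    have "\<mu> = complex_of_real a + \<i> * Im \<mu>" by (simp add: a_def complex_eq[symmetric])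
    then have e: "A u - \<mu> *\<^sub>C u = T u - (\<i> * Im \<mu>) *\<^sub>C u"
      by (metis T_def diff_diff_eq scaleC_add_left scaleC_of_real)
    have "Im (cinner (T u) u) = 0"
    proof -
      have "cinner (T u) u = cinner u (T u)" by (simp add: T_def cinner_diff_left cinner_diff_right sa scaleR_eq_scaleC cinner_scaleC_left cinner_scaleC_right)
      then have "Im (cinner (T u) u) = - Im (cinner (T u) u)"
        using arg_cong[OF cinner_commute[of "T u" u], of Im] by simp
      then show ?thesis by simp
    qed
    then have i0: "inner (T u) ((\<i> * Im \<mu>) *\<^sub>C u) = 0"
      by (simp add: cinner_scaleC_right flip: Re_cinner)
    have "(norm (A u - \<mu> *\<^sub>C u))\<^sup>2 = (norm (T u))\<^sup>2 + (Im \<mu>)\<^sup>2 * (norm u)\<^sup>2"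
      unfolding e power2_norm_diff[of "T u"] using i0 by (simp add: norm_mult power_mult_distrib)
    also have "\<dots> \<ge> m\<^sup>2 * (norm u)\<^sup>2 + (Im \<mu>)\<^sup>2 * (norm u)\<^sup>2"
      using mT[of u] m0 by (simp add: power_mult_distrib[symmetric] power_mono)
    finally have "d\<^sup>2 * (norm u)\<^sup>2 \<le> (norm (A u - \<mu> *\<^sub>C u))\<^sup>2"
      using mult_right_mono[OF dm, of "(norm u)\<^sup>2"] by (simp add: algebra_simps)
    then show ?thesis using \<open>d \<ge> 0\<close> by (simp add: power_mult_distrib[symmetric] power2_le_iff_abs_le)
  qed (use Am[of 0 0] in simp)
qed

section \<open>Estimates for solutions of Sylvester equations\<close>

text \<open>A solution \<open>g\<close> is a fixed point of \<open>g \<mapsto> T\<inverse> (f - V g)\<close>, which is a contraction with constant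
  \<open>t / d\<close>.  The lemma serves for resolvents of the perturbed operators and for \<open>I - Y X\<close>.\<close>

lemma small_perturbation_surj:
  fixes T V :: "'a::banach \<Rightarrow> 'a"
  assumes T: "\<And>x y. T (x - y) = T x - T y" "\<And>u. d * norm u \<le> norm (T u)" "surj T"
    and V: "\<And>x y. V (x - y) = V x - V y" "\<And>u. norm (V u) \<le> t * norm u"
    and t: "0 \<le> t" "t < d"
  shows "\<exists>g. T g + V g = f \<and> (d - t) * norm g \<le> norm f"
proof -
  define R where "R = inv T"
  have TR: "T (R x) = x" for x using T(3) by (simp add: R_def surj_f_inv_f)
  have "\<exists>!g. R (f - V g) = g"
  proof (rule banach_fix_type)
    show "0 \<le> t / d" "t / d < 1" using t by auto
    show "\<forall>x y. dist (R (f - V x)) (R (f - V y)) \<le> t / d * dist x y"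
    proof (intro allI)
      fix x y
      have "d * norm (R (f - V x) - R (f - V y)) \<le> norm (V (y - x))"
        using T(2)[of "R (f - V x) - R (f - V y)"] by (simp add: T(1) V(1) TR)
      also have "\<dots> \<le> t * norm (x - y)" using V(2)[of "y - x"] by (simp add: norm_minus_commute)
      finally show "dist (R (f - V x)) (R (f - V y)) \<le> t / d * dist x y"
        using t by (simp add: dist_norm field_simps)
    qed
  qed
  then obtain g where g: "R (f - V g) = g" by blast
  have eq: "T g + V g = f" using TR[of "f - V g"] g by simp
  have "d * norm g \<le> norm (f - V g)" using T(2)[of g] eq by (metis add_diff_cancel_right')
  also have "\<dots> \<le> norm f + t * norm g" using norm_triangle_ineq4[of f "V g"] V(2)[of g] by linarith
  finally show ?thesis using eq by (intro exI[of _ g]) (simp add: algebra_simps)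
qed

text \<open>The discrete form of a spectral decomposition of \<open>D\<close>: finitely many orthogonal projections
  that commute with \<open>D\<close> and sum to the identity, on each of which \<open>D\<close> is within \<open>\<epsilon>\<close> of a scalar.
  The estimates refer to the space over the contour only through such partitions.\<close>

locale spectral_partition = prehilbert H for H :: "'w hilb" +
  fixes D :: "'w \<Rightarrow> 'w" and \<epsilon> :: real and n :: nat and E :: "nat \<Rightarrow> 'w \<Rightarrow> 'w" and l :: "nat \<Rightarrow> complex"
  assumes D: "D \<in> bounded_ops H H" and \<epsilon>: "\<epsilon> \<ge> 0"
    and E: "j < n \<Longrightarrow> E j \<in> bounded_ops H H"
    and E_sym: "j < n \<Longrightarrow> x \<in> hcarrier H \<Longrightarrow> y \<in> hcarrier H \<Longrightarrow> hip H (E j x) y = hip H x (E j y)"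
    and E_idem: "j < n \<Longrightarrow> x \<in> hcarrier H \<Longrightarrow> E j (E j x) = E j x"
    and E_sum: "x \<in> hcarrier H \<Longrightarrow> y \<in> hcarrier H \<Longrightarrow> (\<Sum>j<n. hip H (E j x) y) = hip H x y"
    and E_comm: "j < n \<Longrightarrow> x \<in> hcarrier H \<Longrightarrow> E j (D x) = D (E j x)"
    and D_near: "j < n \<Longrightarrow> x \<in> hcarrier H \<Longrightarrow>
       hnorm H (hadd H (D (E j x)) (hscale H (- l j) (E j x))) \<le> \<epsilon> * hnorm H (E j x)"
begin

lemma prehilbert_H: "prehilbert H" ..

lemma E_closed [simp]: "j < n \<Longrightarrow> x \<in> hcarrier H \<Longrightarrow> E j x \<in> hcarrier H"
  using E by (rule bounded_ops_closed)

lemma D_closed [simp]: "x \<in> hcarrier H \<Longrightarrow> D x \<in> hcarrier H"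
  using D by (rule bounded_ops_closed)

lemma Pythagoras: "x \<in> hcarrier H \<Longrightarrow> (\<Sum>j<n. (hnorm H (E j x))\<^sup>2) = (hnorm H x)\<^sup>2"
proof -
  assume x: "x \<in> hcarrier H"
  have "(hnorm H (E j x))\<^sup>2 = Re (hip H (E j x) x)" if "j < n" for j
    using x that E_sym[of j "E j x" x] by (simp add: hnorm_power2 E_idem)
  then have "(\<Sum>j<n. (hnorm H (E j x))\<^sup>2) = Re (\<Sum>j<n. hip H (E j x) x)" by simp
  then show ?thesis using x by (simp add: E_sum hnorm_power2)
qed

lemma hnorm_E_le: "j < n \<Longrightarrow> x \<in> hcarrier H \<Longrightarrow> hnorm H (E j x) \<le> hnorm H x"
proof -
  assume j: "j < n" and x: "x \<in> hcarrier H"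
  have "(hnorm H (E j x))\<^sup>2 \<le> (\<Sum>j<n. (hnorm H (E j x))\<^sup>2)"
    using j by (intro member_le_sum) auto
  then show ?thesis using x j by (simp add: Pythagoras power2_le_iff_abs_le)
qed

lemma column_bound:
  assumes S: "\<And>f. S f \<in> hcarrier H" and s: "\<And>j f. j < n \<Longrightarrow> hnorm H (E j (S f)) \<le> s j * norm (f::'a::real_normed_vector)"
    and sum: "(\<Sum>j<n. (s j)\<^sup>2) \<le> c\<^sup>2" and "c \<ge> 0"
  shows "hnorm H (S f) \<le> c * norm f"
proof -
  have "(hnorm H (S f))\<^sup>2 = (\<Sum>j<n. (hnorm H (E j (S f)))\<^sup>2)" by (simp add: Pythagoras S)
  also have "\<dots> \<le> (\<Sum>j<n. (s j * norm f)\<^sup>2)" by (intro sum_mono power_mono s) (auto simp: S)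
  also have "\<dots> = (\<Sum>j<n. (s j)\<^sup>2) * (norm f)\<^sup>2" by (simp add: power_mult_distrib sum_distrib_right)
  also have "\<dots> \<le> (c * norm f)\<^sup>2" unfolding power_mult_distrib by (intro mult_right_mono sum) auto
  finally show ?thesis using \<open>c \<ge> 0\<close> by (simp add: power2_le_iff_abs_le S)
qed

text \<open>The vector \<open>\<Sum>j<n. E j x\<close> has no notation in a space with explicit carrier; partial sums are
  therefore characterized by their inner products.\<close>

lemma E_decompose:
  assumes T: "T \<in> bounded_ops H (whole :: 'a::complex_inner hilb)" and x: "x \<in> hcarrier H"
  shows "T x = (\<Sum>j<n. T (E j x))"
proof -
  have "\<exists>p\<in>hcarrier H. (\<forall>z\<in>hcarrier H. hip H p z = (\<Sum>j<m. hip H (E j x) z)) \<and> T p = (\<Sum>j<m. T (E j x))"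
    if "m \<le> n" for m using that
  proof (induction m)
    case 0
    have "T (hscale H 0 (hzero H)) = 0 *\<^sub>C T (hzero H)" using bounded_ops_scale[OF T zero_closed, of 0] by simp
    also have "hscale H 0 (hzero H) = hzero H" by (rule hip_separates) auto
    finally show ?case by (intro bexI[of _ "hzero H"]) auto
  next
    case (Suc m)
    then obtain p where p: "p \<in> hcarrier H" "\<forall>z\<in>hcarrier H. hip H p z = (\<Sum>j<m. hip H (E j x) z)"
       "T p = (\<Sum>j<m. T (E j x))" by auto
    have "m < n" using Suc by simp
    then show ?case using p x bounded_ops_add[OF T p(1), of "E m x"]
      by (intro bexI[of _ "hadd H p (E m x)"]) auto
  qed
  from this[of n] obtain p where p: "p \<in> hcarrier H" "\<forall>z\<in>hcarrier H. hip H p z = (\<Sum>j<n. hip H (E j x) z)"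
       "T p = (\<Sum>j<n. T (E j x))" by auto
  have "p = x" by (rule hip_separates) (use p x in \<open>auto simp: E_sum\<close>)
  then show ?thesis using p by simp
qed

lemma row_bound:
  assumes T: "T \<in> bounded_ops H (whole :: 'a::complex_inner hilb)" and x: "x \<in> hcarrier H"
    and s: "\<And>j x. j < n \<Longrightarrow> x \<in> hcarrier H \<Longrightarrow> norm (T (E j x)) \<le> s j * hnorm H (E j x)"
    and sum: "(\<Sum>j<n. (s j)\<^sup>2) \<le> c\<^sup>2" and "c \<ge> 0"
  shows "norm (T x) \<le> c * hnorm H x"
proof -
  have "norm (T x) \<le> (\<Sum>j<n. norm (T (E j x)))" unfolding E_decompose[OF T x] by (rule norm_sum)
  also have "\<dots> \<le> (\<Sum>j<n. s j * hnorm H (E j x))" by (intro sum_mono s) (use x in auto)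
  also have "\<dots> \<le> sqrt ((c * hnorm H x)\<^sup>2)"
  proof (rule real_le_rsqrt)
    have "(\<Sum>j<n. s j * hnorm H (E j x))\<^sup>2 \<le> (\<Sum>j<n. (s j)\<^sup>2) * (\<Sum>j<n. (hnorm H (E j x))\<^sup>2)"
      by (rule Cauchy_Schwarz_ineq_sum)
    also have "\<dots> \<le> (c * hnorm H x)\<^sup>2"
      unfolding power_mult_distrib Pythagoras[OF x] by (intro mult_right_mono sum) auto
    finally show "(\<Sum>j<n. s j * hnorm H (E j x))\<^sup>2 \<le> (c * hnorm H x)\<^sup>2" .
  qed
  also have "\<dots> = c * hnorm H x" using \<open>c \<ge> 0\<close> x by simp
  finally show ?thesis .
qed

text \<open>Cutting \<open>X Z - D X = C\<close> with \<open>E j\<close> gives \<open>E j X (Z - l j) = E j C + (D - l j) E j X\<close>.  Composing with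
  a right inverse of \<open>Z - l j\<close> of norm at most \<open>r\<close> bounds \<open>\<parallel>E j X\<parallel>\<close> by \<open>(a + \<epsilon> \<parallel>E j X\<parallel>) r\<close>, and the
  term with \<open>\<epsilon>\<close> is absorbed on the left.\<close>

lemma column_piece_bound:
  fixes X C :: "'a::complex_inner \<Rightarrow> 'w"
  assumes X: "X \<in> bounded_ops whole H" and C: "\<And>f. C f \<in> hcarrier H"
    and eq: "\<And>f. X (Z f) = hadd H (C f) (D (X f))" and j: "j < n"
    and a: "\<And>f. hnorm H (E j (C f)) \<le> a * norm f" "a \<ge> 0"
    and surj: "\<And>f. \<exists>g. Z g - l j *\<^sub>C g = f \<and> norm g \<le> r * norm f" and r: "r \<ge> 0" "\<epsilon> * r < 1"
  shows "hnorm H (E j (X f)) \<le> a * r / (1 - \<epsilon> * r) * norm f"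
proof -
  note Xc [simp] = bounded_ops_closed[OF X, simplified] and [simp] = C j
  have EX: "E j \<circ> X \<in> bounded_ops whole H"
  proof (rule bounded_opsI)
    fix x
    show "hnorm H ((E j \<circ> X) x) \<le> opnorm whole H X * hnorm whole x"
      using order_trans[OF hnorm_E_le opnorm_bound[OF prehilbert_whole prehilbert_H X, of x]] by simp
  qed (use bounded_ops_add[OF X] bounded_ops_scale[OF X] bounded_ops_add[OF E[OF j]] bounded_ops_scale[OF E[OF j]] in auto)
  define s where "s = opnorm whole H (E j \<circ> X)"
  have s: "hnorm H (E j (X f)) \<le> s * norm f" "s \<ge> 0" for f
    using opnorm_bound[OF prehilbert_whole prehilbert_H EX, of f] opnorm_nonneg[OF prehilbert_whole prehilbert_H EX]
    by (auto simp: s_def)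
  have "s \<le> (a + \<epsilon> * s) * r"
    unfolding s_def
  proof (rule opnorm_le[OF prehilbert_whole], fold s_def)
    show "0 \<le> (a + \<epsilon> * s) * r" using a s r \<epsilon> by simp
    fix f :: 'a
    obtain g where g: "Z g - l j *\<^sub>C g = f" "norm g \<le> r * norm f" using surj by blast
    \<comment> \<open>The vector \<open>(D - l j) E j X g\<close>, which is small.\<close>
    let ?w = "hadd H (D (E j (X g))) (hscale H (- l j) (E j (X g)))"
    have "X f = X (Z g + (- l j) *\<^sub>C g)" using g by (simp add: scaleC_minus_left)
    also have "\<dots> = hadd H (hadd H (C g) (D (X g))) (hscale H (- l j) (X g))"
      using bounded_ops_add[OF X, of "Z g" "(- l j) *\<^sub>C g"] bounded_ops_scale[OF X, of g "- l j"] by (simp add: eq)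
    finally have "E j (X f) = hadd H (hadd H (E j (C g)) (D (E j (X g)))) (hscale H (- l j) (E j (X g)))"
      using bounded_ops_add[OF E[OF j]] bounded_ops_scale[OF E[OF j]] by (simp add: E_comm)
    also have "\<dots> = hadd H (E j (C g)) ?w" by (rule hip_separates) auto
    finally have "hnorm H (E j (X f)) \<le> hnorm H (E j (C g)) + hnorm H ?w" by (simp add: hnorm_triangle)
    also have "\<dots> \<le> a * norm g + \<epsilon> * (s * norm g)"
      using \<epsilon> by (intro add_mono a order_trans[OF D_near] mult_left_mono s) auto
    also have "\<dots> = (a + \<epsilon> * s) * norm g" by (simp add: algebra_simps)
    also have "\<dots> \<le> (a + \<epsilon> * s) * (r * norm f)" using g(2) a s \<epsilon> by (intro mult_left_mono) auto
    finally show "hnorm H ((E j \<circ> X) f) \<le> (a + \<epsilon> * s) * r * hnorm whole f" by (simp add: mult_ac)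
  qed
  then have "s * (1 - \<epsilon> * r) \<le> a * r" by (simp add: algebra_simps)
  then have "s \<le> a * r / (1 - \<epsilon> * r)" using r by (simp add: pos_le_divide_eq)
  then show ?thesis using order_trans[OF s(1) mult_right_mono] norm_ge_zero by blast
qed

text \<open>The mirror image: \<open>Y D - Z Y = B\<close> on the range of \<open>E j\<close> reads
  \<open>(Z - l j) Y E j = Y (D - l j) E j - B E j\<close>, and now a lower bound of \<open>Z - l j\<close> suffices.\<close>

lemma row_piece_bound:
  fixes Y B :: "'w \<Rightarrow> 'a::complex_inner"
  assumes Y: "Y \<in> bounded_ops H whole"
    and eq: "\<And>x. x \<in> hcarrier H \<Longrightarrow> Y (D x) = Z (Y x) + B x" and j: "j < n"
    and a: "\<And>x. x \<in> hcarrier H \<Longrightarrow> norm (B (E j x)) \<le> a * hnorm H (E j x)" "a \<ge> 0"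
    and lower: "\<And>u. norm u \<le> r * norm (Z u - l j *\<^sub>C u)" and r: "r \<ge> 0" "\<epsilon> * r < 1"
    and x: "x \<in> hcarrier H"
  shows "norm (Y (E j x)) \<le> a * r / (1 - \<epsilon> * r) * hnorm H (E j x)"
proof -
  note [simp] = j
  have YE: "Y \<circ> E j \<in> bounded_ops H whole"
  proof (rule bounded_opsI)
    fix x assume x: "x \<in> hcarrier H"
    show "hnorm whole ((Y \<circ> E j) x) \<le> opnorm H whole Y * hnorm H x"
      using x opnorm_bound[OF prehilbert_H prehilbert_whole Y, of "E j x"]
         mult_left_mono[OF hnorm_E_le[OF j x] opnorm_nonneg[OF prehilbert_H prehilbert_whole Y]] by simp
  qed (use bounded_ops_add[OF Y] bounded_ops_scale[OF Y] bounded_ops_add[OF E[OF j]] bounded_ops_scale[OF E[OF j]] in auto)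
  define s where "s = opnorm H whole (Y \<circ> E j)"
  have s: "norm (Y (E j x)) \<le> s * hnorm H x" "s \<ge> 0" if "x \<in> hcarrier H" for x
    using opnorm_bound[OF prehilbert_H prehilbert_whole YE that] opnorm_nonneg[OF prehilbert_H prehilbert_whole YE]
    by (auto simp: s_def)
  have s0: "s \<ge> 0" using s zero_closed by blast
  have "s \<le> (a + \<epsilon> * s) * r"
    unfolding s_def
  proof (rule opnorm_le[OF prehilbert_H], fold s_def)
    show "0 \<le> (a + \<epsilon> * s) * r" using a s0 r \<epsilon> by simp
    fix x assume x [simp]: "x \<in> hcarrier H"
    let ?w = "hadd H (D (E j x)) (hscale H (- l j) (E j x))"
    have w: "?w \<in> hcarrier H" by simp
    have Ew: "E j ?w = ?w"
      using bounded_ops_add[OF E[OF j]] bounded_ops_scale[OF E[OF j]] by (simp add: E_comm E_idem)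
    have "Y ?w = Z (Y (E j x)) + B (E j x) - l j *\<^sub>C Y (E j x)"
      using bounded_ops_add[OF Y, of "D (E j x)"] bounded_ops_scale[OF Y, of "E j x"] by (simp add: eq scaleC_minus_left)
    then have "Z (Y (E j x)) - l j *\<^sub>C Y (E j x) = Y ?w - B (E j x)" by simp
    then have lw: "norm (Y (E j x)) \<le> r * norm (Y ?w - B (E j x))" using lower[of "Y (E j x)"] by simp
    have "norm (Y ?w - B (E j x)) \<le> s * (\<epsilon> * hnorm H (E j x)) + a * hnorm H (E j x)"
      using order_trans[OF s(1)[OF w] mult_left_mono[OF D_near[OF j x] s0]] a(1)[OF x] norm_triangle_ineq4[of "Y ?w" "B (E j x)"]
      by (simp add: Ew)
    also have "\<dots> = (a + \<epsilon> * s) * hnorm H (E j x)" by (simp add: algebra_simps)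
    also have "\<dots> \<le> (a + \<epsilon> * s) * hnorm H x" using a s0 \<epsilon> by (intro mult_left_mono hnorm_E_le) auto
    finally have "norm (Y ?w - B (E j x)) \<le> (a + \<epsilon> * s) * hnorm H x" .
    from order_trans[OF lw mult_left_mono[OF this r(1)]]
    show "hnorm whole ((Y \<circ> E j) x) \<le> (a + \<epsilon> * s) * r * hnorm H x" by (simp add: mult_ac)
  qed
  then have "s * (1 - \<epsilon> * r) \<le> a * r" by (simp add: algebra_simps)
  then have "s \<le> a * r / (1 - \<epsilon> * r)" using r by (simp add: pos_le_divide_eq)
  moreover have "norm (Y (E j x)) \<le> s * hnorm H (E j x)" using s(1)[of "E j x"] x by (simp add: E_idem)
  ultimately show ?thesis using x by (smt (verit) E_closed hnorm_nonneg j mult_right_mono)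
qed

end

text \<open>What remains of a finite norm with respect to the spectral measure: for arbitrarily fine
  partitions with scalars in \<open>\<Gamma>\<close>, the squared norms of the pieces sum up to at most \<open>c\<^sup>2\<close>.  A row bound is the
  dual notion for operators that leave the space of \<open>D\<close>.\<close>

definition column_E_bound where
  "column_E_bound H D \<Gamma> (C :: 'a::real_normed_vector \<Rightarrow> 'w) c \<longleftrightarrow> (\<forall>\<epsilon>>0. \<exists>n E l a. spectral_partition H D \<epsilon> n E l \<and>
     (\<forall>j<n. l j \<in> \<Gamma> \<and> 0 \<le> a j \<and> (\<forall>f. hnorm H (E j (C f)) \<le> a j * norm f)) \<and> (\<Sum>j<n. (a j)\<^sup>2) \<le> c\<^sup>2)"

definition row_E_bound where
  "row_E_bound H D \<Gamma> (B :: 'w \<Rightarrow> 'a::real_normed_vector) c \<longleftrightarrow> (\<forall>\<epsilon>>0. \<exists>n E l a. spectral_partition H D \<epsilon> n E l \<and>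
     (\<forall>j<n. l j \<in> \<Gamma> \<and> 0 \<le> a j \<and> (\<forall>x\<in>hcarrier H. norm (B (E j x)) \<le> a j * hnorm H (E j x))) \<and> (\<Sum>j<n. (a j)\<^sup>2) \<le> c\<^sup>2)"

lemma row_E_bound_norm:
  fixes B :: "'w \<Rightarrow> 'a::complex_inner"
  assumes "row_E_bound H D \<Gamma> B c" "B \<in> bounded_ops H whole" "x \<in> hcarrier H" "c \<ge> 0"
  shows "norm (B x) \<le> c * hnorm H x"
proof -
  obtain n E l a where *: "spectral_partition H D 1 n E l"
     "\<And>j. j < n \<Longrightarrow> 0 \<le> a j \<and> (\<forall>x\<in>hcarrier H. norm (B (E j x)) \<le> a j * hnorm H (E j x))" "(\<Sum>j<n. (a j)\<^sup>2) \<le> c\<^sup>2"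
    using assms(1) unfolding row_E_bound_def by (meson zero_less_one)
  show ?thesis using spectral_partition.row_bound[OF *(1) assms(2,3) _ *(3) assms(4)] *(2) by blast
qed

lemma column_E_bound_norm:
  fixes C :: "'a::complex_inner \<Rightarrow> 'w"
  assumes "column_E_bound H D \<Gamma> C c" "\<And>f. C f \<in> hcarrier H" "c \<ge> 0"
  shows "hnorm H (C x) \<le> c * norm x"
proof -
  obtain n E l a where *: "spectral_partition H D 1 n E l"
     "\<And>j. j < n \<Longrightarrow> 0 \<le> a j \<and> (\<forall>f. hnorm H (E j (C f)) \<le> a j * norm f)" "(\<Sum>j<n. (a j)\<^sup>2) \<le> c\<^sup>2"
    using assms(1) unfolding column_E_bound_def by (meson zero_less_one)
  show ?thesis using spectral_partition.column_bound[OF *(1), of C a c x] assms(2,3) * by blast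
qed

lemma le_of_le_shrunk:
  fixes u v r :: real
  assumes "\<And>\<epsilon>. \<epsilon> > 0 \<Longrightarrow> \<epsilon> * r < 1 \<Longrightarrow> u \<le> v / (1 - \<epsilon> * r)" "r \<ge> 0"
  shows "u \<le> v"
proof (rule tendsto_lowerbound)
  show "((\<lambda>\<epsilon>. v / (1 - \<epsilon> * r)) \<longlongrightarrow> v) (at_right 0)"
    by (auto intro!: tendsto_eq_intros)
  have "eventually (\<lambda>\<epsilon>. \<epsilon> * r < 1) (at_right 0)"
    by (rule order_tendstoD[of _ 0]) (auto intro!: tendsto_eq_intros)
  then show "\<forall>\<^sub>F \<epsilon> in at_right 0. u \<le> v / (1 - \<epsilon> * r)"
    using eventually_at_right_less[of 0] by eventually_elim (use assms in auto)
qed simp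

text \<open>The pieces are estimated with the factor \<open>r / (1 - \<epsilon> r)\<close> for every partition, and \<open>\<epsilon>\<close> tends to \<open>0\<close>.\<close>

lemma Sylvester_column_bound:
  fixes X C :: "'a::complex_inner \<Rightarrow> 'w"
  assumes X: "X \<in> bounded_ops whole H" and C: "\<And>f. C f \<in> hcarrier H" "column_E_bound H D \<Gamma> C c" "c \<ge> 0"
    and eq: "\<And>f. X (Z f) = hadd H (C f) (D (X f))"
    and surj: "\<And>f \<mu>. \<mu> \<in> \<Gamma> \<Longrightarrow> \<exists>g. Z g - \<mu> *\<^sub>C g = f \<and> norm g \<le> r * norm f" and r: "r \<ge> 0"
  shows "hnorm H (X f) \<le> c * r * norm f"
proof (rule le_of_le_shrunk[OF _ r])
  fix \<epsilon> :: real assume e: "\<epsilon> > 0" "\<epsilon> * r < 1"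
  obtain n E l a where *: "spectral_partition H D \<epsilon> n E l"
     "\<And>j. j < n \<Longrightarrow> l j \<in> \<Gamma> \<and> 0 \<le> a j \<and> (\<forall>f. hnorm H (E j (C f)) \<le> a j * norm f)" "(\<Sum>j<n. (a j)\<^sup>2) \<le> c\<^sup>2"
    using C(2) e(1) unfolding column_E_bound_def by blast
  interpret spectral_partition H D \<epsilon> n E l by fact
  define q where "q = r / (1 - \<epsilon> * r)"
  have "hnorm H (X f) \<le> c * q * norm f"
  proof (rule column_bound)
    show "hnorm H (E j (X f)) \<le> a j * q * norm f" if "j < n" for j f
      using column_piece_bound[OF X C(1) eq that _ _ surj r e(2)] *(2)[OF that] by (simp add: q_def)
    show "(\<Sum>j<n. (a j * q)\<^sup>2) \<le> (c * q)\<^sup>2"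
      unfolding power_mult_distrib sum_distrib_right[symmetric] by (intro mult_right_mono *) auto
  qed (use bounded_ops_closed[OF X] r e \<open>c \<ge> 0\<close> in \<open>auto simp: q_def\<close>)
  then show "hnorm H (X f) \<le> c * r * norm f / (1 - \<epsilon> * r)" by (simp add: q_def)
qed

lemma Sylvester_row_bound:
  fixes Y B :: "'w \<Rightarrow> 'a::complex_inner"
  assumes Y: "Y \<in> bounded_ops H whole" and B: "row_E_bound H D \<Gamma> B c" "c \<ge> 0"
    and eq: "\<And>x. x \<in> hcarrier H \<Longrightarrow> Y (D x) = Z (Y x) + B x"
    and lower: "\<And>u \<mu>. \<mu> \<in> \<Gamma> \<Longrightarrow> norm u \<le> r * norm (Z u - \<mu> *\<^sub>C u)" and r: "r \<ge> 0"
    and x: "x \<in> hcarrier H"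
  shows "norm (Y x) \<le> c * r * hnorm H x"
proof (rule le_of_le_shrunk[OF _ r])
  fix \<epsilon> :: real assume e: "\<epsilon> > 0" "\<epsilon> * r < 1"
  obtain n E l a where *: "spectral_partition H D \<epsilon> n E l"
     "\<And>j. j < n \<Longrightarrow> l j \<in> \<Gamma> \<and> 0 \<le> a j \<and> (\<forall>x\<in>hcarrier H. norm (B (E j x)) \<le> a j * hnorm H (E j x))" "(\<Sum>j<n. (a j)\<^sup>2) \<le> c\<^sup>2"
    using B(1) e(1) unfolding row_E_bound_def by blast
  interpret spectral_partition H D \<epsilon> n E l by fact
  define q where "q = r / (1 - \<epsilon> * r)"
  have "norm (Y x) \<le> c * q * hnorm H x"
  proof (rule row_bound[OF Y x])
    show "norm (Y (E j x)) \<le> a j * q * hnorm H (E j x)" if "j < n" "x \<in> hcarrier H" for j x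
      using row_piece_bound[OF Y eq that(1) _ _ lower r e(2) that(2)] *(2)[OF that(1)] by (simp add: q_def)
    show "(\<Sum>j<n. (a j * q)\<^sup>2) \<le> (c * q)\<^sup>2"
      unfolding power_mult_distrib sum_distrib_right[symmetric] by (intro mult_right_mono *) auto
  qed (use r e \<open>c \<ge> 0\<close> in \<open>auto simp: q_def\<close>)
  then show "norm (Y x) \<le> c * r * hnorm H x / (1 - \<epsilon> * r)" by (simp add: q_def)
qed

section \<open>Block operators\<close>

lemma bounded_ops_comp:
  assumes H: "prehilbert H" and K: "prehilbert K" and L: "prehilbert L"
    and S: "S \<in> bounded_ops K L" and T: "T \<in> bounded_ops H K"
  shows "S \<circ> T \<in> bounded_ops H L"
proof (rule bounded_opsI)
  note [simp] = bounded_ops_closed[OF S] bounded_ops_closed[OF T] bounded_ops_add[OF S] bounded_ops_add[OF T]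
     bounded_ops_scale[OF S] bounded_ops_scale[OF T]
  fix x y z assume x: "x \<in> hcarrier H"
  show "(S \<circ> T) x \<in> hcarrier L" "(S \<circ> T) (hscale H z x) = hscale L z ((S \<circ> T) x)" using x by auto
  show "(S \<circ> T) (hadd H x y) = hadd L ((S \<circ> T) x) ((S \<circ> T) y)" if "y \<in> hcarrier H" using x that by auto
  have "hnorm L (S (T x)) \<le> opnorm K L S * hnorm K (T x)" using opnorm_bound[OF K L S] x by simp
  also have "\<dots> \<le> opnorm K L S * (opnorm H K T * hnorm H x)"
    using opnorm_bound[OF H K T] opnorm_nonneg[OF K L S] x by (intro mult_left_mono) auto
  finally show "hnorm L ((S \<circ> T) x) \<le> (opnorm K L S * opnorm H K T) * hnorm H x" by (simp add: mult_ac)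
qed

lemma bounded_ops_op_add:
  assumes H: "prehilbert H" and K: "prehilbert K"
    and S: "S \<in> bounded_ops H K" and T: "T \<in> bounded_ops H K"
  shows "op_add K S T \<in> bounded_ops H K"
proof (rule bounded_opsI)
  interpret K: prehilbert K by fact
  note [simp] = bounded_ops_closed[OF S] bounded_ops_closed[OF T] bounded_ops_add[OF S] bounded_ops_add[OF T]
     bounded_ops_scale[OF S] bounded_ops_scale[OF T] op_add_def
  fix x y z assume x: "x \<in> hcarrier H"
  have C: "hadd H x y \<in> hcarrier H" if "y \<in> hcarrier H" using x that H by (simp add: prehilbert.add_closed)
  show "op_add K S T x \<in> hcarrier K" using x by auto
  show "op_add K S T (hscale H z x) = hscale K z (op_add K S T x)"
    by (rule K.hip_separates) (use x in \<open>auto simp: algebra_simps\<close>)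
  show "op_add K S T (hadd H x y) = hadd K (op_add K S T x) (op_add K S T y)" if "y \<in> hcarrier H"
    by (rule K.hip_separates) (use x that C in \<open>auto simp: algebra_simps\<close>)
  have "hnorm K (op_add K S T x) \<le> hnorm K (S x) + hnorm K (T x)" using x by (simp add: K.hnorm_triangle)
  also have "\<dots> \<le> opnorm H K S * hnorm H x + opnorm H K T * hnorm H x"
    using x by (intro add_mono opnorm_bound H K S T)
  finally show "hnorm K (op_add K S T x) \<le> (opnorm H K S + opnorm H K T) * hnorm H x" by (simp add: algebra_simps)
qed

lemma bounded_ops_uminus:
  assumes K: "prehilbert K" and T: "T \<in> bounded_ops H K"
  shows "(\<lambda>x. hscale K (-1) (T x)) \<in> bounded_ops H K"
proof -
  interpret K: prehilbert K by fact
  note [simp] = bounded_ops_closed[OF T] bounded_ops_add[OF T] bounded_ops_scale[OF T]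
  obtain M where M: "\<forall>x\<in>hcarrier H. hnorm K (T x) \<le> M * hnorm H x" using bounded_ops_bound[OF T] by blast
  show ?thesis
  proof (rule bounded_opsI)
    fix x y z assume x: "x \<in> hcarrier H"
    show "hscale K (-1) (T x) \<in> hcarrier K" using x by auto
    show "hscale K (-1) (T (hscale H z x)) = hscale K z (hscale K (-1) (T x))"
      by (rule K.hip_separates) (use x in auto)
    show "hscale K (-1) (T (hadd H x y)) = hadd K (hscale K (-1) (T x)) (hscale K (-1) (T y))" if "y \<in> hcarrier H"
      by (rule K.hip_separates) (use x that in \<open>auto simp: algebra_simps\<close>)
    show "hnorm K (hscale K (-1) (T x)) \<le> M * hnorm H x" using x M by simp
  qed
qed

lemma bounded_ops_hzero:
  assumes H: "prehilbert H" and K: "prehilbert K" and T: "T \<in> bounded_ops H K"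
  shows "T (hzero H) = hzero K"
proof -
  interpret H: prehilbert H by fact
  interpret K: prehilbert K by fact
  have "hscale H 0 (hzero H) = hzero H" by (rule H.hip_separates) auto
  then have "T (hzero H) = hscale K 0 (T (hzero H))" using bounded_ops_scale[OF T H.zero_closed, of 0] by simp
  also have "\<dots> = hzero K" by (rule K.hip_separates) (use bounded_ops_closed[OF T H.zero_closed] in auto)
  finally show ?thesis .
qed

lemma bounded_ops_diff:
  assumes "T \<in> bounded_ops (whole :: 'a::complex_inner hilb) K"
  shows "T (x - y) = hadd K (T x) (hscale K (-1) (T y))"
  using bounded_ops_add[OF assms, of x "- y"] bounded_ops_scale[OF assms, of y "-1"]
  by (simp add: scaleC_minus_one)

lemma bounded_ops_id: "id \<in> bounded_ops H H"
  by (rule bounded_opsI[where M = 1]) auto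

lemma bounded_ops_block:
  assumes H: "prehilbert H" and K: "prehilbert K"
    and P: "P \<in> bounded_ops H H" and Q: "Q \<in> bounded_ops K H"
    and R: "R \<in> bounded_ops H K" and S: "S \<in> bounded_ops K K"
  shows "block_op H K P Q R S \<in> bounded_ops (hsum H K) (hsum H K)"
proof -
  interpret H: prehilbert H by fact
  interpret K: prehilbert K by fact
  note [simp] = bounded_ops_closed[OF P] bounded_ops_closed[OF Q] bounded_ops_closed[OF R] bounded_ops_closed[OF S]
   bounded_ops_add[OF P] bounded_ops_add[OF Q] bounded_ops_add[OF R] bounded_ops_add[OF S]
   bounded_ops_scale[OF P] bounded_ops_scale[OF Q] bounded_ops_scale[OF R] bounded_ops_scale[OF S]
   block_op_def hsum_def
  define M where "M = opnorm H H P + opnorm K H Q + opnorm H K R + opnorm K K S"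
  note nn = opnorm_nonneg[OF H H P] opnorm_nonneg[OF K H Q] opnorm_nonneg[OF H K R] opnorm_nonneg[OF K K S]
  have hn: "hnorm (hsum H K) (x, y) = sqrt ((hnorm H x)\<^sup>2 + (hnorm K y)\<^sup>2)" if "x \<in> hcarrier H" "y \<in> hcarrier K" for x y
    using that by (simp add: hnorm_def[of "hsum H K", unfolded hsum_def] H.hnorm_power2 K.hnorm_power2)
  have hn1: "hnorm H x \<le> hnorm (hsum H K) (x, y)" "hnorm K y \<le> hnorm (hsum H K) (x, y)"
     "hnorm (hsum H K) (x, y) \<le> hnorm H x + hnorm K y" if "x \<in> hcarrier H" "y \<in> hcarrier K" for x y
    using that unfolding hn[OF that] by (auto intro!: real_le_rsqrt sqrt_sum_squares_le_sum)
  show ?thesis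
  proof (rule bounded_opsI)
    fix p q z assume p: "p \<in> hcarrier (hsum H K)"
    obtain x y where [simp]: "p = (x, y)" by (cases p)
    have c [simp]: "x \<in> hcarrier H" "y \<in> hcarrier K" using p by auto
    show "block_op H K P Q R S p \<in> hcarrier (hsum H K)" by simp
    show "block_op H K P Q R S (hscale (hsum H K) z p) = hscale (hsum H K) z (block_op H K P Q R S p)"
      by (auto intro!: H.hip_separates K.hip_separates simp: algebra_simps)
    show "block_op H K P Q R S (hadd (hsum H K) p q) = hadd (hsum H K) (block_op H K P Q R S p) (block_op H K P Q R S q)"
      if "q \<in> hcarrier (hsum H K)" using that
      by (auto intro!: H.hip_separates K.hip_separates simp: algebra_simps)
    define h where "h = hnorm (hsum H K) p"
    have hx: "hnorm H x \<le> h" "hnorm K y \<le> h" using hn1(1,2)[OF c] by (auto simp: h_def simp del: hsum_def)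
    have "hnorm (hsum H K) (block_op H K P Q R S p) \<le> hnorm H (hadd H (P x) (Q y)) + hnorm K (hadd K (R x) (S y))"
      using hn1(3)[of "hadd H (P x) (Q y)" "hadd K (R x) (S y)"] by (simp del: hsum_def)
    also have "\<dots> \<le> (hnorm H (P x) + hnorm H (Q y)) + (hnorm K (R x) + hnorm K (S y))"
      by (intro add_mono H.hnorm_triangle K.hnorm_triangle) auto
    also have "\<dots> \<le> (opnorm H H P * h + opnorm K H Q * h) + (opnorm H K R * h + opnorm K K S * h)"
      by (intro add_mono order_trans[OF opnorm_bound[OF H H P c(1)]] order_trans[OF opnorm_bound[OF K H Q c(2)]]
          order_trans[OF opnorm_bound[OF H K R c(1)]] order_trans[OF opnorm_bound[OF K K S c(2)]] mult_left_mono hx nn)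
    finally show "hnorm (hsum H K) (block_op H K P Q R S p) \<le> M * hnorm (hsum H K) p"
      by (simp add: M_def algebra_simps h_def del: hsum_def)
  qed
qed

lemma bounded_ops_cong:
  assumes H: "prehilbert H" and T: "T \<in> bounded_ops H K" and eq: "\<And>x. x \<in> hcarrier H \<Longrightarrow> S x = T x"
  shows "S \<in> bounded_ops H K"
proof -
  interpret H: prehilbert H by fact
  show ?thesis using T unfolding bounded_ops_def by (auto simp: eq)
qed

lemma boundedly_invertibleI:
  assumes H: "prehilbert H" and T: "T \<in> bounded_ops H H" and S: "S \<in> bounded_ops H H"
    and ST: "\<And>x. x \<in> hcarrier H \<Longrightarrow> S (T x) = x" and TS: "\<And>x. x \<in> hcarrier H \<Longrightarrow> T (S x) = x"
  shows "boundedly_invertible H T"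
proof -
  have b: "bij_betw T (hcarrier H) (hcarrier H)"
    by (rule bij_betw_byWitness[where f' = S])
      (use ST TS bounded_ops_closed[OF S] bounded_ops_closed[OF T] in auto)
  have "op_inv H T x = S x" if "x \<in> hcarrier H" for x
    unfolding op_inv_def using b TS[OF that] bounded_ops_closed[OF S that]
    by (metis bij_betw_inv_into_left)
  then have "op_inv H T \<in> bounded_ops H H" by (rule bounded_ops_cong[OF H S])
  with T b show ?thesis by (simp add: boundedly_invertible_def)
qed

text \<open>The block inverse is made from the inverse \<open>W\<close> of the Schur complement \<open>I - Y X\<close>.  That complement
  acts in the first space, which is complete, and so \<open>W\<close> can come from a contraction argument.\<close>

lemma boundedly_invertible_id_plus_offdiagonal:
  assumes K: "prehilbert K"
    and X: "X \<in> bounded_ops (whole :: 'a::complex_inner hilb) K" and Y: "Y \<in> bounded_ops K whole"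
    and W: "W \<in> bounded_ops whole whole" "\<And>u. W (u - Y (X u)) = u" "\<And>u. W u - Y (X (W u)) = u"
  shows "boundedly_invertible (hsum whole K) (block_op whole K id Y X id)"
proof -
  interpret K: prehilbert K by fact
  note H = prehilbert_whole[where 'a = 'a]
  define neg :: "_ \<Rightarrow> 'c \<Rightarrow> 'a" where "neg = (\<lambda>T x. - T x)"
  note Xc [simp] = bounded_ops_closed[OF X, simplified]
  note Xa = bounded_ops_add[OF X, simplified]
  note Xs = bounded_ops_scale[OF X, simplified]
  note Ya = bounded_ops_add[OF Y, simplified]
  note Ys = bounded_ops_scale[OF Y, simplified]
  note Wa = bounded_ops_add[OF W(1), simplified]
  have Wm: "W (- x) = - W x" for x
    using bounded_ops_scale[OF W(1), of x "-1"] by (simp add: scaleC_minus_one)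
  have Wd: "W (x - y) = W x - W y" for x y
    using Wa[of x "- y"] by (simp add: Wm)
  have Xm: "X (- x) = hscale K (-1) (X x)" for x
    using Xs[of "-1" x] by (simp add: scaleC_minus_one)
  have Xd: "X (x - y) = hadd K (X x) (hscale K (-1) (X y))" for x y
    using Xa[of x "- y"] by (simp add: Xm)
  have k1: "W (Y (X x)) = W x - x" for x using W(2)[of x] by (simp add: Wd algebra_simps)
  have k2: "Y (X (W x)) = W x - x" for x using W(3)[of x] by (simp add: algebra_simps)
  define S where "S = block_op whole K W (\<lambda>y. hscale whole (-1) ((W \<circ> Y) y)) (\<lambda>x. hscale K (-1) ((X \<circ> W) x))
     (op_add K id (X \<circ> (W \<circ> Y)))"
  show ?thesis
  proof (rule boundedly_invertibleI[OF prehilbert_hsum[OF H K]])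
    show "block_op whole K id Y X id \<in> bounded_ops (hsum whole K) (hsum whole K)"
      by (intro bounded_ops_block H K bounded_ops_id X Y)
    show "S \<in> bounded_ops (hsum whole K) (hsum whole K)"
      unfolding S_def
      by (intro bounded_ops_block bounded_ops_uminus bounded_ops_op_add bounded_ops_comp[where K = whole]
          bounded_ops_id H K X Y W)
    fix p assume p: "p \<in> hcarrier (hsum (whole :: 'a hilb) K)"
    obtain x y where [simp]: "p = (x, y)" by (cases p)
    have y [simp]: "y \<in> hcarrier K" using p by (simp add: hsum_def)
    show "S (block_op whole K id Y X id p) = p"
      by (simp add: S_def block_op_def op_add_def Ya Wa Xa Xd Wd k1 scaleC_minus_one)
        (rule K.hip_separates, auto)
    show "block_op whole K id Y X id (S p) = p"
      by (simp add: S_def block_op_def op_add_def Ya Ys Xa Xd Xm k2 scaleC_minus_one)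
        (rule K.hip_separates, auto)
  qed
qed

lemma Schur_complement_inverse:
  assumes K: "prehilbert K"
    and X: "X \<in> bounded_ops (whole :: 'a::chilbert_space hilb) K" and Y: "Y \<in> bounded_ops K whole"
    and q: "\<And>u. norm (Y (X u)) \<le> q * norm u" "0 \<le> q" "q < 1"
  obtains W where "W \<in> bounded_ops whole whole" "\<And>u. W (u - Y (X u)) = u" "\<And>u. W u - Y (X (W u)) = u"
proof -
  note H = prehilbert_whole[where 'a = 'a]
  have YX: "Y \<circ> X \<in> bounded_ops whole whole" by (rule bounded_ops_comp[OF H K H Y X])
  have a: "Y (X (x + y)) = Y (X x) + Y (X y)" "Y (X (z *\<^sub>C x)) = z *\<^sub>C Y (X x)" for x y z
    using bounded_ops_add[OF YX, of x y] bounded_ops_scale[OF YX, of x z] by auto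
  have d: "Y (X (x - y)) = Y (X x) - Y (X y)" for x y
    using a(1)[of x "- y"] a(2)[of "-1" y] by (simp add: scaleC_minus_one)
  have lower: "(1 - q) * norm u \<le> norm (u - Y (X u))" for u
    using q(1)[of u] norm_triangle_ineq2[of u "Y (X u)"] by (simp add: algebra_simps)
  have "\<exists>g. g - Y (X g) = f" for f
    using small_perturbation_surj[of id 1 "\<lambda>u. - Y (X u)" q f] q by (auto simp: d)
  then obtain W where W: "\<And>f. W f - Y (X (W f)) = f" by metis
  have inj: "x = y" if "x - Y (X x) = y - Y (X y)" for x y
  proof -
    have "(x - y) - Y (X (x - y)) = 0" using that by (simp add: d algebra_simps)
    then have "(1 - q) * norm (x - y) \<le> 0" using lower[of "x - y"] by simp
    then show ?thesis using q by (simp add: mult_le_0_iff)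
  qed
  show ?thesis
  proof
    show "W \<in> bounded_ops whole whole"
    proof (rule bounded_opsI)
      fix x y z
      have "(W x + W y) - Y (X (W x + W y)) = (W x - Y (X (W x))) + (W y - Y (X (W y)))"
        by (simp add: a)
      then have "(W x + W y) - Y (X (W x + W y)) = x + y" by (simp add: W)
      then show "W (hadd whole x y) = hadd whole (W x) (W y)"
        by - (rule inj, simp add: W)
      show "W (hscale whole z x) = hscale whole z (W x)"
        by (rule inj) (use W[of "z *\<^sub>C x"] W[of x] in \<open>simp add: a flip: scaleC_diff_right\<close>)
      show "hnorm whole (W x) \<le> (1 / (1 - q)) * hnorm whole x"
        using lower[of "W x"] q by (simp add: W field_simps)
    qed simp
    show "W (u - Y (X u)) = u" for u by (rule inj) (rule W)
  qed (rule W)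
qed

text \<open>The Riccati equations are precisely the identities \<open>L (I + Q) = (I + Q) diag (A + B X, D + C Y)\<close> and
  \<open>(I - Q) L = diag (A - Y C, D - X B) (I - Q)\<close>.  The operator \<open>I - Q\<close> belongs to the pair \<open>- X\<close>, \<open>- Y\<close>, which has the
  same Schur complement.\<close>

lemma Riccati_block_diagonalization:
  fixes A :: "'a::chilbert_space \<Rightarrow> 'a" and K :: "'w hilb"
  assumes K: "prehilbert K" and A: "A \<in> bounded_ops whole whole" and B: "B \<in> bounded_ops K whole"
    and C: "C \<in> bounded_ops whole K" and D: "D \<in> bounded_ops K K"
    and X: "riccati_solution whole K A B C D X" and Y: "riccati_solution K whole D C B A Y"
    and q: "\<And>u. norm (Y (X u)) \<le> q * norm u" "0 \<le> q" "q < 1"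
  defines "H \<equiv> hsum whole K" and "L \<equiv> block_op whole K A B C D"
    and "Q \<equiv> block_op whole K (op_zero whole) Y X (op_zero K)"
  shows "boundedly_invertible H (op_add H id Q)
    \<and> boundedly_invertible H (op_diff H id Q)
    \<and> op_eq H L
        (op_add H id Q
          \<circ> block_op whole K (op_add whole A (B \<circ> X)) (op_zero whole) (op_zero K) (op_add K D (C \<circ> Y))
          \<circ> op_inv H (op_add H id Q))
    \<and> op_eq H L
        (op_inv H (op_diff H id Q)
          \<circ> block_op whole K (op_diff whole A (Y \<circ> C)) (op_zero whole) (op_zero K) (op_diff K D (X \<circ> B))
          \<circ> op_diff H id Q)"
proof -
  interpret K: prehilbert K by fact
  note HA = prehilbert_whole[where 'a = 'a]
  have Xb: "X \<in> bounded_ops whole K" and Yb: "Y \<in> bounded_ops K whole"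
    using X Y by (auto simp: riccati_solution_def)
  note cl [simp] = bounded_ops_closed[OF Xb, simplified] bounded_ops_closed[OF C, simplified] bounded_ops_closed[OF D]
  note Xa = bounded_ops_add[OF Xb, simplified]
  note Ya = bounded_ops_add[OF Yb, simplified]
  note lin = Xa Ya bounded_ops_add[OF A, simplified] bounded_ops_add[OF B, simplified]
     bounded_ops_add[OF C, simplified] bounded_ops_add[OF D]
     bounded_ops_scale[OF Xb, simplified] bounded_ops_scale[OF Yb, simplified]
     bounded_ops_scale[OF A, simplified] bounded_ops_scale[OF B, simplified]
     bounded_ops_scale[OF C, simplified] bounded_ops_scale[OF D]
     bounded_ops_hzero[OF HA K Xb, simplified] bounded_ops_hzero[OF K HA Yb, simplified]
     bounded_ops_diff[OF Xb] bounded_ops_diff[OF A] bounded_ops_diff[OF C]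
  define Xn where "Xn = (\<lambda>x. hscale K (-1) (X x))"
  define Yn where "Yn = (\<lambda>x. hscale whole (-1) (Y x))"
  have Xnb: "Xn \<in> bounded_ops whole K" unfolding Xn_def by (rule bounded_ops_uminus[OF K Xb])
  have Ynb: "Yn \<in> bounded_ops K whole" unfolding Yn_def by (rule bounded_ops_uminus[OF HA Yb])
  have YnXn: "Yn (Xn u) = Y (X u)" for u
    by (simp add: Xn_def Yn_def lin scaleC_scaleC)
  obtain W where W: "W \<in> bounded_ops whole whole" "\<And>u. W (u - Y (X u)) = u" "\<And>u. W u - Y (X (W u)) = u"
    using Schur_complement_inverse[OF K Xb Yb q] by blast
  have Hp: "prehilbert H" unfolding H_def by (rule prehilbert_hsum[OF HA K])
  interpret H: prehilbert H by fact
  have H_simps: "hcarrier H = UNIV \<times> hcarrier K" "hadd H = (\<lambda>(x, y) (x', y'). (x + x', hadd K y y'))"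
     "hscale H = (\<lambda>z (x, y). (z *\<^sub>C x, hscale K z y))"
    by (simp_all add: H_def hsum_def)
  have plus: "op_add H id Q p = block_op whole K id Y X id p" if "p \<in> hcarrier H" for p
    using that
    by (auto simp: H_simps op_add_def Q_def block_op_def op_zero_def intro!: K.hip_separates)
  have minus: "op_diff H id Q p = block_op whole K id Yn Xn id p" if "p \<in> hcarrier H" for p
    using that
    by (auto simp: H_simps op_diff_def Q_def block_op_def op_zero_def Xn_def Yn_def intro!: K.hip_separates)
  have cong: "boundedly_invertible H S" if "boundedly_invertible H T" "\<And>x. x \<in> hcarrier H \<Longrightarrow> S x = T x" for S T
  proof -
    have "op_inv H S x = op_inv H T x" for x unfolding op_inv_def inv_into_def using that(2) by (metis (full_types))
    then have "op_inv H S = op_inv H T" ..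
    then show ?thesis using that bounded_ops_cong[OF Hp, of T H S] bij_betw_cong[of "hcarrier H" S T]
      by (auto simp: boundedly_invertible_def)
  qed
  have i1: "boundedly_invertible H (op_add H id Q)"
    by (rule cong[OF _ plus]) (use boundedly_invertible_id_plus_offdiagonal[OF K Xb Yb W] in \<open>simp add: H_def\<close>)
  have i2: "boundedly_invertible H (op_diff H id Q)"
    by (rule cong[OF _ minus])
      (use boundedly_invertible_id_plus_offdiagonal[OF K Xnb Ynb W(1)] W in \<open>simp add: H_def YnXn\<close>)
  let ?Z = "block_op whole K (op_add whole A (B \<circ> X)) (op_zero whole) (op_zero K) (op_add K D (C \<circ> Y))"
  let ?Zt = "block_op whole K (op_diff whole A (Y \<circ> C)) (op_zero whole) (op_zero K) (op_diff K D (X \<circ> B))"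
  have RX: "hip K (C x) z = hip K (X (A x)) z - hip K (D (X x)) z + hip K (X (B (X x))) z" if "z \<in> hcarrier K" for x z
  proof -
    have "C x = hadd K (hadd K (X (A x)) (hscale K (- 1) (D (X x)))) (X (B (X x)))"
      using X unfolding riccati_solution_def op_eq_def op_add_def op_diff_def by simp
    then show ?thesis using that by simp
  qed
  have RY: "B y = Y (D y) - A (Y y) + Y (C (Y y))" if "y \<in> hcarrier K" for y
    using Y that unfolding riccati_solution_def op_eq_def op_add_def op_diff_def by (simp add: scaleC_minus_one)
  have Zc: "?Z p \<in> hcarrier H" "L p \<in> hcarrier H" if "p \<in> hcarrier H" for p
    using that by (auto simp: H_simps block_op_def op_zero_def op_add_def L_def)
  have LQ: "L (op_add H id Q p) = op_add H id Q (?Z p)" if p: "p \<in> hcarrier H" for p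
  proof -
    obtain x y where [simp]: "p = (x, y)" by (cases p)
    have y [simp]: "y \<in> hcarrier K" using p by (simp add: H_simps)
    have s: "D y \<in> hcarrier K" "hadd K (D y) (C (Y y)) \<in> hcarrier K" by simp_all
    show ?thesis unfolding plus[OF p] plus[OF Zc(1)[OF p]]
      by (auto simp: L_def block_op_def op_add_def op_zero_def lin RX RY intro!: K.hip_separates)
  qed
  have QL: "op_diff H id Q (L p) = ?Zt (op_diff H id Q p)" if p: "p \<in> hcarrier H" for p
  proof -
    obtain x y where [simp]: "p = (x, y)" by (cases p)
    have y [simp]: "y \<in> hcarrier K" using p by (simp add: H_simps)
    show ?thesis unfolding minus[OF p] minus[OF Zc(2)[OF p]]
      by (auto simp: L_def block_op_def op_diff_def op_zero_def lin RX RY Xn_def Yn_def scaleC_minus_one intro!: K.hip_separates)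
  qed
  have "op_eq H L (op_add H id Q \<circ> ?Z \<circ> op_inv H (op_add H id Q))"
    unfolding op_eq_def
  proof
    fix p assume p: "p \<in> hcarrier H"
    have b: "bij_betw (op_add H id Q) (hcarrier H) (hcarrier H)" using i1 by (simp add: boundedly_invertible_def)
    define r where "r = op_inv H (op_add H id Q) p"
    have r: "r \<in> hcarrier H" "op_add H id Q r = p"
      using b p unfolding r_def op_inv_def by (auto simp: bij_betw_def inv_into_into f_inv_into_f)
    then show "L p = (op_add H id Q \<circ> ?Z \<circ> op_inv H (op_add H id Q)) p"
      using LQ[OF r(1)] by (simp add: r_def[symmetric])
  qed
  moreover have "op_eq H L (op_inv H (op_diff H id Q) \<circ> ?Zt \<circ> op_diff H id Q)"
    unfolding op_eq_def
  proof
    fix p assume p: "p \<in> hcarrier H"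
    have b: "bij_betw (op_diff H id Q) (hcarrier H) (hcarrier H)" using i2 by (simp add: boundedly_invertible_def)
    have "op_inv H (op_diff H id Q) (op_diff H id Q (L p)) = L p"
      unfolding op_inv_def using b Zc(2)[OF p] by (simp add: bij_betw_inv_into_left)
    then show "L p = (op_inv H (op_diff H id Q) \<circ> ?Zt \<circ> op_diff H id Q) p"
      using QL[OF p] by simp
  qed
  ultimately show ?thesis using i1 i2 by blast
qed

section \<open>The bound on the product of the two solutions\<close>

text \<open>The set \<open>\<Gamma>\<close> plays the role of the contour; only its distance from the spectrum of \<open>A\<close> is recorded.\<close>

locale riccati_pair =
  fixes A :: "'a::chilbert_space \<Rightarrow> 'a" and K :: "'w hilb" and B C D X Y and d :: real and \<Gamma> :: "complex set"
  assumes K: "prehilbert K" and A: "self_adjoint_op whole A" and B: "B \<in> bounded_ops K whole"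
    and C: "C \<in> bounded_ops whole K" and D: "D \<in> bounded_ops K K"
    and X: "riccati_solution whole K A B C D X" and Y: "riccati_solution K whole D C B A Y"
    and real_spectrum: "op_spectrum whole A \<subseteq> \<real>"
    and d: "d > 0" and dist_spectrum: "\<And>z \<mu>. z \<in> op_spectrum whole A \<Longrightarrow> \<mu> \<in> \<Gamma> \<Longrightarrow> d \<le> dist \<mu> z"
begin

lemma X_bounded: "X \<in> bounded_ops whole K" and Y_bounded: "Y \<in> bounded_ops K whole" and A_bounded: "A \<in> bounded_ops whole whole"
  using X Y A by (auto simp: riccati_solution_def self_adjoint_op_def)

lemma A_lower: "\<mu> \<in> \<Gamma> \<Longrightarrow> d * norm u \<le> norm (A u - \<mu> *\<^sub>C u)"
  using self_adjoint_resolvent_bound[OF A real_spectrum] dist_spectrum d by auto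

lemma A_surj: "\<mu> \<in> \<Gamma> \<Longrightarrow> surj (\<lambda>u. A u - \<mu> *\<^sub>C u)"
proof -
  assume "\<mu> \<in> \<Gamma>"
  then have "\<mu> \<notin> op_spectrum whole A" using dist_spectrum[of \<mu> \<mu>] d by auto
  then have "bij (op_diff whole A (hscale whole \<mu>))"
    by (simp add: op_spectrum_def boundedly_invertible_def)
  moreover have "op_diff whole A (hscale whole \<mu>) = (\<lambda>u. A u - \<mu> *\<^sub>C u)"
    by (auto simp: op_diff_def scaleC_minus_one)
  ultimately show ?thesis by (simp add: bij_is_surj)
qed

lemma X_norm_le:
  assumes t: "\<And>f. norm (B (X f)) \<le> t * norm f" "0 \<le> t" "t < d" and c: "column_E_bound K D \<Gamma> C c" "0 \<le> c"
  shows "hnorm K (X f) \<le> c * (1 / (d - t)) * norm f"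
proof (rule Sylvester_column_bound[OF X_bounded _ c, where Z = "\<lambda>f. A f + B (X f)"])
  interpret K: prehilbert K by (rule K)
  note [simp] = bounded_ops_closed[OF X_bounded, simplified] bounded_ops_closed[OF C, simplified] bounded_ops_closed[OF D]
  show "C f \<in> hcarrier K" for f by simp
  show "0 \<le> 1 / (d - t)" using t by simp
  show "X (A f + B (X f)) = hadd K (C f) (D (X f))" for f
  proof (rule K.hip_separates)
    fix z assume z: "z \<in> hcarrier K"
    have "C f = hadd K (hadd K (X (A f)) (hscale K (- 1) (D (X f)))) (X (B (X f)))"
      using X unfolding riccati_solution_def op_eq_def op_add_def op_diff_def by simp
    then show "hip K (X (A f + B (X f))) z = hip K (hadd K (C f) (D (X f))) z"
      using z bounded_ops_add[OF X_bounded, of "A f" "B (X f)"] by simp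
  qed auto
  fix f :: 'a and \<mu> assume \<mu>: "\<mu> \<in> \<Gamma>"
  have BX: "B \<circ> X \<in> bounded_ops whole whole" by (rule bounded_ops_comp[OF prehilbert_whole K prehilbert_whole B X_bounded])
  have "\<exists>g. A g - \<mu> *\<^sub>C g + B (X g) = f \<and> (d - t) * norm g \<le> norm f"
  proof (rule small_perturbation_surj)
    show "A (x - y) - \<mu> *\<^sub>C (x - y) = A x - \<mu> *\<^sub>C x - (A y - \<mu> *\<^sub>C y)" for x y
      using bounded_ops_diff[OF A_bounded, of x y] by (simp add: scaleC_minus_one scaleC_diff_right)
    show "B (X (x - y)) = B (X x) - B (X y)" for x y
      using bounded_ops_diff[OF BX, of x y] by (simp add: scaleC_minus_one)
  qed (use t A_lower[OF \<mu>] A_surj[OF \<mu>] in auto)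
  then show "\<exists>g. A g + B (X g) - \<mu> *\<^sub>C g = f \<and> norm g \<le> 1 / (d - t) * norm f"
    using t by (auto simp: field_simps)
qed

lemma Y_norm_le:
  assumes t: "\<And>f. norm (Y (C f)) \<le> t * norm f" "0 \<le> t" "t < d" and b: "row_E_bound K D \<Gamma> B b" "0 \<le> b"
    and x: "x \<in> hcarrier K"
  shows "norm (Y x) \<le> b * (1 / (d - t)) * hnorm K x"
proof (rule Sylvester_row_bound[OF Y_bounded b _ _ _ x, where Z = "\<lambda>f. A f - Y (C f)"])
  show "0 \<le> 1 / (d - t)" using t by simp
  show "Y (D x) = A (Y x) - Y (C (Y x)) + B x" if "x \<in> hcarrier K" for x
    using Y that unfolding riccati_solution_def op_eq_def op_add_def op_diff_def
    by (auto simp: scaleC_minus_one algebra_simps dest: bspec[of _ _ x])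
  fix u \<mu> assume "\<mu> \<in> \<Gamma>"
  then have "d * norm u \<le> norm (A u - \<mu> *\<^sub>C u)" by (rule A_lower)
  also have "\<dots> \<le> norm (A u - Y (C u) - \<mu> *\<^sub>C u) + norm (Y (C u))"
    using norm_triangle_ineq[of "A u - Y (C u) - \<mu> *\<^sub>C u" "Y (C u)"] by (simp add: algebra_simps)
  also have "\<dots> \<le> norm (A u - Y (C u) - \<mu> *\<^sub>C u) + t * norm u" by (simp add: t)
  finally show "norm u \<le> 1 / (d - t) * norm (A u - Y (C u) - \<mu> *\<^sub>C u)"
    using t by (simp add: field_simps)
qed

text \<open>If \<open>B = 0\<close>, the equation for \<open>Y\<close> is a Sylvester equation with right-hand side \<open>0\<close>, so \<open>Y = 0\<close>;
  likewise \<open>X = 0\<close> if \<open>C = 0\<close>.  In the main case put \<open>s = sqrt (b * c)\<close>.  The hypothesis on \<open>X\<close> says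
  \<open>d - b \<parallel>X\<parallel> > s\<close>, hence the resolvent of \<open>A + B X\<close> on the contour is smaller than \<open>1 / s\<close> and
  \<open>\<parallel>X\<parallel> < c / s\<close>.  In the same way \<open>\<parallel>Y\<parallel> < b / s\<close>, and the product of the two bounds is \<open>1\<close>.\<close>

lemma YX_strict_contraction:
  assumes part: "\<And>\<epsilon>. \<epsilon> > 0 \<Longrightarrow> \<exists>n E l. spectral_partition K D \<epsilon> n E l \<and> (\<forall>j<n. l j \<in> \<Gamma>)"
    and bc: "0 \<le> b" "0 \<le> c"
    and b: "\<not> op_eq K B (op_zero whole) \<Longrightarrow>
        0 < b \<and> row_E_bound K D \<Gamma> B b \<and> opnorm whole K X < (d - sqrt (b * c)) / b"
    and c: "\<not> op_eq whole C (op_zero K) \<Longrightarrow>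
        0 < c \<and> column_E_bound K D \<Gamma> C c \<and> opnorm K whole Y < (d - sqrt (b * c)) / c"
  obtains q where "\<And>u. norm (Y (X u)) \<le> q * norm u" "0 \<le> q" "q < 1"
proof -
  interpret K: prehilbert K by (rule K)
  note HA = prehilbert_whole[where 'a = 'a]
  note Xc [simp] = bounded_ops_closed[OF X_bounded, simplified]
  note Cc [simp] = bounded_ops_closed[OF C, simplified]
  define x where "x = opnorm whole K X"
  define y where "y = opnorm K whole Y"
  have x: "hnorm K (X f) \<le> x * norm f" "0 \<le> x" for f
    using opnorm_bound[OF HA K X_bounded, of f] opnorm_nonneg[OF HA K X_bounded] by (auto simp: x_def)
  have y: "norm (Y g) \<le> y * hnorm K g" if "g \<in> hcarrier K" for g
    using opnorm_bound[OF K HA Y_bounded that] by (auto simp: y_def)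
  have y0: "0 \<le> y" using opnorm_nonneg[OF K HA Y_bounded] by (auto simp: y_def)
  have BX: "norm (B (X f)) \<le> b * x * norm f" if "row_E_bound K D \<Gamma> B b" for f
    using order_trans[OF row_E_bound_norm[OF that B _ bc(1), of "X f"] mult_left_mono[OF x(1)[of f] bc(1)]] by (simp add: mult_ac)
  have YC: "norm (Y (C f)) \<le> c * y * norm f" if "column_E_bound K D \<Gamma> C c" for f
    using order_trans[OF y[of "C f"] mult_left_mono[OF column_E_bound_norm[OF that _ bc(2), of f] y0]] by (simp add: mult_ac)
  have hz: "hnorm K (hzero K) = 0" by simp
  consider (B0) "op_eq K B (op_zero whole)" | (C0) "op_eq whole C (op_zero K)"
    | (main) "\<not> op_eq K B (op_zero whole)" "\<not> op_eq whole C (op_zero K)" by blast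
  then show ?thesis
  proof cases
    case B0
    have row0: "row_E_bound K D \<Gamma> B 0"
      unfolding row_E_bound_def
    proof (intro allI impI)
      fix \<epsilon> :: real assume "\<epsilon> > 0"
      then obtain n E l where *: "spectral_partition K D \<epsilon> n E l" "\<forall>j<n. l j \<in> \<Gamma>" using part by blast
      have "B (E j z) = 0" if "j < n" "z \<in> hcarrier K" for j z
        using B0 that spectral_partition.E_closed[OF *(1) that] by (simp add: op_eq_def op_zero_def)
      then show "\<exists>n E l a. spectral_partition K D \<epsilon> n E l \<and> (\<forall>j<n. l j \<in> \<Gamma> \<and> 0 \<le> a j \<and>
          (\<forall>x\<in>hcarrier K. norm (B (E j x)) \<le> a j * hnorm K (E j x))) \<and> (\<Sum>j<n. (a j)\<^sup>2) \<le> 0\<^sup>2"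
        using * by (intro exI[of _ n] exI[of _ E] exI[of _ l] exI[of _ "\<lambda>_. 0"]) auto
    qed
    have "\<exists>t. (\<forall>f. norm (Y (C f)) \<le> t * norm f) \<and> 0 \<le> t \<and> t < d"
    proof (cases "op_eq whole C (op_zero K)")
      case True
      have "Y (C f) = 0" for f using True bounded_ops_hzero[OF K HA Y_bounded] by (simp add: op_eq_def op_zero_def)
      then show ?thesis using d by (intro exI[of _ 0]) auto
    next
      case False
      have "0 \<le> sqrt (b * c)" using bc by simp
      moreover have "c * y < d - sqrt (b * c)"
        using c[OF False] by (auto simp: y_def field_simps)
      ultimately have "c * y < d" by linarith
      then show ?thesis using YC c[OF False] y0 bc by (intro exI[of _ "c * y"]) auto
    qed
    then obtain t where "\<And>f. norm (Y (C f)) \<le> t * norm f" "0 \<le> t" "t < d" by blast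
    from Y_norm_le[OF this row0] have "norm (Y (X u)) \<le> 0 * norm u" for u by simp
    then show ?thesis by (rule that) auto
  next
    case C0
    have col0: "column_E_bound K D \<Gamma> C 0"
      unfolding column_E_bound_def
    proof (intro allI impI)
      fix \<epsilon> :: real assume "\<epsilon> > 0"
      then obtain n E l where *: "spectral_partition K D \<epsilon> n E l" "\<forall>j<n. l j \<in> \<Gamma>" using part by blast
      have "E j (C f) = hzero K" if "j < n" for j f
        using C0 bounded_ops_hzero[OF K K spectral_partition.E[OF *(1) that]] by (simp add: op_eq_def op_zero_def)
      then show "\<exists>n E l a. spectral_partition K D \<epsilon> n E l \<and> (\<forall>j<n. l j \<in> \<Gamma> \<and> 0 \<le> a j \<and>
          (\<forall>f. hnorm K (E j (C f)) \<le> a j * norm f)) \<and> (\<Sum>j<n. (a j)\<^sup>2) \<le> 0\<^sup>2"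
        using * by (intro exI[of _ n] exI[of _ E] exI[of _ l] exI[of _ "\<lambda>_. 0"]) auto
    qed
    have "\<exists>t. (\<forall>f. norm (B (X f)) \<le> t * norm f) \<and> 0 \<le> t \<and> t < d"
    proof (cases "op_eq K B (op_zero whole)")
      case True
      have "B (X f) = 0" for f using True by (simp add: op_eq_def op_zero_def)
      then show ?thesis using d by (intro exI[of _ 0]) auto
    next
      case False
      have "0 \<le> sqrt (b * c)" using bc by simp
      moreover have "b * x < d - sqrt (b * c)"
        using b[OF False] by (auto simp: x_def field_simps)
      ultimately have "b * x < d" by linarith
      then show ?thesis using BX b[OF False] x bc by (intro exI[of _ "b * x"]) auto
    qed
    then obtain t where "\<And>f. norm (B (X f)) \<le> t * norm f" "0 \<le> t" "t < d" by blast
    from X_norm_le[OF this col0] have "hnorm K (X u) \<le> 0" for u by simp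
    then have "norm (Y (X u)) \<le> 0 * norm u" for u
      using order_trans[OF y[of "X u"] mult_left_mono[OF _ y0, of _ 0]] by simp
    then show ?thesis by (rule that) auto
  next
    case main
    note b = b[OF main(1)] and c = c[OF main(2)]
    define s where "s = sqrt (b * c)"
    have s: "s > 0" "s * s = b * c" using b c by (auto simp: s_def)
    have bx: "s < d - b * x" and cy: "s < d - c * y"
      using b c by (auto simp: x_def[symmetric] y_def[symmetric] s_def[symmetric] field_simps)
    have "hnorm K (X f) \<le> c * (1 / (d - b * x)) * norm f" for f
      by (rule X_norm_le[OF BX]) (use b c bx s x bc in auto)
    then have "x \<le> c * (1 / (d - b * x))"
      unfolding x_def by (intro opnorm_le[OF HA]) (use bx s c in \<open>auto simp: x_def\<close>)
    also have "\<dots> < c / s" using c s bx by (simp add: divide_strict_left_mono)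
    finally have xs: "x < c / s" .
    have "norm (Y g) \<le> b * (1 / (d - c * y)) * hnorm K g" if "g \<in> hcarrier K" for g
      by (rule Y_norm_le[OF YC]) (use that b c cy s y0 bc in auto)
    then have "y \<le> b * (1 / (d - c * y))"
      unfolding y_def by (intro opnorm_le[OF K]) (use cy s b in \<open>auto simp: y_def\<close>)
    also have "\<dots> < b / s" using b s cy by (simp add: divide_strict_left_mono)
    finally have ys: "y < b / s" .
    have "y * x < (b / s) * (c / s)" by (intro mult_strict_mono') (use xs ys x y0 in auto)
    also have "\<dots> = 1" using s b c by simp
    finally have "y * x < 1" .
    moreover have "norm (Y (X u)) \<le> (y * x) * norm u" for u
      using order_trans[OF y[of "X u"] mult_left_mono[OF x(1)[of u] y0]] by (simp add: mult_ac)
    ultimately show ?thesis using that x(2) y0 by (metis mult_nonneg_nonneg)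
  qed
qed

end

section \<open>Strongly measurable functions\<close>

text \<open>The simple functions approximating \<open>f\<close> and \<open>g\<close> are combined by \<open>h\<close>, pointwise; the result is
  again simple, and converges by the sequential continuity of \<open>h\<close>.\<close>

lemma strongly_measurable_compose2:
  assumes f: "strongly_measurable M f" and g: "strongly_measurable M g"
    and h: "\<And>a b u v. u \<longlonglongrightarrow> a \<Longrightarrow> v \<longlonglongrightarrow> b \<Longrightarrow> (\<lambda>n::nat. h (u n) (v n)) \<longlonglongrightarrow> h a b"
  shows "strongly_measurable M (\<lambda>x. h (f x) (g x))"
proof -
  obtain s t where "\<And>n. simple_function M (s n)" "\<And>x. x \<in> space M \<Longrightarrow> (\<lambda>n. s n x) \<longlonglongrightarrow> f x"
    "\<And>n. simple_function M (t n)" "\<And>x. x \<in> space M \<Longrightarrow> (\<lambda>n. t n x) \<longlonglongrightarrow> g x"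
    using f g unfolding strongly_measurable_def by metis
  then show ?thesis
    unfolding strongly_measurable_def
    by (intro exI[of _ "\<lambda>n x. h (s n x) (t n x)"]) (auto intro: simple_function_compose2 h)
qed

lemma strongly_measurable_const: "strongly_measurable M (\<lambda>_. a)"
  unfolding strongly_measurable_def by (intro exI[of _ "\<lambda>_ _. a"]) auto

lemma strongly_measurable_borel:
  fixes f :: "_ \<Rightarrow> _ :: {metric_space, second_countable_topology}"
  shows "f \<in> borel_measurable M \<Longrightarrow> strongly_measurable M f"
  unfolding strongly_measurable_def
  by (drule borel_measurable_implies_sequence_metric[where z = undefined]) (elim ex_forward conjE, intro conjI)

lemma borel_measurable_strongly:
  fixes f :: "_ \<Rightarrow> _ :: metric_space"
  assumes "strongly_measurable M f"
  shows "f \<in> borel_measurable M"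
proof -
  obtain s where "\<And>n. simple_function M (s n)" "\<And>x. x \<in> space M \<Longrightarrow> (\<lambda>n. s n x) \<longlonglongrightarrow> f x"
    using assms unfolding strongly_measurable_def by metis
  then show ?thesis
    by (intro borel_measurable_LIMSEQ_metric[of s M f]) (auto intro: borel_measurable_simple_function)
qed

lemma strongly_measurable_add:
  "strongly_measurable M f \<Longrightarrow> strongly_measurable M g \<Longrightarrow>
     strongly_measurable M (\<lambda>x. f x + (g x :: 'h::real_normed_vector))"
  by (rule strongly_measurable_compose2[where h = "(+)"]) (auto intro: tendsto_add)

lemma strongly_measurable_diff:
  "strongly_measurable M f \<Longrightarrow> strongly_measurable M g \<Longrightarrow>
     strongly_measurable M (\<lambda>x. f x - (g x :: 'h::real_normed_vector))"
  by (rule strongly_measurable_compose2[where h = "(-)"]) (auto intro: tendsto_diff)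

lemma strongly_measurable_scaleC:
  "m \<in> borel_measurable M \<Longrightarrow> strongly_measurable M g \<Longrightarrow>
     strongly_measurable M (\<lambda>x. m x *\<^sub>C (g x :: 'h::complex_inner))"
  by (rule strongly_measurable_compose2[OF strongly_measurable_borel, where h = scaleC])
    (auto intro: bounded_bilinear.tendsto[OF bounded_bilinear_scaleC])

lemma strongly_measurable_blinfun_apply:
  "strongly_measurable M f \<Longrightarrow> strongly_measurable M g \<Longrightarrow>
     strongly_measurable M (\<lambda>x. blinfun_apply (f x) (g x))"
  by (rule strongly_measurable_compose2[where h = blinfun_apply]) (auto intro: blinfun.tendsto)

lemma borel_measurable_cinner:
  "strongly_measurable M f \<Longrightarrow> strongly_measurable M g \<Longrightarrow>
     (\<lambda>x. cinner (f x) (g x :: 'h::complex_inner)) \<in> borel_measurable M"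
  by (rule borel_measurable_strongly, rule strongly_measurable_compose2[where h = cinner])
    (auto intro: bounded_bilinear.tendsto[OF bounded_bilinear_cinner])

lemma borel_measurable_norm_strongly:
  "strongly_measurable M f \<Longrightarrow> (\<lambda>x. norm (f x :: 'h::real_normed_vector)) \<in> borel_measurable M"
  by (rule borel_measurable_strongly, rule strongly_measurable_compose2[where h = "\<lambda>a _. norm a"])
    (auto intro: tendsto_norm)

text \<open>The target space may be non-separable; simple functions approximating the identity of the
  separable domain are composed with \<open>f\<close>, which is legitimate near points of the open set \<open>S\<close>.\<close>

lemma strongly_measurable_continuous_on_open:
  fixes f :: "'x::{metric_space, second_countable_topology} \<Rightarrow> 'h::real_normed_vector"
  assumes S: "open S" and f: "continuous_on S f" and u: "u \<in> borel_measurable M"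
  shows "strongly_measurable M (\<lambda>x. if u x \<in> S then f (u x) else 0)"
proof -
  obtain s where s: "\<And>n. simple_function M (s n)" "\<And>x. x \<in> space M \<Longrightarrow> (\<lambda>n. s n x) \<longlonglongrightarrow> u x"
    using strongly_measurable_borel[OF u] unfolding strongly_measurable_def by metis
  have uS: "{x \<in> space M. u x \<in> S} \<in> sets M"
    using measurable_sets[OF u, of S] S by (simp add: vimage_def Int_def conj_commute)
  then have i: "simple_function M (\<lambda>x. u x \<in> S)"
    unfolding simple_function_def
  proof safe
    fix b
    have "(\<lambda>x. u x \<in> S) -` {u b \<in> S} \<inter> space M = (if u b \<in> S then {x \<in> space M. u x \<in> S} else space M - {x \<in> space M. u x \<in> S})"
      by auto
    then show "(\<lambda>x. u x \<in> S) -` {u b \<in> S} \<inter> space M \<in> sets M" using uS by (simp del: Diff_eq_empty_iff)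
  qed (auto intro: finite_subset[OF subset_UNIV])
  show ?thesis
    unfolding strongly_measurable_def
  proof (intro exI[of _ "\<lambda>n x. if u x \<in> S then f (s n x) else 0"] conjI allI ballI)
    show "simple_function M (\<lambda>x. if u x \<in> S then f (s n x) else 0)" for n
      using simple_function_compose2[OF i s(1)[of n], of "\<lambda>p y. if p then f y else 0"] .
    show "(\<lambda>n. if u x \<in> S then f (s n x) else 0) \<longlonglongrightarrow> (if u x \<in> S then f (u x) else 0)" if x: "x \<in> space M" for x
    proof (cases "u x \<in> S")
      case True
      then have "isCont f (u x)" using S f by (simp add: continuous_on_eq_continuous_at)
      from isCont_tendsto_compose[OF this s(2)[OF x]] show ?thesis using True by simp
    qed simp
  qed
qed

section \<open>The space of square-integrable functions\<close>

context
  fixes \<gamma> :: "real \<Rightarrow> complex"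
begin

lemma space_M [simp]: "space (arclength \<gamma>) = UNIV" and sets_M [simp, measurable_cong]: "sets (arclength \<gamma>) = sets borel"
  by (simp_all add: arclength_def)

lemma ae_class_cong: "(AE z in arclength \<gamma>. f z = g z) \<Longrightarrow> ae_class \<gamma> f = ae_class \<gamma> g"
  unfolding ae_class_def
proof (rule Collect_cong, rule conj_cong[OF refl])
  fix h assume fg: "AE z in arclength \<gamma>. f z = g z"
  show "(AE z in arclength \<gamma>. h z = f z) \<longleftrightarrow> (AE z in arclength \<gamma>. h z = g z)"
  proof
    assume "AE z in arclength \<gamma>. h z = f z" then show "AE z in arclength \<gamma>. h z = g z" using fg by eventually_elim simp
  next
    assume "AE z in arclength \<gamma>. h z = g z" then show "AE z in arclength \<gamma>. h z = f z" using fg by eventually_elim simp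
  qed
qed

lemma rep_ae_class:
  assumes "strongly_measurable (arclength \<gamma>) f"
  shows "strongly_measurable (arclength \<gamma>) (rep (ae_class \<gamma> f))" and "AE z in arclength \<gamma>. rep (ae_class \<gamma> f) z = f z"
proof -
  have "f \<in> ae_class \<gamma> f" using assms by (simp add: ae_class_def)
  then have "rep (ae_class \<gamma> f) \<in> ae_class \<gamma> f" unfolding rep_def by (auto simp: some_in_eq)
  then show "strongly_measurable (arclength \<gamma>) (rep (ae_class \<gamma> f))" "AE z in arclength \<gamma>. rep (ae_class \<gamma> f) z = f z"
    by (auto simp: ae_class_def)
qed

lemma square_integrable_AE:
  fixes f g :: "complex \<Rightarrow> 'h::real_normed_vector"
  assumes "square_integrable (arclength \<gamma>) f" "strongly_measurable (arclength \<gamma>) g" "AE z in arclength \<gamma>. g z = f z"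
  shows "square_integrable (arclength \<gamma>) g"
proof -
  have "integrable (arclength \<gamma>) (\<lambda>z. (norm (g z))\<^sup>2) \<longleftrightarrow> integrable (arclength \<gamma>) (\<lambda>z. (norm (f z))\<^sup>2)"
    using assms by (intro integrable_cong_AE) (auto simp: square_integrable_def intro!: borel_measurable_power borel_measurable_norm_strongly)
  then show ?thesis using assms by (simp add: square_integrable_def)
qed

lemma square_integrable_bound:
  fixes f :: "complex \<Rightarrow> 'h::real_normed_vector"
  assumes "integrable (arclength \<gamma>) h" "strongly_measurable (arclength \<gamma>) f" "AE z in arclength \<gamma>. (norm (f z))\<^sup>2 \<le> h z"
  shows "square_integrable (arclength \<gamma>) f"
  unfolding square_integrable_def
proof
  show "integrable (arclength \<gamma>) (\<lambda>z. (norm (f z))\<^sup>2)"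
  proof (rule Bochner_Integration.integrable_bound[OF assms(1)])
    show "AE z in arclength \<gamma>. norm ((norm (f z))\<^sup>2) \<le> norm (h z)" using assms(3) by eventually_elim auto
  qed (use assms in \<open>auto intro!: borel_measurable_power borel_measurable_norm_strongly\<close>)
qed (rule assms)

lemma square_integrable_add:
  fixes f g :: "complex \<Rightarrow> 'h::real_inner"
  assumes "square_integrable (arclength \<gamma>) f" "square_integrable (arclength \<gamma>) g"
  shows "square_integrable (arclength \<gamma>) (\<lambda>z. f z + g z)"
proof (rule square_integrable_bound)
  show "integrable (arclength \<gamma>) (\<lambda>z. 2 * (norm (f z))\<^sup>2 + 2 * (norm (g z))\<^sup>2)"
    using assms by (auto simp: square_integrable_def)
  have "(norm (f z + g z))\<^sup>2 \<le> 2 * (norm (f z))\<^sup>2 + 2 * (norm (g z))\<^sup>2" for z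
    using parallelogram[of "f z" "g z"] zero_le_power2[of "norm (f z - g z)"] by linarith
  then show "AE z in arclength \<gamma>. (norm (f z + g z))\<^sup>2 \<le> 2 * (norm (f z))\<^sup>2 + 2 * (norm (g z))\<^sup>2" by simp
qed (use assms in \<open>auto simp: square_integrable_def intro: strongly_measurable_add\<close>)

lemma square_integrable_scaleC:
  fixes f :: "complex \<Rightarrow> 'h::complex_inner"
  assumes "square_integrable (arclength \<gamma>) f" "m \<in> borel_measurable (arclength \<gamma>)" "AE z in arclength \<gamma>. cmod (m z) \<le> k"
  shows "square_integrable (arclength \<gamma>) (\<lambda>z. m z *\<^sub>C f z)"
proof (rule square_integrable_bound)
  show "integrable (arclength \<gamma>) (\<lambda>z. k\<^sup>2 * (norm (f z))\<^sup>2)"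
    using assms by (auto simp: square_integrable_def)
  show "AE z in arclength \<gamma>. (norm (m z *\<^sub>C f z))\<^sup>2 \<le> k\<^sup>2 * (norm (f z))\<^sup>2"
    using assms(3) by eventually_elim (simp add: power_mult_distrib mult_right_mono power_mono)
qed (use assms in \<open>auto simp: square_integrable_def intro: strongly_measurable_scaleC\<close>)

lemma integrable_cinner:
  fixes f g :: "complex \<Rightarrow> 'h::complex_inner"
  assumes "square_integrable (arclength \<gamma>) f" "square_integrable (arclength \<gamma>) g"
  shows "integrable (arclength \<gamma>) (\<lambda>z. cinner (f z) (g z))"
proof (rule Bochner_Integration.integrable_bound)
  show "integrable (arclength \<gamma>) (\<lambda>z. (norm (f z))\<^sup>2 + (norm (g z))\<^sup>2)"
    using assms by (auto simp: square_integrable_def)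
  have "cmod (cinner (f z) (g z)) \<le> (norm (f z))\<^sup>2 + (norm (g z))\<^sup>2" for z
    using norm_cinner[of "f z" "g z"] sum_squares_bound[of "norm (f z)" "norm (g z)"]
      mult_nonneg_nonneg[OF norm_ge_zero norm_ge_zero, of "f z" "g z"] by linarith
  then show "AE z in arclength \<gamma>. norm (cinner (f z) (g z)) \<le> norm ((norm (f z))\<^sup>2 + (norm (g z))\<^sup>2)" by simp
qed (use assms in \<open>auto simp: square_integrable_def intro: borel_measurable_cinner\<close>)

lemma L2_carrierI: "square_integrable (arclength \<gamma>) f \<Longrightarrow> ae_class \<gamma> f \<in> hcarrier (L2 \<gamma>)"
  by (simp add: L2_def)

lemma L2_rep:
  assumes "F \<in> hcarrier (L2 \<gamma>)"
  shows square_integrable_rep: "square_integrable (arclength \<gamma>) (rep F)" and ae_class_rep: "ae_class \<gamma> (rep F) = F"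
proof -
  obtain f where f: "square_integrable (arclength \<gamma>) f" "F = ae_class \<gamma> f" using assms by (auto simp: L2_def)
  note r = rep_ae_class[of f, folded f(2)]
  show "square_integrable (arclength \<gamma>) (rep F)" using f r by (intro square_integrable_AE[OF f(1)]) (auto simp: square_integrable_def)
  show "ae_class \<gamma> (rep F) = F" unfolding f(2) using f r by (intro ae_class_cong) (auto simp: square_integrable_def f(2))
qed

lemma strongly_measurable_rep: "F \<in> hcarrier (L2 \<gamma>) \<Longrightarrow> strongly_measurable (arclength \<gamma>) (rep F)"
  using square_integrable_rep by (auto simp: square_integrable_def)

lemma L2_eqI:
  "F \<in> hcarrier (L2 \<gamma>) \<Longrightarrow> G \<in> hcarrier (L2 \<gamma>) \<Longrightarrow> (AE z in arclength \<gamma>. rep F z = rep G z) \<Longrightarrow> F = G"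
  by (metis ae_class_cong ae_class_rep)

lemma hip_L2: "hip (L2 \<gamma>) F G = (LINT z|arclength \<gamma>. cinner (rep F z) (rep G z))"
  by (simp add: L2_def)

text \<open>Inner products, and by the lemmas that follow also sums and multiples, may be computed with any
  strongly measurable functions that agree almost everywhere with the chosen representatives.\<close>

lemma hip_L2_cong:
  assumes "F \<in> hcarrier (L2 \<gamma>)" "G \<in> hcarrier (L2 \<gamma>)" "strongly_measurable (arclength \<gamma>) f" "strongly_measurable (arclength \<gamma>) g"
    "AE z in arclength \<gamma>. rep F z = f z" "AE z in arclength \<gamma>. rep G z = g z"
  shows "hip (L2 \<gamma>) F G = (LINT z|arclength \<gamma>. cinner (f z) (g z))"
  unfolding hip_L2
proof (rule integral_cong_AE)
  show "AE z in arclength \<gamma>. cinner (rep F z) (rep G z) = cinner (f z) (g z)" using assms(5,6) by eventually_elim simp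
qed (use assms in \<open>auto intro: borel_measurable_cinner strongly_measurable_rep\<close>)

lemma L2_add:
  assumes "F \<in> hcarrier (L2 \<gamma>)" "G \<in> hcarrier (L2 \<gamma>)"
  shows "hadd (L2 \<gamma>) F G \<in> hcarrier (L2 \<gamma>)" and "AE z in arclength \<gamma>. rep (hadd (L2 \<gamma>) F G) z = rep F z + rep G z"
proof -
  have e: "hadd (L2 \<gamma>) F G = ae_class \<gamma> (\<lambda>z. rep F z + rep G z)" by (simp add: L2_def)
  show "hadd (L2 \<gamma>) F G \<in> hcarrier (L2 \<gamma>)"
    unfolding e by (intro L2_carrierI square_integrable_add square_integrable_rep assms)
  show "AE z in arclength \<gamma>. rep (hadd (L2 \<gamma>) F G) z = rep F z + rep G z"
    unfolding e by (intro rep_ae_class strongly_measurable_add strongly_measurable_rep assms)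
qed

definition mult_op :: "(complex \<Rightarrow> complex) \<Rightarrow> (complex \<Rightarrow> 'h::complex_inner) set \<Rightarrow> (complex \<Rightarrow> 'h) set" where
  "mult_op m F = ae_class \<gamma> (\<lambda>z. m z *\<^sub>C rep F z)"

lemma L2_mult:
  assumes "F \<in> hcarrier (L2 \<gamma>)" "m \<in> borel_measurable (arclength \<gamma>)" "AE z in arclength \<gamma>. cmod (m z) \<le> k"
  shows "mult_op m F \<in> hcarrier (L2 \<gamma>)" and "AE z in arclength \<gamma>. rep (mult_op m F) z = m z *\<^sub>C rep F z"
proof -
  show "mult_op m F \<in> hcarrier (L2 \<gamma>)"
    unfolding mult_op_def by (intro L2_carrierI square_integrable_scaleC[OF _ assms(2,3)] square_integrable_rep assms)
  show "AE z in arclength \<gamma>. rep (mult_op m F) z = m z *\<^sub>C rep F z"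
    unfolding mult_op_def by (intro rep_ae_class strongly_measurable_scaleC strongly_measurable_rep assms)
qed

lemma hscale_L2: "hscale (L2 \<gamma>) w F = mult_op (\<lambda>_. w) F"
  by (simp add: L2_def mult_op_def)

lemma L2_scale:
  assumes "F \<in> hcarrier (L2 \<gamma>)"
  shows "hscale (L2 \<gamma>) w F \<in> hcarrier (L2 \<gamma>)" and "AE z in arclength \<gamma>. rep (hscale (L2 \<gamma>) w F) z = w *\<^sub>C rep F z"
  using L2_mult[OF assms, of "\<lambda>_. w" "cmod w"] by (simp_all add: hscale_L2)

lemma L2_zero:
  "hzero (L2 \<gamma>) \<in> hcarrier (L2 \<gamma> :: (complex \<Rightarrow> 'h::complex_inner) set hilb)"
  "AE z in arclength \<gamma>. rep (hzero (L2 \<gamma>)) z = (0 :: 'h)"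
proof -
  have e: "hzero (L2 \<gamma>) = ae_class \<gamma> (\<lambda>_. 0 :: 'h)" by (simp add: L2_def)
  show "hzero (L2 \<gamma>) \<in> hcarrier (L2 \<gamma> :: (complex \<Rightarrow> 'h) set hilb)"
    unfolding e by (intro L2_carrierI) (simp add: square_integrable_def strongly_measurable_const)
  show "AE z in arclength \<gamma>. rep (hzero (L2 \<gamma>)) z = (0 :: 'h)"
    unfolding e by (rule rep_ae_class) (rule strongly_measurable_const)
qed

lemma hip_L2_self: "F \<in> hcarrier (L2 \<gamma>) \<Longrightarrow> hip (L2 \<gamma>) F F = complex_of_real (LINT z|arclength \<gamma>. (norm (rep F z))\<^sup>2)"
  by (simp add: hip_L2 cinner_self del: of_real_power)

lemma prehilbert_L2: "prehilbert (L2 \<gamma> :: (complex \<Rightarrow> 'h::complex_inner) set hilb)"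
proof
  fix F G K :: "(complex \<Rightarrow> 'h) set" and w
  note sm = strongly_measurable_rep and ic = integrable_cinner[OF square_integrable_rep square_integrable_rep]
  show "hzero (L2 \<gamma>) \<in> hcarrier (L2 \<gamma> :: (complex \<Rightarrow> 'h) set hilb)" by (rule L2_zero)
  assume F: "F \<in> hcarrier (L2 \<gamma>)"
  show "hscale (L2 \<gamma>) w F \<in> hcarrier (L2 \<gamma>)" by (rule L2_scale[OF F])
  have z: "hip (L2 \<gamma>) (hzero (L2 \<gamma>)) F = (LINT z|arclength \<gamma>. cinner 0 (rep F z))"
    by (rule hip_L2_cong[OF L2_zero(1) F strongly_measurable_const sm[OF F] L2_zero(2)]) simp
  then show "hip (L2 \<gamma>) (hzero (L2 \<gamma>)) F = 0" by simp
  show "0 \<le> Re (hip (L2 \<gamma>) F F)" by (simp add: hip_L2_self[OF F] del: of_real_power)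
  assume G: "G \<in> hcarrier (L2 \<gamma>)"
  show "hadd (L2 \<gamma>) F G \<in> hcarrier (L2 \<gamma>)" by (rule L2_add[OF F G])
  have "hip (L2 \<gamma>) (hscale (L2 \<gamma>) w F) G = (LINT z|arclength \<gamma>. cinner (w *\<^sub>C rep F z) (rep G z))"
    by (rule hip_L2_cong[OF L2_scale(1)[OF F] G _ sm[OF G] L2_scale(2)[OF F]])
       (auto intro: strongly_measurable_scaleC sm[OF F])
  then show "hip (L2 \<gamma>) (hscale (L2 \<gamma>) w F) G = w * hip (L2 \<gamma>) F G"
    by (simp add: cinner_scaleC_left hip_L2)
  show "hip (L2 \<gamma>) F G = cnj (hip (L2 \<gamma>) G F)"
    unfolding hip_L2 by (subst cinner_commute) (rule Bochner_Integration.integral_cnj)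
  show "hip (L2 \<gamma>) (hadd (L2 \<gamma>) F G) K = hip (L2 \<gamma>) F K + hip (L2 \<gamma>) G K" if K: "K \<in> hcarrier (L2 \<gamma>)"
  proof -
    have "hip (L2 \<gamma>) (hadd (L2 \<gamma>) F G) K = (LINT z|arclength \<gamma>. cinner (rep F z + rep G z) (rep K z))"
      by (rule hip_L2_cong[OF L2_add(1)[OF F G] K _ sm[OF K] L2_add(2)[OF F G]])
         (auto intro: strongly_measurable_add sm F G)
    then show ?thesis by (simp add: cinner_add_left hip_L2 ic F G K)
  qed
  show "F = G" if eq: "\<And>z. z \<in> hcarrier (L2 \<gamma>) \<Longrightarrow> hip (L2 \<gamma>) F z = hip (L2 \<gamma>) G z"
  proof -
    let ?N = "hscale (L2 \<gamma>) (-1) G"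
    define W where "W = hadd (L2 \<gamma>) F ?N"
    note N = L2_scale[OF G, of "-1"]
    have W: "W \<in> hcarrier (L2 \<gamma>)" "AE z in arclength \<gamma>. rep W z = rep F z - rep G z"
    proof -
      show "W \<in> hcarrier (L2 \<gamma>)" unfolding W_def by (rule L2_add[OF F N(1)])
      show "AE z in arclength \<gamma>. rep W z = rep F z - rep G z"
        using L2_add(2)[OF F N(1)] N(2) unfolding W_def by eventually_elim (simp add: scaleC_minus_one)
    qed
    have "hip (L2 \<gamma>) W W = (LINT z|arclength \<gamma>. cinner (rep F z - rep G z) (rep W z))"
      by (rule hip_L2_cong[OF W(1) W(1) _ sm[OF W(1)] W(2)]) (auto intro: strongly_measurable_diff sm F G)
    also have "\<dots> = hip (L2 \<gamma>) F W - hip (L2 \<gamma>) G W"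
      by (simp add: cinner_diff_left hip_L2 ic F G W)
    also have "\<dots> = 0" using eq[OF W(1)] by simp
    finally have "(LINT z|arclength \<gamma>. (norm (rep W z))\<^sup>2) = 0"
      by (simp add: hip_L2_self[OF W(1)] del: of_real_power)
    then have "AE z in arclength \<gamma>. (norm (rep W z))\<^sup>2 = 0"
      using square_integrable_rep[OF W(1)] by (subst (asm) integral_nonneg_eq_0_iff_AE) (auto simp: square_integrable_def)
    then have "AE z in arclength \<gamma>. rep F z = rep G z" using W(2) by eventually_elim simp
    then show "F = G" by (rule L2_eqI[OF F G])
  qed
qed

lemma hnorm_L2_power2: "F \<in> hcarrier (L2 \<gamma>) \<Longrightarrow> (hnorm (L2 \<gamma>) F)\<^sup>2 = (LINT z|arclength \<gamma>. (norm (rep F z))\<^sup>2)"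
  using prehilbert.hnorm_power2[OF prehilbert_L2, of F] by (simp add: hip_L2_self del: of_real_power)

lemma hnorm_L2_le:
  assumes "F \<in> hcarrier (L2 \<gamma>)" "G \<in> hcarrier (L2 \<gamma>)" "AE z in arclength \<gamma>. norm (rep F z) \<le> k * norm (rep G z)" "k \<ge> 0"
  shows "hnorm (L2 \<gamma>) F \<le> k * hnorm (L2 \<gamma>) G"
proof -
  have "(hnorm (L2 \<gamma>) F)\<^sup>2 \<le> (LINT z|arclength \<gamma>. k\<^sup>2 * (norm (rep G z))\<^sup>2)"
    unfolding hnorm_L2_power2[OF assms(1)]
  proof (rule integral_mono_AE)
    show "AE z in arclength \<gamma>. (norm (rep F z))\<^sup>2 \<le> k\<^sup>2 * (norm (rep G z))\<^sup>2"
      using assms(3) by eventually_elim (simp add: power_mult_distrib[symmetric] power_mono)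
  qed (use assms square_integrable_rep in \<open>auto simp: square_integrable_def\<close>)
  also have "\<dots> = (k * hnorm (L2 \<gamma>) G)\<^sup>2" by (simp add: power_mult_distrib hnorm_L2_power2 assms)
  finally show ?thesis
    using prehilbert.hnorm_nonneg[OF prehilbert_L2 assms(1)] prehilbert.hnorm_nonneg[OF prehilbert_L2 assms(2)] assms(4)
    by (simp add: power2_le_iff_abs_le)
qed

lemma bounded_ops_mult:
  assumes m: "m \<in> borel_measurable (arclength \<gamma>)" "AE z in arclength \<gamma>. cmod (m z) \<le> k" "k \<ge> 0"
  shows "mult_op m \<in> bounded_ops (L2 \<gamma> :: (complex \<Rightarrow> 'h::complex_inner) set hilb) (L2 \<gamma>)"
proof (rule bounded_opsI)
  fix F G :: "(complex \<Rightarrow> 'h) set" and w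
  assume F: "F \<in> hcarrier (L2 \<gamma>)"
  note mF = L2_mult[OF F m(1,2)]
  show "mult_op m F \<in> hcarrier (L2 \<gamma>)" by (rule mF)
  note wF = L2_scale[OF F, of w] and wmF = L2_scale[OF mF(1), of w]
  show "mult_op m (hscale (L2 \<gamma>) w F) = hscale (L2 \<gamma>) w (mult_op m F)"
  proof (rule L2_eqI)
    show "AE z in arclength \<gamma>. rep (mult_op m (hscale (L2 \<gamma>) w F)) z = rep (hscale (L2 \<gamma>) w (mult_op m F)) z"
      using L2_mult(2)[OF wF(1) m(1,2)] wF(2) wmF(2) mF(2)
      by eventually_elim (simp add: scaleC_scaleC mult.commute)
  qed (use L2_mult(1)[OF wF(1) m(1,2)] wmF in auto)
  show "hnorm (L2 \<gamma>) (mult_op m F) \<le> k * hnorm (L2 \<gamma>) F"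
  proof (rule hnorm_L2_le[OF mF(1) F _ m(3)])
    show "AE z in arclength \<gamma>. norm (rep (mult_op m F) z) \<le> k * norm (rep F z)"
      using mF(2) m(2) by eventually_elim (simp add: mult_right_mono)
  qed
  assume G: "G \<in> hcarrier (L2 \<gamma>)"
  note mG = L2_mult[OF G m(1,2)] and FG = L2_add[OF F G]
  show "mult_op m (hadd (L2 \<gamma>) F G) = hadd (L2 \<gamma>) (mult_op m F) (mult_op m G)"
  proof (rule L2_eqI)
    show "AE z in arclength \<gamma>. rep (mult_op m (hadd (L2 \<gamma>) F G)) z = rep (hadd (L2 \<gamma>) (mult_op m F) (mult_op m G)) z"
      using L2_mult(2)[OF FG(1) m(1,2)] FG(2) L2_add(2)[OF mF(1) mG(1)] mF(2) mG(2)
      by eventually_elim (simp add: scaleC_add_right)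
  qed (use L2_mult(1)[OF FG(1) m(1,2)] L2_add(1)[OF mF(1) mG(1)] in auto)
qed

lemma D_op_eq_mult: "D_op \<gamma> = mult_op (\<lambda>z. z)"
  by (auto simp: D_op_def mult_op_def)

lemma spectral_measure_eq_mult: "spectral_measure \<gamma> \<delta> = mult_op (\<lambda>z. of_real (indicator \<delta> z))"
  by (rule ext) (simp only: spectral_measure_def mult_op_def scaleC_of_real)

lemma hip_mult_op_left:
  assumes "F \<in> hcarrier (L2 \<gamma>)" "G \<in> hcarrier (L2 \<gamma>)" "m \<in> borel_measurable (arclength \<gamma>)" "AE z in arclength \<gamma>. cmod (m z) \<le> k"
  shows "hip (L2 \<gamma>) (mult_op m F) G = (LINT z|arclength \<gamma>. m z * cinner (rep F z) (rep G z))"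
proof -
  have "hip (L2 \<gamma>) (mult_op m F) G = (LINT z|arclength \<gamma>. cinner (m z *\<^sub>C rep F z) (rep G z))"
    by (rule hip_L2_cong[OF L2_mult(1)[OF assms(1,3,4)] assms(2) _ strongly_measurable_rep[OF assms(2)] L2_mult(2)[OF assms(1,3,4)]])
      (auto intro: strongly_measurable_scaleC strongly_measurable_rep assms)
  then show ?thesis by (simp add: cinner_scaleC_left)
qed

lemma hip_mult_op_right:
  assumes "F \<in> hcarrier (L2 \<gamma>)" "G \<in> hcarrier (L2 \<gamma>)" "m \<in> borel_measurable (arclength \<gamma>)" "AE z in arclength \<gamma>. cmod (m z) \<le> k"
  shows "hip (L2 \<gamma>) F (mult_op m G) = (LINT z|arclength \<gamma>. cnj (m z) * cinner (rep F z) (rep G z))"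
proof -
  have "hip (L2 \<gamma>) F (mult_op m G) = (LINT z|arclength \<gamma>. cinner (rep F z) (m z *\<^sub>C rep G z))"
    by (rule hip_L2_cong[OF assms(1) L2_mult(1)[OF assms(2,3,4)] strongly_measurable_rep[OF assms(1)] _ _ L2_mult(2)[OF assms(2,3,4)]])
      (auto intro: strongly_measurable_scaleC strongly_measurable_rep assms)
  then show ?thesis by (simp add: cinner_scaleC_right)
qed

end

section \<open>The gauge integral of strongly measurable functions\<close>

abbreviation unit_interval :: "real measure" where
  "unit_interval \<equiv> restrict_space lborel {0..1}"

lemma integrable_unit_interval_HK:
  fixes f :: "real \<Rightarrow> 'b::euclidean_space"
  assumes "integrable unit_interval f"
  shows "(f has_integral (integral\<^sup>L unit_interval f)) {0..1}"
proof -
  have i: "set_integrable lborel {0..1} f"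
    using assms by (simp add: integrable_restrict_space set_integrable_def)
  have "integral\<^sup>L unit_interval f = (LINT x : {0..1} | lborel. f x)"
    by (simp add: integral_restrict_space set_lebesgue_integral_def)
  also have "\<dots> = integral {0..1} f" by (rule set_borel_integral_eq_integral(2)[OF i])
  finally show ?thesis using set_borel_integral_eq_integral(1)[OF i] by (simp add: integrable_integral)
qed

lemma simple_function_integrable_on:
  fixes s :: "real \<Rightarrow> 'a::banach"
  assumes s: "simple_function unit_interval s"
  shows "s integrable_on {0..1}"
proof -
  let ?R = "s ` {0..1}"
  have fin: "finite ?R" using s by (simp add: simple_function_def space_restrict_space)
  have E: "(\<lambda>t. indicator (s -` {y} \<inter> {0..1}) t *\<^sub>R y) integrable_on {0..1}" if "y \<in> ?R" for y
  proof -
    have "s -` {y} \<inter> {0..1} \<in> sets unit_interval"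
      using s that by (auto simp: simple_function_def space_restrict_space)
    moreover have "emeasure unit_interval (s -` {y} \<inter> {0..1}) < \<infinity>"
    proof -
      have "emeasure unit_interval (s -` {y} \<inter> {0..1}) \<le> emeasure unit_interval (space unit_interval)"
        by (rule emeasure_space)
      also have "\<dots> = 1" by (simp add: space_restrict_space emeasure_restrict_space)
      finally show ?thesis by (auto intro: le_less_trans)
    qed
    ultimately have "integrable unit_interval (indicator (s -` {y} \<inter> {0..1}) :: real \<Rightarrow> real)"
      by (rule integrable_real_indicator)
    then have "(indicator (s -` {y} \<inter> {0..1}) :: real \<Rightarrow> real) integrable_on {0..1}"
      using integrable_unit_interval_HK by blast
    from integrable_linear[OF this bounded_linear_scaleR_left[of y]] show ?thesis by (simp add: o_def)
  qed
  have "(\<lambda>t. \<Sum>y\<in>?R. indicator (s -` {y} \<inter> {0..1}) t *\<^sub>R y) integrable_on {0..1}"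
    by (rule integrable_sum[OF fin E])
  moreover have "(\<Sum>y\<in>?R. indicator (s -` {y} \<inter> {0..1}) t *\<^sub>R y) = s t" if t: "t \<in> {0..1}" for t
  proof -
    have "(\<Sum>y\<in>?R. indicator (s -` {y} \<inter> {0..1}) t *\<^sub>R y) = (\<Sum>y\<in>?R. if y = s t then s t else 0)"
      by (rule sum.cong) (use t in \<open>auto simp: indicator_def\<close>)
    then show ?thesis using fin t by (simp add: sum.delta')
  qed
  ultimately show ?thesis by (rule integrable_eq)
qed

text \<open>A function that is well approximated by a gauge integrable \<open>s\<close> in the integral of the norm satisfies
  the Cauchy criterion: the Riemann sums of \<open>h\<close> and \<open>s\<close> differ by at most a Riemann sum of
  \<open>norm (h t - s t)\<close>.\<close>

lemma integrable_on_approx: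
  fixes h :: "real \<Rightarrow> 'a::banach"
  assumes "\<And>e. e > 0 \<Longrightarrow> \<exists>s I. s integrable_on {0..1} \<and> ((\<lambda>t. norm (h t - s t)) has_integral I) {0..1} \<and> I < e"
  shows "h integrable_on {0..1}"
proof -
  have "h integrable_on cbox 0 1"
    unfolding integrable_Cauchy
  proof (intro allI impI)
    fix e :: real assume e: "e > 0"
    obtain s I where s: "s integrable_on {0..1}" and I: "((\<lambda>t. norm (h t - s t)) has_integral I) (cbox 0 1)" "I < e/4"
      using assms[of "e/4"] e by auto
    define J where "J = integral {0..1} s"
    have J: "(s has_integral J) (cbox 0 1)" using s by (simp add: J_def has_integral_integral)
    obtain g1 where g1: "gauge g1"
      "\<And>p. p tagged_division_of (cbox 0 1) \<Longrightarrow> g1 fine p \<Longrightarrow> norm ((\<Sum>(x,k)\<in>p. measure lborel k *\<^sub>R s x) - J) < e/8"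
      using J e unfolding has_integral[of s] by (meson divide_pos_pos zero_less_numeral)
    obtain g2 where g2: "gauge g2"
      "\<And>p. p tagged_division_of (cbox 0 1) \<Longrightarrow> g2 fine p \<Longrightarrow> norm ((\<Sum>(x,k)\<in>p. measure lborel k *\<^sub>R norm (h x - s x)) - I) < e/8"
      using I(1) e unfolding has_integral[of "\<lambda>t. norm (h t - s t)"] by (meson divide_pos_pos zero_less_numeral)
    have key: "norm ((\<Sum>(x,k)\<in>p. measure lborel k *\<^sub>R h x) - J) < e / 2"
      if p: "p tagged_division_of (cbox 0 1)" "(\<lambda>x. g1 x \<inter> g2 x) fine p" for p
    proof -
      have f: "g1 fine p" "g2 fine p" using p(2) by (auto simp: fine_Int)
      have "norm ((\<Sum>(x,k)\<in>p. measure lborel k *\<^sub>R h x) - (\<Sum>(x,k)\<in>p. measure lborel k *\<^sub>R s x))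
          = norm (\<Sum>(x,k)\<in>p. measure lborel k *\<^sub>R (h x - s x))"
        by (simp add: sum_subtractf[symmetric] case_prod_unfold scaleR_diff_right)
      also have "\<dots> \<le> (\<Sum>(x,k)\<in>p. measure lborel k *\<^sub>R norm (h x - s x))"
        by (rule order_trans[OF norm_sum]) (simp add: case_prod_unfold)
      finally show ?thesis using g1(2)[OF p(1) f(1)] g2(2)[OF p(1) f(2)] I(2)
        norm_triangle_ineq[of "(\<Sum>(x,k)\<in>p. measure lborel k *\<^sub>R h x) - (\<Sum>(x,k)\<in>p. measure lborel k *\<^sub>R s x)" "(\<Sum>(x,k)\<in>p. measure lborel k *\<^sub>R s x) - J"]
        by (simp add: abs_if split: if_splits)
    qed
    show "\<exists>\<gamma>. gauge \<gamma> \<and>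
          (\<forall>\<D>1 \<D>2. \<D>1 tagged_division_of (cbox 0 1) \<and> \<gamma> fine \<D>1 \<and>
            \<D>2 tagged_division_of (cbox 0 1) \<and> \<gamma> fine \<D>2 \<longrightarrow>
            norm ((\<Sum>(x,K)\<in>\<D>1. measure lborel K *\<^sub>R h x) - (\<Sum>(x,K)\<in>\<D>2. measure lborel K *\<^sub>R h x)) < e)"
    proof (intro exI[of _ "\<lambda>x. g1 x \<inter> g2 x"] conjI allI impI gauge_Int g1(1) g2(1), elim conjE)
      fix p q assume "p tagged_division_of (cbox 0 1)" "(\<lambda>x. g1 x \<inter> g2 x) fine p"
        "q tagged_division_of (cbox 0 1)" "(\<lambda>x. g1 x \<inter> g2 x) fine q"
      then have "norm ((\<Sum>(x,k)\<in>p. measure lborel k *\<^sub>R h x) - J) < e / 2" "norm ((\<Sum>(x,k)\<in>q. measure lborel k *\<^sub>R h x) - J) < e / 2"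
        using key by blast+
      then show "norm ((\<Sum>(x,K)\<in>p. measure lborel K *\<^sub>R h x) - (\<Sum>(x,K)\<in>q. measure lborel K *\<^sub>R h x)) < e"
        by (metis dist_norm dist_triangle_half_l dist_commute)
    qed
  qed
  then show ?thesis by simp
qed

text \<open>The simple functions are cut off where they exceed \<open>2 \<parallel>h t\<parallel>\<close>, so that dominated convergence
  applies to \<open>\<parallel>h t - u n t\<parallel>\<close>.  This connects the gauge integral in the definition of the
  deformed operator with Lebesgue's theory.\<close>

lemma strongly_measurable_integrable_on:
  fixes h :: "real \<Rightarrow> 'a::banach"
  assumes h: "strongly_measurable unit_interval h" and int: "integrable unit_interval (\<lambda>t. norm (h t))"
  shows "h integrable_on {0..1}"
proof (rule integrable_on_approx)
  fix e :: real assume e: "e > 0"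
  obtain s where s: "\<And>n. simple_function unit_interval (s n)"
    "\<And>x. x \<in> space unit_interval \<Longrightarrow> (\<lambda>n. s n x) \<longlonglongrightarrow> h x"
    using h unfolding strongly_measurable_def by metis
  have nh [measurable]: "(\<lambda>t. norm (h t)) \<in> borel_measurable unit_interval" using h by (rule borel_measurable_norm_strongly)
  define u where "u n t = (if norm (s n t) \<le> 2 * norm (h t) then s n t else 0)" for n t
  have u: "simple_function unit_interval (u n)" for n
  proof -
    have sn: "s n \<in> measurable unit_interval (count_space UNIV)" by (rule measurable_simple_function[OF s(1)])
    have nsn: "(\<lambda>t. norm (s n t)) \<in> borel_measurable unit_interval"
      using borel_measurable_simple_function[OF simple_function_compose1[OF s(1)[of n], of norm]] .
    have P: "{t \<in> space unit_interval. norm (s n t) \<le> 2 * norm (h t)} \<in> sets unit_interval"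
      using nsn nh by measurable
    have "simple_function unit_interval (\<lambda>t. if t \<in> {t \<in> space unit_interval. norm (s n t) \<le> 2 * norm (h t)} then s n t else 0)"
      by (rule simple_function_If_set[OF s(1) simple_function_const sets.Int[OF P sets.top]])
    then show ?thesis by (rule simple_function_cong[THEN iffD1, rotated]) (auto simp: u_def)
  qed
  have uh: "(\<lambda>n. u n t) \<longlonglongrightarrow> h t" if t: "t \<in> space unit_interval" for t
  proof (cases "h t = 0")
    case True
    then have "u n t = 0" for n by (auto simp: u_def)
    then show ?thesis using True by simp
  next
    case False
    have "(\<lambda>n. norm (s n t)) \<longlonglongrightarrow> norm (h t)" by (intro tendsto_norm s(2) t)
    moreover have "norm (h t) < 2 * norm (h t)" using False by simp
    ultimately have "eventually (\<lambda>n. norm (s n t) < 2 * norm (h t)) sequentially" by (rule order_tendstoD)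
    then have "eventually (\<lambda>n. u n t = s n t) sequentially" by eventually_elim (simp add: u_def)
    then show ?thesis using s(2)[OF t] by (simp add: tendsto_cong)
  qed
  have nu [measurable]: "(\<lambda>t. norm (h t - u n t)) \<in> borel_measurable unit_interval" for n
  proof (rule borel_measurable_norm_strongly, rule strongly_measurable_diff[OF h])
    show "strongly_measurable unit_interval (u n)" unfolding strongly_measurable_def
      using u by (intro exI[of _ "\<lambda>_. u n"]) auto
  qed
  have le: "norm (h t - u n t) \<le> 3 * norm (h t)" for n t
  proof -
    have "norm (u n t) \<le> 2 * norm (h t)" by (simp add: u_def)
    then show ?thesis using norm_triangle_ineq4[of "h t" "u n t"] by linarith
  qed
  have int3: "integrable unit_interval (\<lambda>t. 3 * norm (h t))" using int by simp
  have lim0: "AE t in unit_interval. (\<lambda>n. norm (h t - u n t)) \<longlonglongrightarrow> 0"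
  proof (rule AE_I2)
    fix t assume t: "t \<in> space unit_interval"
    have "(\<lambda>n. norm (h t - u n t)) \<longlonglongrightarrow> norm (h t - h t)" by (intro tendsto_intros uh t)
    then show "(\<lambda>n. norm (h t - u n t)) \<longlonglongrightarrow> 0" by simp
  qed
  have b: "AE t in unit_interval. norm (norm (h t - u n t)) \<le> 3 * norm (h t)" for n using le by simp
  have "(\<lambda>n. LINT t|unit_interval. norm (h t - u n t)) \<longlonglongrightarrow> (LINT t|unit_interval. 0)"
    by (rule integral_dominated_convergence[OF _ nu int3 lim0 b]) simp
  then have "eventually (\<lambda>n. (LINT t|unit_interval. norm (h t - u n t)) < e) sequentially"
    using e by (intro order_tendstoD(2)) auto
  then obtain n where n: "(LINT t|unit_interval. norm (h t - u n t)) < e" by (auto simp: eventually_sequentially)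
  have i: "integrable unit_interval (\<lambda>t. norm (h t - u n t))"
    by (rule Bochner_Integration.integrable_bound[OF int3 nu]) (use le in simp)
  show "\<exists>s I. s integrable_on {0..1} \<and> ((\<lambda>t. norm (h t - s t)) has_integral I) {0..1} \<and> I < e"
    using simple_function_integrable_on[OF u] integrable_unit_interval_HK[OF i] n by blast
qed

section \<open>Piecewise smooth arcs\<close>

lemma finite_gap:
  fixes P :: "real set"
  assumes "finite P" "{0, 1} \<subseteq> P" "t \<in> {0..1} - P"
  obtains a b where "a \<in> P" "b \<in> P" "a < t" "t < b" "{a<..<b} \<inter> P = {}"
proof
  let ?A = "{p \<in> P. p < t}" and ?B = "{p \<in> P. t < p}"
  have t: "0 < t" "t < 1" using assms by (auto simp: order.order_iff_strict)
  have ne: "finite ?A" "finite ?B" "?A \<noteq> {}" "?B \<noteq> {}" using assms t by auto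
  show "Max ?A \<in> P" "Max ?A < t" using Max_in[OF ne(1,3)] by auto
  show "Min ?B \<in> P" "t < Min ?B" using Min_in[OF ne(2,4)] by auto
  show "{Max ?A<..<Min ?B} \<inter> P = {}"
  proof (rule equals0I)
    fix p assume p: "p \<in> {Max ?A<..<Min ?B} \<inter> P"
    then have "p \<noteq> t" using assms by auto
    then show False using p Max_ge[OF ne(1), of p] Min_le[OF ne(2), of p] by (cases "p < t") auto
  qed
qed

lemma linear_lower_bound_of_derivative:
  fixes f :: "real \<Rightarrow> 'b::real_normed_vector"
  assumes f: "(f has_vector_derivative v) (at x within S)" and v: "v \<noteq> 0"
  obtains e k where "e > 0" "k > 0" "\<And>y. y \<in> S \<Longrightarrow> \<bar>y - x\<bar> < e \<Longrightarrow> k * \<bar>y - x\<bar> \<le> norm (f y - f x)"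
proof -
  have "\<forall>e>0. \<exists>d>0. \<forall>y\<in>S. norm (y - x) < d \<longrightarrow> norm (f y - f x - (y - x) *\<^sub>R v) \<le> e * norm (y - x)"
    using f unfolding has_vector_derivative_def has_derivative_within_alt by blast
  from this[rule_format, of "norm v / 2"] v obtain d where d: "d > 0"
    "\<And>y. y \<in> S \<Longrightarrow> norm (y - x) < d \<Longrightarrow> norm (f y - f x - (y - x) *\<^sub>R v) \<le> norm v / 2 * norm (y - x)"
    by auto
  have "norm v / 2 * \<bar>y - x\<bar> \<le> norm (f y - f x)" if "y \<in> S" "\<bar>y - x\<bar> < d" for y
  proof -
    have "norm ((y - x) *\<^sub>R v) \<le> norm (f y - f x) + norm (f y - f x - (y - x) *\<^sub>R v)"
      using norm_triangle_ineq4[of "f y - f x" "f y - f x - (y - x) *\<^sub>R v"] by simp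
    then show ?thesis using d(2)[of y] that by (simp add: mult.commute)
  qed
  then show ?thesis using that[of d "norm v / 2"] d(1) v by auto
qed

locale smooth_arc =
  fixes \<gamma> :: "real \<Rightarrow> complex"
  assumes arc: "arc \<gamma>" and smooth: "piecewise_smooth \<gamma>"
begin

lemma smooth_pieces:
  obtains P where "finite P" "{0, 1} \<subseteq> P" "P \<subseteq> {0..1}"
    "\<forall>a\<in>P. \<forall>b\<in>P. a < b \<and> {a<..<b} \<inter> P = {} \<longrightarrow>
         (\<exists>\<gamma>'. continuous_on {a..b} \<gamma>' \<and> (\<forall>x\<in>{a..b}. (\<gamma> has_vector_derivative \<gamma>' x) (at x within {a..b}) \<and> \<gamma>' x \<noteq> 0))"
proof -
  from smooth[unfolded piecewise_smooth_def, THEN conjunct2] obtain P where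
    "finite P \<and> {0, 1} \<subseteq> P \<and> P \<subseteq> {0..1} \<and>
       (\<forall>s\<in>P. \<forall>t\<in>P. s < t \<and> {s<..<t} \<inter> P = {} \<longrightarrow>
         (\<exists>\<gamma>'. continuous_on {s..t} \<gamma>' \<and>
            (\<forall>x\<in>{s..t}. (\<gamma> has_vector_derivative \<gamma>' x) (at x within {s..t}) \<and> \<gamma>' x \<noteq> 0)))" ..
  then show ?thesis by (elim conjE) (rule that)
qed

lemma path_deriv_pieces:
  obtains P where "finite P" "P \<subseteq> {0..1}" "{0, 1} \<subseteq> P" "continuous_on ({0..1} - P) (path_deriv \<gamma>)"
    "bounded (path_deriv \<gamma> ` ({0..1} - P))" "\<forall>t\<in>{0..1} - P. path_deriv \<gamma> t \<noteq> 0"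
proof -
  obtain P where P: "finite P" "{0, 1} \<subseteq> P" "P \<subseteq> {0..1}"
    and sm: "\<forall>a\<in>P. \<forall>b\<in>P. a < b \<and> {a<..<b} \<inter> P = {} \<longrightarrow>
         (\<exists>\<gamma>'. continuous_on {a..b} \<gamma>' \<and> (\<forall>x\<in>{a..b}. (\<gamma> has_vector_derivative \<gamma>' x) (at x within {a..b}) \<and> \<gamma>' x \<noteq> 0))"
    using smooth_pieces .
  define Q where "Q = {(a, b). a \<in> P \<and> b \<in> P \<and> a < b \<and> {a<..<b} \<inter> P = {}}"
  have finQ: "finite Q" by (rule finite_subset[of _ "P \<times> P"]) (use P in \<open>auto simp: Q_def\<close>)
  have piece: "\<exists>\<gamma>'. continuous_on {a..b} \<gamma>' \<and> (\<forall>t\<in>{a<..<b}. path_deriv \<gamma> t = \<gamma>' t \<and> \<gamma>' t \<noteq> 0)"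
    if ab: "(a, b) \<in> Q" for a b
  proof -
    obtain \<gamma>' where g: "continuous_on {a..b} \<gamma>'"
      "\<And>x. x \<in> {a..b} \<Longrightarrow> (\<gamma> has_vector_derivative \<gamma>' x) (at x within {a..b}) \<and> \<gamma>' x \<noteq> 0"
    proof -
      have "a \<in> P" "b \<in> P" "a < b \<and> {a<..<b} \<inter> P = {}" using ab by (auto simp: Q_def)
      from sm[rule_format, OF this] show ?thesis using that by blast
    qed
    have "path_deriv \<gamma> t = \<gamma>' t" if t: "t \<in> {a<..<b}" for t
    proof -
      have "a \<in> {0..1}" "b \<in> {0..1}" using ab P(3) by (auto simp: Q_def)
      then have t01: "0 \<le> t" "t \<le> 1" using t by auto
      have "at t within {a..b} = at t" using t by (intro at_within_interior) simp
      then have "(\<gamma> has_vector_derivative \<gamma>' t) (at t)" using g(2)[of t] t by auto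
      from vector_derivative_at_within_ivl[OF this t01] show ?thesis by (simp add: path_deriv_def)
    qed
    then have "\<forall>t\<in>{a<..<b}. path_deriv \<gamma> t = \<gamma>' t \<and> \<gamma>' t \<noteq> 0" using g(2) by simp
    then show ?thesis using g(1) by blast
  qed
  have gap: "\<exists>a b. (a, b) \<in> Q \<and> t \<in> {a<..<b}" if t: "t \<in> {0..1} - P" for t
  proof -
    obtain a b where "a \<in> P" "b \<in> P" "a < t" "t < b" "{a<..<b} \<inter> P = {}"
      by (rule finite_gap[OF P(1,2) t])
    then show ?thesis unfolding Q_def by (intro exI[of _ a] exI[of _ b]) auto
  qed
  show ?thesis
  proof (rule that[OF P(1,3,2)])
    show "\<forall>t\<in>{0..1} - P. path_deriv \<gamma> t \<noteq> 0"
    proof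
      fix t assume t: "t \<in> {0..1} - P"
      obtain a b where ab: "(a, b) \<in> Q" "t \<in> {a<..<b}" using gap[OF t] by blast
      from piece[OF ab(1)] ab(2) show "path_deriv \<gamma> t \<noteq> 0" by metis
    qed
    have "continuous (at t) (path_deriv \<gamma>)" if t: "t \<in> {0..1} - P" for t
    proof -
      obtain a b where ab: "(a, b) \<in> Q" "t \<in> {a<..<b}" using gap[OF t] by blast
      obtain \<gamma>' where g: "continuous_on {a..b} \<gamma>'" "\<And>t. t \<in> {a<..<b} \<Longrightarrow> path_deriv \<gamma> t = \<gamma>' t"
        using piece[OF ab(1)] by blast
      have "continuous_on {a<..<b} \<gamma>'" by (rule continuous_on_subset[OF g(1)]) auto
      then have "continuous_on {a<..<b} (path_deriv \<gamma>)" by (subst continuous_on_cong[OF refl g(2)])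
      then show ?thesis using ab by (simp add: continuous_on_eq_continuous_at)
    qed
    then show "continuous_on ({0..1} - P) (path_deriv \<gamma>)" by (intro continuous_at_imp_continuous_on ballI)
    have "bounded (path_deriv \<gamma> ` {a<..<b})" if ab: "(a, b) \<in> Q" for a b
    proof -
      obtain \<gamma>' where g: "continuous_on {a..b} \<gamma>'" "\<And>t. t \<in> {a<..<b} \<Longrightarrow> path_deriv \<gamma> t = \<gamma>' t"
        using piece[OF ab(1)] by blast
      have "bounded (\<gamma>' ` {a..b})" by (intro compact_imp_bounded compact_continuous_image g) auto
      then show ?thesis by (rule bounded_subset) (use g(2) in auto)
    qed
    then have "bounded (\<Union>(a, b)\<in>Q. path_deriv \<gamma> ` {a<..<b})" using finQ by (intro bounded_UN) auto
    then show "bounded (path_deriv \<gamma> ` ({0..1} - P))"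
    proof (rule bounded_subset, safe)
      fix t :: real assume "t \<in> {0..1}" "t \<notin> P"
      then obtain a b where "(a, b) \<in> Q" "t \<in> {a<..<b}" using gap[of t] by blast
      then show "path_deriv \<gamma> t \<in> (\<Union>(a, b)\<in>Q. path_deriv \<gamma> ` {a<..<b})" by blast
    qed
  qed
qed

lemma path_deriv_bounded: obtains K where "K \<ge> 0" "\<And>t. t \<in> {0..1} \<Longrightarrow> cmod (path_deriv \<gamma> t) \<le> K"
proof -
  obtain P where P: "finite P" "P \<subseteq> {0..1}" "{0, 1} \<subseteq> P" "continuous_on ({0..1} - P) (path_deriv \<gamma>)"
    "bounded (path_deriv \<gamma> ` ({0..1} - P))" "\<forall>t\<in>{0..1} - P. path_deriv \<gamma> t \<noteq> 0" using path_deriv_pieces .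
  have "bounded (path_deriv \<gamma> ` ({0..1} - P) \<union> path_deriv \<gamma> ` P)" using P by (simp add: finite_imp_bounded)
  then obtain K where "\<And>z. z \<in> path_deriv \<gamma> ` ({0..1} - P) \<union> path_deriv \<gamma> ` P \<Longrightarrow> cmod z \<le> K"
    unfolding bounded_iff by blast
  then have "cmod (path_deriv \<gamma> t) \<le> K" if "t \<in> {0..1}" for t using that by blast
  then have "cmod (path_deriv \<gamma> t) \<le> \<bar>K\<bar>" if "t \<in> {0..1}" for t using that by fastforce
  then show ?thesis by (intro that[of "\<bar>K\<bar>"]) auto
qed

lemma borel_measurable_path_deriv: "(\<lambda>t. indicator {0..1} t *\<^sub>R path_deriv \<gamma> t) \<in> borel_measurable borel"
proof -
  obtain P where P: "finite P" "P \<subseteq> {0..1}" "{0, 1} \<subseteq> P" "continuous_on ({0..1} - P) (path_deriv \<gamma>)"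
    "bounded (path_deriv \<gamma> ` ({0..1} - P))" "\<forall>t\<in>{0..1} - P. path_deriv \<gamma> t \<noteq> 0" using path_deriv_pieces .
  have "{0..1} - P \<in> sets borel" using P by (intro sets.Diff) (auto intro: sets.countable countable_finite)
  then have "(\<lambda>t. indicator ({0..1} - P) t *\<^sub>R path_deriv \<gamma> t) \<in> borel_measurable borel"
    by (rule borel_measurable_continuous_on_indicator[OF _ P(4)])
  then show ?thesis
    by (rule measurable_discrete_difference[where X = P]) (use P in \<open>auto simp: indicator_def intro: countable_finite\<close>)
qed

lemma measurable_path_deriv [measurable]: "path_deriv \<gamma> \<in> borel_measurable unit_interval"
  using borel_measurable_path_deriv by (simp add: borel_measurable_restrict_space_iff)

lemma continuous_arc: "continuous_on {0..1} \<gamma>"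
  using arc by (simp add: arc_def path_def)

lemma inj_arc: "inj_on \<gamma> {0..1}"
  using arc by (simp add: arc_def)

lemma measurable_arc [measurable]: "\<gamma> \<in> borel_measurable unit_interval"
  using borel_measurable_continuous_on_indicator[OF _ continuous_arc]
  by (simp add: borel_measurable_restrict_space_iff)

lemma arclength_transfer:
  fixes f :: "complex \<Rightarrow> 'b::{banach, second_countable_topology}"
  assumes [measurable]: "f \<in> borel_measurable borel"
  shows "integrable (arclength \<gamma>) f \<longleftrightarrow> integrable unit_interval (\<lambda>t. cmod (path_deriv \<gamma> t) *\<^sub>R f (\<gamma> t))"
    and "integral\<^sup>L (arclength \<gamma>) f = (LINT t|unit_interval. cmod (path_deriv \<gamma> t) *\<^sub>R f (\<gamma> t))"
  unfolding arclength_def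
  by (subst integrable_distr_eq integral_distr; simp add: integrable_density integral_density)+

lemma AE_unit_intervalI:
  assumes "finite P" "\<And>t. t \<in> {0..1} - P \<Longrightarrow> Q t"
  shows "AE t in unit_interval. Q t"
proof -
  have "AE t in lborel. t \<notin> P"
    using finite_imp_null_set_lborel[OF assms(1)] by (rule AE_not_in)
  then have "AE t in lborel. t \<in> {0..1} \<longrightarrow> Q t" by eventually_elim (use assms in auto)
  then show ?thesis by (simp add: AE_restrict_space_iff)
qed

lemma inner_arc_borel: "\<gamma> ` {0<..<1} \<in> sets borel"
proof -
  have "\<gamma> ` {0<..<1} = path_image \<gamma> - {\<gamma> 0, \<gamma> 1}"
    using inj_arc unfolding path_image_def by (force simp: inj_on_def image_iff)
  moreover have "closed (path_image \<gamma>)" using arc by (intro compact_imp_closed compact_arc_image)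
  ultimately show ?thesis by auto
qed

lemma AE_inner_arc: "AE z in arclength \<gamma>. z \<in> \<gamma> ` {0<..<1}"
proof -
  have "AE t in unit_interval. \<gamma> t \<in> \<gamma> ` {0<..<1}"
    by (rule AE_unit_intervalI[of "{0,1}"]) (auto simp: order.order_iff_strict)
  then have "AE t in density unit_interval (\<lambda>t. ennreal (norm (path_deriv \<gamma> t))). \<gamma> t \<in> \<gamma> ` {0<..<1}"
    by (subst AE_density) auto
  then show ?thesis
    unfolding arclength_def using inner_arc_borel by (subst AE_distr_iff) auto
qed

lemma endpoint_lower_bounds:
  obtains e k where "0 < e" "e \<le> 1/2" "k > 0" "\<forall>t. 0 \<le> t \<longrightarrow> t < e \<longrightarrow> k * t \<le> cmod (\<gamma> t - \<gamma> 0)"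
    "\<forall>t. 1 - e < t \<longrightarrow> t \<le> 1 \<longrightarrow> k * (1 - t) \<le> cmod (\<gamma> t - \<gamma> 1)"
proof -
  obtain P where P: "finite P" "{0, 1} \<subseteq> P" "P \<subseteq> {0..1}"
    and sm: "\<forall>a\<in>P. \<forall>b\<in>P. a < b \<and> {a<..<b} \<inter> P = {} \<longrightarrow>
         (\<exists>\<gamma>'. continuous_on {a..b} \<gamma>' \<and> (\<forall>x\<in>{a..b}. (\<gamma> has_vector_derivative \<gamma>' x) (at x within {a..b}) \<and> \<gamma>' x \<noteq> 0))"
    using smooth_pieces .
  have ne: "finite (P - {0})" "P - {0} \<noteq> {}" "finite (P - {1})" "P - {1} \<noteq> {}" using P by auto
  define b where "b = Min (P - {0})"
  define a where "a = Max (P - {1})"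
  have b: "b \<in> P" "0 < b" "{0<..<b} \<inter> P = {}"
    using Min_in[OF ne(1,2)] Min_le[OF ne(1)] P(3) by (fastforce simp: b_def)+
  have a: "a \<in> P" "a < 1" "{a<..<1} \<inter> P = {}"
    using Max_in[OF ne(3,4)] Max_ge[OF ne(3)] P(3) by (fastforce simp: a_def)+
  obtain v where "(\<gamma> has_vector_derivative v) (at 0 within {0..b})" "v \<noteq> 0"
  proof -
    have "0 \<in> P" "b \<in> P" "0 < b \<and> {0<..<b} \<inter> P = {}" "0 \<in> {0..b}" using b P(2) by auto
    from sm[rule_format, OF this(1-3)] this(4) show ?thesis using that by blast
  qed
  then obtain e k where ek: "e > 0" "k > 0" "\<And>y. y \<in> {0..b} \<Longrightarrow> \<bar>y - 0\<bar> < e \<Longrightarrow> k * \<bar>y - 0\<bar> \<le> cmod (\<gamma> y - \<gamma> 0)"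
    using linear_lower_bound_of_derivative by blast
  obtain w where "(\<gamma> has_vector_derivative w) (at 1 within {a..1})" "w \<noteq> 0"
  proof -
    have "a \<in> P" "1 \<in> P" "a < 1 \<and> {a<..<1} \<inter> P = {}" "1 \<in> {a..1}" using a P(2) by auto
    from sm[rule_format, OF this(1-3)] this(4) show ?thesis using that by blast
  qed
  then obtain e' k' where ek': "e' > 0" "k' > 0" "\<And>y. y \<in> {a..1} \<Longrightarrow> \<bar>y - 1\<bar> < e' \<Longrightarrow> k' * \<bar>y - 1\<bar> \<le> cmod (\<gamma> y - \<gamma> 1)"
    using linear_lower_bound_of_derivative by blast
  define m where "m = min (min (min e e') (min b (1 - a))) (1/2)"
  show ?thesis
  proof (rule that[of m "min k k'"])
    show "0 < m" "min k k' > 0" using ek ek' a b by (auto simp: m_def)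
    show "m \<le> 1/2" unfolding m_def by (rule min.cobounded2)
    show "\<forall>t. 0 \<le> t \<longrightarrow> t < m \<longrightarrow> min k k' * t \<le> cmod (\<gamma> t - \<gamma> 0)"
    proof (intro allI impI)
      fix t assume t: "0 \<le> t" "t < m"
      have "min k k' * t \<le> k * t" using t by (intro mult_right_mono) auto
      also have "\<dots> \<le> cmod (\<gamma> t - \<gamma> 0)" using ek(3)[of t] t by (auto simp: m_def)
      finally show "min k k' * t \<le> cmod (\<gamma> t - \<gamma> 0)" .
    qed
    show "\<forall>t. 1 - m < t \<longrightarrow> t \<le> 1 \<longrightarrow> min k k' * (1 - t) \<le> cmod (\<gamma> t - \<gamma> 1)"
    proof (intro allI impI)
      fix t assume t: "1 - m < t" "t \<le> 1"
      have "min k k' * (1 - t) \<le> k' * (1 - t)" using t by (intro mult_right_mono) auto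
      also have "\<dots> \<le> cmod (\<gamma> t - \<gamma> 1)" using ek'(3)[of t] t by (auto simp: m_def)
      finally show "min k k' * (1 - t) \<le> cmod (\<gamma> t - \<gamma> 1)" .
    qed
  qed
qed

end

lemma integrable_powr_unit_interval:
  assumes "p < 1"
  shows "integrable unit_interval (\<lambda>t. t powr (- p))" "integrable unit_interval (\<lambda>t. (1 - t) powr (- p))"
proof -
  let ?f = "\<lambda>t::real. indicator {0..1} t *\<^sub>R (t powr (- p))"
  have "(\<lambda>t. t powr (- p)) integrable_on {0..1}" using assms by (intro integrable_on_powr_from_0) auto
  then have "set_integrable lebesgue {0..1} (\<lambda>t. t powr (- p))"
    by (intro nonnegative_absolutely_integrable_1) auto
  then have i: "integrable lborel ?f"
    unfolding set_integrable_def by (subst (asm) integrable_completion) auto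
  then show "integrable unit_interval (\<lambda>t. t powr (- p))" by (simp add: integrable_restrict_space)
  have "integrable lborel (\<lambda>t. ?f (1 + (-1) * t))" by (rule lborel_integrable_real_affine[OF i]) simp
  moreover have "?f (1 + (-1) * t) = indicator {0..1} t *\<^sub>R ((1 - t) powr (- p))" for t
    by (auto simp: indicator_def)
  ultimately have "integrable lborel (\<lambda>t. indicator {0..1} t *\<^sub>R ((1 - t) powr (- p)))" by (simp only:)
  then show "integrable unit_interval (\<lambda>t. (1 - t) powr (- p))" by (simp add: integrable_restrict_space)
qed

text \<open>Near an end point the arc moves away at least linearly, so a singularity of order \<open>\<nu>\<close> in the
  plane becomes one of order at most \<open>\<nu>\<close> in the parameter, and \<open>2 * \<nu> < 1\<close> makes its square
  integrable.\<close>

lemma (in smooth_arc) square_integrable_of_endpoint_bounds: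
  fixes F :: "complex \<Rightarrow> 'b::real_normed_vector"
  assumes S: "open S" "continuous_on S F" "\<gamma> ` {0<..<1} \<subseteq> S" and \<nu>: "0 \<le> \<nu>" "\<nu> < 1/2" and c: "c \<ge> 0"
    and bd: "\<And>\<omega>. \<omega> \<in> {\<gamma> 0, \<gamma> 1} \<Longrightarrow> \<exists>U. open U \<and> \<omega> \<in> U \<and> (\<forall>\<mu>\<in>S \<inter> U. norm (F \<mu>) \<le> c * cmod (\<mu> - \<omega>) powr (- \<nu>))"
  shows "square_integrable (arclength \<gamma>) (\<lambda>z. if z \<in> S then F z else 0)"
proof -
  define p where "p = 2 * \<nu>"
  obtain e k where ek: "0 < e" "e \<le> 1/2" "k > 0" "\<forall>t. 0 \<le> t \<longrightarrow> t < e \<longrightarrow> k * t \<le> cmod (\<gamma> t - \<gamma> 0)"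
    "\<forall>t. 1 - e < t \<longrightarrow> t \<le> 1 \<longrightarrow> k * (1 - t) \<le> cmod (\<gamma> t - \<gamma> 1)" using endpoint_lower_bounds .
  have near: "\<exists>d>0. \<forall>t\<in>{0<..<1}. \<bar>t - x\<bar> < d \<longrightarrow> norm (F (\<gamma> t)) \<le> c * cmod (\<gamma> t - \<gamma> x) powr (- \<nu>)"
    if x: "x \<in> {0, 1}" for x
  proof -
    obtain U where U: "open U" "\<gamma> x \<in> U" "\<forall>\<mu>\<in>S \<inter> U. norm (F \<mu>) \<le> c * cmod (\<mu> - \<gamma> x) powr (- \<nu>)"
      using bd[of "\<gamma> x"] x by auto
    obtain r where r: "r > 0" "ball (\<gamma> x) r \<subseteq> U" using U open_contains_ball by blast
    have "x \<in> {0..1}" using x by auto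
    then obtain d where d: "d > 0" "\<And>t. t \<in> {0..1} \<Longrightarrow> dist t x < d \<Longrightarrow> dist (\<gamma> t) (\<gamma> x) < r"
      using continuous_arc r(1) unfolding continuous_on_iff by blast
    have "norm (F (\<gamma> t)) \<le> c * cmod (\<gamma> t - \<gamma> x) powr (- \<nu>)" if "t \<in> {0<..<1}" "\<bar>t - x\<bar> < d" for t
    proof -
      have "\<gamma> t \<in> ball (\<gamma> x) r" using d(2)[of t] that by (simp add: dist_real_def dist_commute)
      then show ?thesis using U(3) r S(3) that by blast
    qed
    then show ?thesis using d by blast
  qed
  obtain d0 where d0: "d0 > 0" "\<And>t. t \<in> {0<..<1} \<Longrightarrow> \<bar>t - 0\<bar> < d0 \<Longrightarrow> norm (F (\<gamma> t)) \<le> c * cmod (\<gamma> t - \<gamma> 0) powr (- \<nu>)"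
    using near[of 0] by blast
  obtain d1 where d1: "d1 > 0" "\<And>t. t \<in> {0<..<1} \<Longrightarrow> \<bar>t - 1\<bar> < d1 \<Longrightarrow> norm (F (\<gamma> t)) \<le> c * cmod (\<gamma> t - \<gamma> 1) powr (- \<nu>)"
    using near[of 1] by blast
  define m where "m = min e (min d0 d1)"
  have m: "0 < m" "m \<le> 1/2" using ek d0 d1 by (auto simp: m_def)
  have "compact ((F \<circ> \<gamma>) ` {m..1 - m})"
  proof (intro compact_continuous_image continuous_on_compose)
    show "continuous_on {m..1 - m} \<gamma>" by (rule continuous_on_subset[OF continuous_arc]) (use m in auto)
    show "continuous_on (\<gamma> ` {m..1 - m}) F" by (rule continuous_on_subset[OF S(2)]) (use m S(3) in fastforce)
  qed auto
  then obtain N where N: "\<And>t. t \<in> {m..1 - m} \<Longrightarrow> norm (F (\<gamma> t)) \<le> N"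
    using compact_imp_bounded bounded_iff by (metis comp_apply image_eqI)
  \<comment> \<open>One constant for the ends and for the middle of the arc, where the weights are at least \<open>1\<close>.\<close>
  define R where "R = N\<^sup>2 + (c * k powr (- \<nu>))\<^sup>2"
  have R: "R \<ge> 0" by (simp add: R_def)
  have end_bd: "(norm (F (\<gamma> t)))\<^sup>2 \<le> R * s powr (- p)"
    if "norm (F (\<gamma> t)) \<le> c * q powr (- \<nu>)" "k * s \<le> q" "s > 0" for t s q
  proof -
    have "q powr (- \<nu>) \<le> (k * s) powr (- \<nu>)" using that ek \<nu> by (intro powr_mono2') auto
    then have "norm (F (\<gamma> t)) \<le> c * (k powr (- \<nu>) * s powr (- \<nu>))"
      using that ek c by (auto simp: powr_mult intro: order_trans mult_left_mono)
    then have "(norm (F (\<gamma> t)))\<^sup>2 \<le> (c * (k powr (- \<nu>) * s powr (- \<nu>)))\<^sup>2" by (intro power_mono) auto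
    also have "\<dots> = (c * k powr (- \<nu>))\<^sup>2 * s powr (- p)"
      using that by (simp add: power_mult_distrib p_def power2_eq_square powr_add[symmetric])
    also have "\<dots> \<le> R * s powr (- p)" by (intro mult_right_mono) (auto simp: R_def)
    finally show ?thesis .
  qed
  have key: "(norm (F (\<gamma> t)))\<^sup>2 \<le> R * (t powr (- p) + (1 - t) powr (- p))" if t: "t \<in> {0<..<1}" for t
  proof -
    consider "t < m" | "1 - m < t" | "t \<in> {m..1 - m}" by fastforce
    then show ?thesis
    proof cases
      case 1
      then have "(norm (F (\<gamma> t)))\<^sup>2 \<le> R * t powr (- p)"
        using d0(2)[OF t] ek(4)[rule_format, of t] t
        by (intro end_bd[of _ "cmod (\<gamma> t - \<gamma> 0)"]) (auto simp: m_def)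
      then show ?thesis unfolding distrib_left using mult_nonneg_nonneg[OF R powr_ge_zero, of "1 - t" "- p"] by linarith
    next
      case 2
      then have "(norm (F (\<gamma> t)))\<^sup>2 \<le> R * (1 - t) powr (- p)"
        using d1(2)[OF t] ek(5)[rule_format, of t] t
        by (intro end_bd[of _ "cmod (\<gamma> t - \<gamma> 1)"]) (auto simp: m_def)
      then show ?thesis unfolding distrib_left using mult_nonneg_nonneg[OF R powr_ge_zero, of t "- p"] by linarith
    next
      case 3
      have "(norm (F (\<gamma> t)))\<^sup>2 \<le> N\<^sup>2" using N[OF 3] by (intro power_mono) auto
      also have "\<dots> \<le> R * 1" by (simp add: R_def)
      also have "\<dots> \<le> R * (t powr (- p) + (1 - t) powr (- p))"
      proof (intro mult_left_mono R)
        have "1 powr (- p) \<le> t powr (- p)" using t \<nu> by (intro powr_mono2') (auto simp: p_def)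
        moreover have "0 \<le> (1 - t) powr (- p)" by (rule powr_ge_zero)
        moreover have "1 powr (- p) = 1" by simp
        ultimately show "1 \<le> t powr (- p) + (1 - t) powr (- p)" by linarith
      qed
      finally show ?thesis .
    qed
  qed
  let ?G = "\<lambda>z. if z \<in> S then F z else 0"
  have sm: "strongly_measurable (arclength \<gamma>) ?G"
    using strongly_measurable_continuous_on_open[OF S(1,2), of "\<lambda>z. z" "arclength \<gamma>"] by simp
  then have Gm: "(\<lambda>z. (norm (?G z))\<^sup>2) \<in> borel_measurable borel"
    using borel_measurable_power[OF borel_measurable_norm_strongly[OF sm]] by simp
  obtain K where K: "K \<ge> 0" "\<And>t. t \<in> {0..1} \<Longrightarrow> cmod (path_deriv \<gamma> t) \<le> K"
    using path_deriv_bounded by blast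
  have "integrable unit_interval (\<lambda>t. cmod (path_deriv \<gamma> t) *\<^sub>R (norm (?G (\<gamma> t)))\<^sup>2)"
  proof (rule Bochner_Integration.integrable_bound)
    show "integrable unit_interval (\<lambda>t. K * (R * (t powr (- p) + (1 - t) powr (- p))))"
      using integrable_powr_unit_interval[of p] \<nu> by (auto simp: p_def)
    show "(\<lambda>t. cmod (path_deriv \<gamma> t) *\<^sub>R (norm (?G (\<gamma> t)))\<^sup>2) \<in> borel_measurable unit_interval"
      using measurable_compose[OF measurable_arc Gm] by simp
    show "AE t in unit_interval. norm (cmod (path_deriv \<gamma> t) *\<^sub>R (norm (?G (\<gamma> t)))\<^sup>2)
        \<le> norm (K * (R * (t powr (- p) + (1 - t) powr (- p))))"
    proof (rule AE_unit_intervalI[of "{0, 1}"])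
      fix t :: real assume "t \<in> {0..1} - {0, 1}"
      then have t: "t \<in> {0<..<1}" "t \<in> {0..1}" by auto
      have "cmod (path_deriv \<gamma> t) * (norm (F (\<gamma> t)))\<^sup>2 \<le> K * (R * (t powr (- p) + (1 - t) powr (- p)))"
        by (intro mult_mono K t key) (use K in auto)
      moreover have "\<gamma> t \<in> S" using t S(3) by blast
      ultimately show "norm (cmod (path_deriv \<gamma> t) *\<^sub>R (norm (?G (\<gamma> t)))\<^sup>2)
        \<le> norm (K * (R * (t powr (- p) + (1 - t) powr (- p))))" by simp
    qed simp
  qed
  then have "integrable (arclength \<gamma>) (\<lambda>z. (norm (?G z))\<^sup>2)"
    using arclength_transfer(1)[OF Gm] by simp
  then show ?thesis using sm by (simp add: square_integrable_def)
qed

section \<open>The deformed operators are bounded\<close>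

lemma strongly_measurable_comp:
  assumes "T \<in> measurable M N" "strongly_measurable N f"
  shows "strongly_measurable M (\<lambda>x. f (T x))"
proof -
  obtain s where s: "\<And>n. simple_function N (s n)" "\<And>x. x \<in> space N \<Longrightarrow> (\<lambda>n. s n x) \<longlonglongrightarrow> f x"
    using assms(2) unfolding strongly_measurable_def by metis
  show ?thesis
    unfolding strongly_measurable_def
    by (intro exI[of _ "\<lambda>n x. s n (T x)"] conjI allI ballI simple_function_comp[OF assms(1) s(1)] s(2) measurable_space[OF assms(1)])
qed

text \<open>The adjoint relation alone forces both operators to be linear, and a bound for one of them to
  hold for the other.\<close>

lemma adjoint_pair_bounded_ops:
  fixes T :: "'w \<Rightarrow> 'a::complex_inner"
  assumes K: "prehilbert K" and S: "\<And>x. S x \<in> hcarrier K" and bd: "\<And>x. hnorm K (S x) \<le> k * norm x" and k: "k \<ge> 0"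
    and adj: "\<And>F x. F \<in> hcarrier K \<Longrightarrow> cinner (T F) x = hip K F (S x)"
  shows "T \<in> bounded_ops K whole" and "S \<in> bounded_ops whole K"
proof -
  interpret K: prehilbert K by fact
  have adj2: "hip K (S x) F = cinner x (T F)" if "F \<in> hcarrier K" for F x
    using adj[OF that, of x] S[of x] that by (metis K.hip_commute cinner_commute)
  show "T \<in> bounded_ops K whole"
  proof (rule bounded_opsI)
    fix F G z assume F: "F \<in> hcarrier K"
    show "T (hadd K F G) = hadd whole (T F) (T G)" if "G \<in> hcarrier K"
      by (rule cinner_eqI) (use F that S in \<open>simp add: adj cinner_add_left\<close>)
    show "T (hscale K z F) = hscale whole z (T F)"
      by (rule cinner_eqI) (use F S in \<open>simp add: adj cinner_scaleC_left\<close>)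
    have "hip K F (S (T F)) = complex_of_real ((norm (T F))\<^sup>2)"
      using adj[OF F, of "T F"] by (simp only: cinner_self)
    then have "(norm (T F))\<^sup>2 = cmod (hip K F (S (T F)))" by (simp only: norm_of_real) simp
    also have "\<dots> \<le> hnorm K F * (k * norm (T F))"
      by (rule order_trans[OF K.Cauchy_Schwarz[OF F S] mult_left_mono[OF bd]]) (use F in simp)
    finally have "norm (T F) * norm (T F) \<le> (k * hnorm K F) * norm (T F)" by (simp add: power2_eq_square mult_ac)
    then show "hnorm whole (T F) \<le> k * hnorm K F"
      using F k by (cases "T F = 0") auto
  qed simp
  show "S \<in> bounded_ops whole K"
  proof (rule bounded_opsI)
    fix x y z
    show "S (hadd whole x y) = hadd K (S x) (S y)"
      by (rule K.hip_separates) (use S in \<open>auto simp: adj2 cinner_add_left\<close>)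
    show "S (hscale whole z x) = hscale K z (S x)"
      by (rule K.hip_separates) (use S in \<open>auto simp: adj2 cinner_scaleC_left\<close>)
    show "hnorm K (S x) \<le> k * hnorm whole x" by (simp add: bd)
  qed (rule S)
qed

lemma pointwise_bound_L2:
  fixes g :: "'a::real_normed_vector \<Rightarrow> complex \<Rightarrow> 'h::complex_inner"
  assumes sm: "\<And>x. strongly_measurable (arclength \<gamma>) (g x)"
    and bd: "\<And>x z. norm (g x z) \<le> k z * norm x" and k: "integrable (arclength \<gamma>) (\<lambda>z. (k z)\<^sup>2)"
  shows "square_integrable (arclength \<gamma>) (g x)"
    and "hnorm (L2 \<gamma>) (ae_class \<gamma> (g x)) \<le> sqrt (LINT z|arclength \<gamma>. (k z)\<^sup>2) * norm x"
proof -
  have b2: "(norm (g x z))\<^sup>2 \<le> (norm x)\<^sup>2 * (k z)\<^sup>2" for z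
    using power_mono[OF bd[of x z] norm_ge_zero, of 2] by (simp add: power_mult_distrib mult.commute)
  show si: "square_integrable (arclength \<gamma>) (g x)"
    by (rule square_integrable_bound[where h = "\<lambda>z. (norm x)\<^sup>2 * (k z)\<^sup>2"]) (use sm b2 k in auto)
  let ?F = "ae_class \<gamma> (g x)"
  have F: "?F \<in> hcarrier (L2 \<gamma>)" by (rule L2_carrierI[OF si])
  have "(hnorm (L2 \<gamma>) ?F)\<^sup>2 = (LINT z|arclength \<gamma>. (norm (rep ?F z))\<^sup>2)" by (rule hnorm_L2_power2[OF F])
  also have "\<dots> \<le> (LINT z|arclength \<gamma>. (norm x)\<^sup>2 * (k z)\<^sup>2)"
  proof (rule integral_mono_AE)
    show "AE z in arclength \<gamma>. (norm (rep ?F z))\<^sup>2 \<le> (norm x)\<^sup>2 * (k z)\<^sup>2"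
      using rep_ae_class(2)[OF sm[of x]] by eventually_elim (simp add: b2)
  qed (use square_integrable_rep[OF F] k in \<open>auto simp: square_integrable_def\<close>)
  also have "\<dots> = (sqrt (LINT z|arclength \<gamma>. (k z)\<^sup>2) * norm x)\<^sup>2"
    by (simp add: power_mult_distrib mult.commute)
  finally show "hnorm (L2 \<gamma>) ?F \<le> sqrt (LINT z|arclength \<gamma>. (k z)\<^sup>2) * norm x"
    by (rule power2_le_imp_le) simp
qed

text \<open>The operator functions are arbitrary outside their domain, in particular at the end points of the
  contour; replacing these values by \<open>0\<close> makes the functions strongly measurable.\<close>

definition extend0 :: "complex set \<Rightarrow> (complex \<Rightarrow> 'b::zero) \<Rightarrow> complex \<Rightarrow> 'b" where
  "extend0 S F z = (if z \<in> S then F z else 0)"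

locale contour_operators = smooth_arc +
  fixes S :: "complex set"
  assumes open_S: "open S" and inner_S: "\<gamma> ` {0<..<1} \<subseteq> S"
begin

lemma AE_S: "AE z in arclength \<gamma>. z \<in> S"
  using AE_inner_arc by eventually_elim (use inner_S in blast)

lemma strongly_measurable_extend0:
  "continuous_on S F \<Longrightarrow> strongly_measurable (arclength \<gamma>) (extend0 S F :: complex \<Rightarrow> 'b::real_normed_vector)"
  using strongly_measurable_continuous_on_open[OF open_S, of F "\<lambda>z. z" "arclength \<gamma>"]
  by (simp add: extend0_def[abs_def])

lemma bounded_ops_C_op:
  fixes \<cc> :: "complex \<Rightarrow> 'a::complex_inner \<Rightarrow>\<^sub>L 'h::complex_inner"
  assumes lin: "\<And>z. z \<in> S \<Longrightarrow> blinfun_apply (\<cc> z) \<in> bounded_ops whole whole"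
    and si: "square_integrable (arclength \<gamma>) (extend0 S \<cc>)"
  shows "C_op \<gamma> \<cc> \<in> bounded_ops whole (L2 \<gamma>)"
proof -
  define g where "g x z = blinfun_apply (extend0 S \<cc> z) x" for x z
  interpret L2: prehilbert "L2 \<gamma> :: (complex \<Rightarrow> 'h) set hilb" by (rule prehilbert_L2)
  have sm: "strongly_measurable (arclength \<gamma>) (g x)" for x
    unfolding g_def using si
    by (intro strongly_measurable_blinfun_apply strongly_measurable_const) (auto simp: square_integrable_def)
  note pw = pointwise_bound_L2[of \<gamma> g "\<lambda>z. norm (extend0 S \<cc> z)", OF sm]
  have bd: "norm (g x z) \<le> norm (extend0 S \<cc> z) * norm x" for x z
    unfolding g_def by (rule norm_blinfun)
  have k: "integrable (arclength \<gamma>) (\<lambda>z. (norm (extend0 S \<cc> z))\<^sup>2)" using si by (simp add: square_integrable_def)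
  have Cg: "C_op \<gamma> \<cc> x = ae_class \<gamma> (g x)" for x
    unfolding C_op_def by (rule ae_class_cong) (use AE_S in \<open>eventually_elim, simp add: g_def extend0_def\<close>)
  have car: "C_op \<gamma> \<cc> x \<in> hcarrier (L2 \<gamma>)" for x
    unfolding Cg by (rule L2_carrierI[OF pw(1)[OF bd k]])
  have rp: "AE z in arclength \<gamma>. rep (C_op \<gamma> \<cc> x) z = blinfun_apply (\<cc> z) x" for x
    using rep_ae_class(2)[OF sm[of x]] AE_S unfolding Cg by eventually_elim (simp add: g_def extend0_def)
  show ?thesis
  proof (rule bounded_opsI)
    fix x y :: 'a and w
    show "C_op \<gamma> \<cc> (hadd whole x y) = hadd (L2 \<gamma>) (C_op \<gamma> \<cc> x) (C_op \<gamma> \<cc> y)"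
    proof (rule L2_eqI)
      show "AE z in arclength \<gamma>. rep (C_op \<gamma> \<cc> (hadd whole x y)) z = rep (hadd (L2 \<gamma>) (C_op \<gamma> \<cc> x) (C_op \<gamma> \<cc> y)) z"
        using rp[of "x + y"] rp[of x] rp[of y] L2_add(2)[OF car[of x] car[of y]]
        by eventually_elim (simp add: blinfun.add_right)
    qed (use car in auto)
    show "C_op \<gamma> \<cc> (hscale whole w x) = hscale (L2 \<gamma>) w (C_op \<gamma> \<cc> x)"
    proof (rule L2_eqI)
      show "AE z in arclength \<gamma>. rep (C_op \<gamma> \<cc> (hscale whole w x)) z = rep (hscale (L2 \<gamma>) w (C_op \<gamma> \<cc> x)) z"
        using rp[of "w *\<^sub>C x"] rp[of x] L2_scale(2)[OF car[of x], of w] AE_S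
        by eventually_elim (use bounded_ops_scale[OF lin] in simp)
    qed (use car in auto)
    show "hnorm (L2 \<gamma>) (C_op \<gamma> \<cc> x) \<le> sqrt (LINT z|arclength \<gamma>. (norm (extend0 S \<cc> z))\<^sup>2) * hnorm whole x"
      unfolding Cg using pw(2)[OF bd k] by simp
  qed (rule car)
qed

text \<open>The function \<open>d\<lambda> / |d\<lambda>|\<close> on the contour; the continuous inverse of the arc makes it measurable.\<close>

lemma unit_tangent:
  obtains \<tau> where "\<tau> \<in> borel_measurable borel" "\<forall>z. cmod (\<tau> z) \<le> 1"
    "\<forall>t\<in>{0..1}. cmod (path_deriv \<gamma> t) *\<^sub>R \<tau> (\<gamma> t) = path_deriv \<gamma> t"
proof -
  obtain g where g: "homeomorphism {0..1} (path_image \<gamma>) \<gamma> g" using homeomorphism_arc[OF arc] .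
  define g' where "g' z = indicator (path_image \<gamma>) z *\<^sub>R g z" for z
  have "closed (path_image \<gamma>)" using arc by (intro compact_imp_closed compact_arc_image)
  then have gm [measurable]: "g' \<in> borel_measurable borel"
    unfolding g'_def[abs_def]
    by (intro borel_measurable_continuous_on_indicator) (use g in \<open>auto simp: homeomorphism_def\<close>)
  define dz where "dz t = indicator {0..1} t *\<^sub>R path_deriv \<gamma> t" for t
  have dm [measurable]: "dz \<in> borel_measurable borel"
    unfolding dz_def[abs_def] by (rule borel_measurable_path_deriv)
  define \<tau> where "\<tau> z = dz (g' z) / complex_of_real (cmod (dz (g' z)))" for z
  show ?thesis
  proof (rule that[of \<tau>])
    show "\<tau> \<in> borel_measurable borel" unfolding \<tau>_def[abs_def] by measurable
    show "\<forall>z. cmod (\<tau> z) \<le> 1" by (simp add: \<tau>_def norm_divide)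
    show "\<forall>t\<in>{0..1}. cmod (path_deriv \<gamma> t) *\<^sub>R \<tau> (\<gamma> t) = path_deriv \<gamma> t"
    proof
      fix t :: real assume t: "t \<in> {0..1}"
      have "g' (\<gamma> t) = t" using g t by (auto simp: g'_def homeomorphism_def path_image_def)
      then show "cmod (path_deriv \<gamma> t) *\<^sub>R \<tau> (\<gamma> t) = path_deriv \<gamma> t"
        using t by (simp add: \<tau>_def dz_def scaleR_conv_of_real)
    qed
  qed
qed

text \<open>The operator integrates against the complex line element, the inner product against arc length.
  Hence the adjoint multiplies with the conjugate of the unit tangent and the pointwise adjoints
  of \<open>\<bb>\<close>, and the adjoint relation is an identity between scalar integrals once the
  integral that defines the operator is known to exist.\<close>

lemma bounded_ops_B_op:
  fixes \<bb> :: "complex \<Rightarrow> 'h::chilbert_space \<Rightarrow>\<^sub>L 'a::chilbert_space"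
  assumes lin: "\<And>z. z \<in> S \<Longrightarrow> blinfun_apply (\<bb> z) \<in> bounded_ops whole whole"
    and cont: "continuous_on S \<bb>"
    and si: "square_integrable (arclength \<gamma>) (extend0 S \<bb>)"
  obtains B' where "B_op \<gamma> \<bb> \<in> bounded_ops (L2 \<gamma>) whole" "B' \<in> bounded_ops whole (L2 \<gamma>)"
    "\<forall>F\<in>hcarrier (L2 \<gamma>). \<forall>x. cinner (B_op \<gamma> \<bb> F) x = hip (L2 \<gamma>) F (B' x)"
proof -
  define b where "b = extend0 S \<bb>"
  have smb: "strongly_measurable (arclength \<gamma>) b" using si by (simp add: square_integrable_def b_def)
  have "\<exists>T'. \<forall>x y. cinner (blinfun_apply (\<bb> z) x) y = cinner x (T' y)" if z: "z \<in> S" for z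
    using adjoint_exists[OF prehilbert_whole lin[OF z]] by (metis UNIV_I whole_simps(1,5))
  then obtain adj where adj: "\<And>z x y. z \<in> S \<Longrightarrow> cinner (blinfun_apply (\<bb> z) x) y = cinner x (adj z y)" by metis
  have adj_lip: "norm (adj z x - adj w x) \<le> norm (\<bb> z - \<bb> w) * norm x" if "z \<in> S" "w \<in> S" for z w x
  proof -
    define v where "v = adj z x - adj w x"
    have "(norm v)\<^sup>2 = cmod (cinner v (adj z x - adj w x))"
      by (simp add: v_def[symmetric] cinner_self norm_power flip: of_real_power)
    also have "\<dots> = cmod (cinner (blinfun_apply (\<bb> z - \<bb> w) v) x)"
      using adj[OF that(1), of v x] adj[OF that(2), of v x]
      by (simp add: cinner_diff_right cinner_diff_left blinfun.diff_left)
    also have "\<dots> \<le> (norm (\<bb> z - \<bb> w) * norm v) * norm x"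
      by (rule order_trans[OF norm_cinner]) (intro mult_right_mono norm_blinfun, simp)
    finally have "norm v * norm v \<le> (norm (\<bb> z - \<bb> w) * norm x) * norm v" by (simp add: power2_eq_square mult_ac)
    then show ?thesis unfolding v_def[symmetric] by (cases "v = 0") auto
  qed
  have adj_norm: "norm (adj z x) \<le> norm (\<bb> z) * norm x" if "z \<in> S" for z x
  proof -
    have "(norm (adj z x))\<^sup>2 = cmod (cinner (blinfun_apply (\<bb> z) (adj z x)) x)"
      by (simp add: adj[OF that] cinner_self norm_power flip: of_real_power)
    also have "\<dots> \<le> (norm (\<bb> z) * norm (adj z x)) * norm x"
      by (rule order_trans[OF norm_cinner]) (intro mult_right_mono norm_blinfun, simp)
    finally have "norm (adj z x) * norm (adj z x) \<le> (norm (\<bb> z) * norm x) * norm (adj z x)"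
      by (simp add: power2_eq_square mult_ac)
    then show ?thesis by (cases "adj z x = 0") auto
  qed
  have adj_cont: "continuous_on S (\<lambda>z. adj z x)" for x
    unfolding continuous_on_def
  proof
    fix z assume z: "z \<in> S"
    have "(\<bb> \<longlongrightarrow> \<bb> z) (at z within S)" using cont z by (simp add: continuous_on_def)
    then have "((\<lambda>w. norm (\<bb> w - \<bb> z) * norm x) \<longlongrightarrow> norm (\<bb> z - \<bb> z) * norm x) (at z within S)"
      by (intro tendsto_intros)
    then have "((\<lambda>w. norm (\<bb> w - \<bb> z) * norm x) \<longlongrightarrow> 0) (at z within S)" by simp
    moreover have "\<forall>\<^sub>F w in at z within S. norm (adj w x - adj z x) \<le> norm (\<bb> w - \<bb> z) * norm x"
      unfolding eventually_at_filter by (rule always_eventually) (use adj_lip z in blast)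
    ultimately have "((\<lambda>w. adj w x - adj z x) \<longlongrightarrow> 0) (at z within S)"
      by (rule Lim_null_comparison[rotated])
    then show "((\<lambda>w. adj w x) \<longlongrightarrow> adj z x) (at z within S)" by (simp add: LIM_zero_iff)
  qed
  obtain \<tau> where \<tau>: "\<tau> \<in> borel_measurable borel" "\<forall>z. cmod (\<tau> z) \<le> 1"
    "\<forall>t\<in>{0..1}. cmod (path_deriv \<gamma> t) *\<^sub>R \<tau> (\<gamma> t) = path_deriv \<gamma> t" using unit_tangent .
  define G where "G x z = cnj (\<tau> z) *\<^sub>C extend0 S (\<lambda>z. adj z x) z" for x z
  define B' where "B' x = ae_class \<gamma> (G x)" for x
  have "(\<lambda>z. cnj (\<tau> z)) \<in> borel_measurable borel"
    by (rule measurable_compose[OF \<tau>(1)]) (intro borel_measurable_continuous_onI continuous_intros)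
  then have \<tau>': "(\<lambda>z. cnj (\<tau> z)) \<in> borel_measurable (arclength \<gamma>)"
    by (simp cong: measurable_cong_sets)
  have smG: "strongly_measurable (arclength \<gamma>) (G x)" for x
    unfolding G_def
    by (intro strongly_measurable_scaleC strongly_measurable_extend0 adj_cont \<tau>')
  have bdG: "norm (G x z) \<le> norm (b z) * norm x" for x z
  proof (cases "z \<in> S")
    case True
    have "cmod (\<tau> z) * norm (adj z x) \<le> 1 * (norm (\<bb> z) * norm x)"
      using \<tau>(2) adj_norm[OF True, of x] by (intro mult_mono) auto
    then show ?thesis using True by (simp add: G_def b_def extend0_def)
  qed (simp add: G_def extend0_def)
  have kb: "integrable (arclength \<gamma>) (\<lambda>z. (norm (b z))\<^sup>2)" using si by (simp add: square_integrable_def b_def)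
  note pw = pointwise_bound_L2[of \<gamma> G "\<lambda>z. norm (b z)", OF smG bdG kb]
  have car: "B' x \<in> hcarrier (L2 \<gamma>)" for x unfolding B'_def by (rule L2_carrierI[OF pw(1)])
  have main: "cinner (B_op \<gamma> \<bb> F) x = hip (L2 \<gamma>) F (B' x)" if F: "F \<in> hcarrier (L2 \<gamma>)" for F x
  proof -
    note siF = square_integrable_rep[OF F] and smF = strongly_measurable_rep[OF F]
    define h where "h t = path_deriv \<gamma> t *\<^sub>C blinfun_apply (b (\<gamma> t)) (rep F (\<gamma> t))" for t
    have g: "\<gamma> \<in> measurable unit_interval (arclength \<gamma>)" using measurable_arc by (simp cong: measurable_cong_sets)
    have smh: "strongly_measurable unit_interval h"
      unfolding h_def
      by (intro strongly_measurable_scaleC strongly_measurable_blinfun_apply measurable_path_deriv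
          strongly_measurable_comp[OF g smb] strongly_measurable_comp[OF g smF])
    define k where "k z = (norm (b z))\<^sup>2 + (norm (rep F z))\<^sup>2" for z
    have ik: "integrable (arclength \<gamma>) k" using kb siF by (auto simp: k_def[abs_def] square_integrable_def)
    then have km: "k \<in> borel_measurable borel" using borel_measurable_integrable by fastforce
    have ik': "integrable unit_interval (\<lambda>t. cmod (path_deriv \<gamma> t) *\<^sub>R k (\<gamma> t))"
      using ik arclength_transfer(1)[OF km] by simp
    have hk: "norm (h t) \<le> cmod (path_deriv \<gamma> t) *\<^sub>R k (\<gamma> t)" for t
    proof -
      have "norm (blinfun_apply (b (\<gamma> t)) (rep F (\<gamma> t))) \<le> norm (b (\<gamma> t)) * norm (rep F (\<gamma> t))" by (rule norm_blinfun)
      also have "\<dots> \<le> k (\<gamma> t)"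
        unfolding k_def
        using sum_squares_bound[of "norm (b (\<gamma> t))" "norm (rep F (\<gamma> t))"]
          mult_nonneg_nonneg[OF norm_ge_zero norm_ge_zero, of "b (\<gamma> t)" "rep F (\<gamma> t)"] by linarith
      finally show ?thesis by (simp add: h_def mult_left_mono)
    qed
    have inh: "integrable unit_interval (\<lambda>t. norm (h t))"
      by (rule Bochner_Integration.integrable_bound[OF ik' borel_measurable_norm_strongly[OF smh]])
        (intro AE_I2, use order_trans[OF hk abs_ge_self] in simp)
    have hi: "h integrable_on {0..1}" by (rule strongly_measurable_integrable_on[OF smh inh])
    have "B_op \<gamma> \<bb> F = integral {0..1} h"
      unfolding B_op_def
    proof (rule integral_spike[of "{0, 1}"])
      fix t :: real assume "t \<in> {0..1} - {0, 1}"
      then have "t \<in> {0<..<1}" by auto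
      then have "\<gamma> t \<in> S" using inner_S by blast
      then show "h t = path_deriv \<gamma> t *\<^sub>C blinfun_apply (\<bb> (\<gamma> t)) (rep F (\<gamma> t))"
        by (simp add: h_def b_def extend0_def)
    qed simp
    then have "cinner (B_op \<gamma> \<bb> F) x = integral {0..1} (\<lambda>t. cinner (h t) x)"
      using integral_linear[OF hi bounded_bilinear.bounded_linear_left[OF bounded_bilinear_cinner, of x]]
      by (simp add: o_def)
    also have "\<dots> = (LINT t|unit_interval. cinner (h t) x)"
    proof (rule integral_unique, rule integrable_unit_interval_HK, rule Bochner_Integration.integrable_bound)
      show "integrable unit_interval (\<lambda>t. norm (h t) * norm x)" using inh by simp
      show "(\<lambda>t. cinner (h t) x) \<in> borel_measurable unit_interval"
        by (rule borel_measurable_cinner[OF smh strongly_measurable_const])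
    qed (simp add: norm_cinner)
    also have "\<dots> = (LINT t|unit_interval. cmod (path_deriv \<gamma> t) *\<^sub>R cinner (rep F (\<gamma> t)) (G x (\<gamma> t)))"
    proof (rule Bochner_Integration.integral_cong[OF refl])
      fix t assume "t \<in> space unit_interval"
      then have t: "t \<in> {0..1}" by (simp add: space_restrict_space)
      have e: "cinner (blinfun_apply (b z) y) x = cinner y (extend0 S (\<lambda>z. adj z x) z)" for y z
        by (simp add: b_def extend0_def adj)
      have "cinner (h t) x = (cmod (path_deriv \<gamma> t) *\<^sub>R \<tau> (\<gamma> t)) * cinner (rep F (\<gamma> t)) (extend0 S (\<lambda>z. adj z x) (\<gamma> t))"
        using \<tau>(3) t by (simp add: h_def cinner_scaleC_left e)
      then show "cinner (h t) x = cmod (path_deriv \<gamma> t) *\<^sub>R cinner (rep F (\<gamma> t)) (G x (\<gamma> t))"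
        by (simp add: G_def cinner_scaleC_right)
    qed
    also have "\<dots> = (LINT z|arclength \<gamma>. cinner (rep F z) (G x z))"
      using borel_measurable_cinner[OF smF smG[of x]] by (intro arclength_transfer(2)[symmetric]) simp
    also have "\<dots> = hip (L2 \<gamma>) F (B' x)"
      unfolding B'_def
      by (rule hip_L2_cong[OF F car[unfolded B'_def] smF smG _ rep_ae_class(2)[OF smG], symmetric]) simp
    finally show ?thesis .
  qed
  have "hnorm (L2 \<gamma>) (B' x) \<le> sqrt (LINT z|arclength \<gamma>. (norm (b z))\<^sup>2) * norm x" for x
    unfolding B'_def by (rule pw(2))
  note ap = adjoint_pair_bounded_ops[OF prehilbert_L2 car this _ main]
  show ?thesis
  proof (rule that[of B'])
    show "B_op \<gamma> \<bb> \<in> bounded_ops (L2 \<gamma>) whole" "B' \<in> bounded_ops whole (L2 \<gamma>)" using ap by simp_all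
    show "\<forall>F\<in>hcarrier (L2 \<gamma>). \<forall>x. cinner (B_op \<gamma> \<bb> F) x = hip (L2 \<gamma>) F (B' x)" using main by blast
  qed
qed

end

section \<open>The norm with respect to the spectral measure\<close>

context smooth_arc
begin

lemma path_image_borel: "path_image \<gamma> \<in> sets borel"
  using arc by (intro borel_closed compact_imp_closed compact_arc_image)

lemma AE_path_image: "AE z in arclength \<gamma>. z \<in> path_image \<gamma>"
  using AE_inner_arc by eventually_elim (auto simp: path_image_def)

text \<open>Finitely many small balls cover the compact contour; subtracting from each one its predecessors
  makes the pieces disjoint.\<close>

lemma fine_borel_system:
  assumes \<epsilon>: "\<epsilon> > 0"
  obtains n \<delta> l where "\<delta> \<in> borel_systems \<gamma>" "\<forall>j\<ge>n. \<delta> j = {}" "(\<Union>j<n. \<delta> j) = path_image \<gamma>"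
    "\<forall>j<n. l j \<in> path_image \<gamma> \<and> (\<forall>z\<in>\<delta> j. cmod (z - l j) \<le> \<epsilon>)"
proof -
  have "compact (path_image \<gamma>)" using arc by (rule compact_arc_image)
  then obtain C where C: "C \<subseteq> path_image \<gamma>" "finite C" "path_image \<gamma> \<subseteq> (\<Union>x\<in>C. ball x \<epsilon>)"
    by (rule compactE_image[of _ "path_image \<gamma>" "\<lambda>x. ball x \<epsilon>"]) (use \<epsilon> in auto)
  define n where "n = card C"
  obtain l where l: "bij_betw l {0..<n} C" using ex_bij_betw_nat_finite[OF C(2)] unfolding n_def by blast
  define A where "A j = (if j < n then path_image \<gamma> \<inter> ball (l j) \<epsilon> else {})" for j
  define \<delta> where "\<delta> = disjointed A"
  have sub: "\<delta> j \<subseteq> A j" for j unfolding \<delta>_def by (rule disjointed_subset)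
  have A: "A j \<in> sets borel" for j using path_image_borel by (auto simp: A_def)
  have "(\<Union>j. \<delta> j) = (\<Union>j. A j)" unfolding \<delta>_def by (rule UN_disjointed_eq)
  also have "\<dots> = path_image \<gamma>"
  proof
    show "path_image \<gamma> \<subseteq> (\<Union>j. A j)"
    proof
      fix z assume z: "z \<in> path_image \<gamma>"
      then obtain x where x: "x \<in> C" "z \<in> ball x \<epsilon>" using C(3) by blast
      then obtain j where "j < n" "l j = x" using l by (auto simp: bij_betw_def)
      then show "z \<in> (\<Union>j. A j)" using z x by (auto simp: A_def)
    qed
  qed (auto simp: A_def)
  finally have U: "(\<Union>j. \<delta> j) = path_image \<gamma>" .
  have emp: "\<delta> j = {}" if "j \<ge> n" for j using sub[of j] that by (auto simp: A_def)
  show ?thesis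
  proof (rule that[of \<delta> n l])
    show "\<delta> \<in> borel_systems \<gamma>"
      unfolding borel_systems_def
    proof (intro CollectI conjI allI)
      show "\<delta> j \<in> sets borel" for j unfolding \<delta>_def disjointed_def using A by auto
      show "\<delta> j \<subseteq> path_image \<gamma>" for j using U by auto
      show "disjoint_family \<delta>" unfolding \<delta>_def by (rule disjoint_family_disjointed)
    qed
    show "\<forall>j\<ge>n. \<delta> j = {}" using emp by blast
    have "x \<in> (\<Union>j<n. \<delta> j)" if "x \<in> \<delta> j" for x j using that emp[of j] by (cases "j < n") auto
    then show "(\<Union>j<n. \<delta> j) = path_image \<gamma>" unfolding U[symmetric] by blast
    show "\<forall>j<n. l j \<in> path_image \<gamma> \<and> (\<forall>z\<in>\<delta> j. cmod (z - l j) \<le> \<epsilon>)"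
    proof (intro allI impI conjI ballI)
      fix j assume j: "j < n"
      then show "l j \<in> path_image \<gamma>" using l C(1) by (auto simp: bij_betw_def)
      fix z assume "z \<in> \<delta> j"
      then have "z \<in> ball (l j) \<epsilon>" using sub[of j] j by (auto simp: A_def)
      then show "cmod (z - l j) \<le> \<epsilon>" by (simp add: dist_norm norm_minus_commute)
    qed
  qed
qed

lemma borel_indicator:
  "\<delta> \<in> sets borel \<Longrightarrow> (\<lambda>z. complex_of_real (indicator \<delta> z)) \<in> borel_measurable (arclength \<gamma>)"
  by (rule measurable_compose[of "indicator \<delta>" _ borel complex_of_real])
    (auto intro!: borel_measurable_continuous_onI continuous_intros borel_measurable_indicator)

lemma L2_spectral_measure:
  assumes "\<delta> \<in> sets borel" "F \<in> hcarrier (L2 \<gamma>)"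
  shows "spectral_measure \<gamma> \<delta> F \<in> hcarrier (L2 \<gamma>)"
    and "AE z in arclength \<gamma>. rep (spectral_measure \<gamma> \<delta> F) z = complex_of_real (indicator \<delta> z) *\<^sub>C rep F z"
  unfolding spectral_measure_eq_mult
  by (rule L2_mult[OF assms(2) borel_indicator[OF assms(1)], of 1]; simp add: indicator_def)+

lemma spectral_partition_L2:
  fixes \<delta> :: "nat \<Rightarrow> complex set"
  assumes \<delta>: "\<delta> \<in> borel_systems \<gamma>" and U: "(\<Union>j<n. \<delta> j) = path_image \<gamma>" and \<epsilon>: "\<epsilon> > 0"
    and near: "\<forall>j<n. l j \<in> path_image \<gamma> \<and> (\<forall>z\<in>\<delta> j. cmod (z - l j) \<le> \<epsilon>)"
  shows "spectral_partition (L2 \<gamma> :: (complex \<Rightarrow> 'h::complex_inner) set hilb) (D_op \<gamma>) \<epsilon> n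
     (\<lambda>j. spectral_measure \<gamma> (\<delta> j)) l"
proof -
  have sets: "\<delta> j \<in> sets borel" for j using \<delta> by (simp add: borel_systems_def)
  obtain R where R: "R > 0" "\<And>z. z \<in> path_image \<gamma> \<Longrightarrow> cmod z \<le> R"
    using compact_imp_bounded[OF compact_arc_image[OF arc]] by (auto simp: bounded_pos)
  have idm: "(\<lambda>z. z) \<in> borel_measurable (arclength \<gamma>)" by simp
  have idb: "AE z in arclength \<gamma>. cmod z \<le> R" using AE_path_image by eventually_elim (rule R)
  note ind = borel_indicator[OF sets]
  have indb: "AE z in arclength \<gamma>. cmod (complex_of_real (indicator (\<delta> j) z)) \<le> 1" for j by (simp add: indicator_def)
  note car = L2_spectral_measure(1)[OF sets] and rp = L2_spectral_measure(2)[OF sets]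
  note Dcar = L2_mult(1)[OF _ idm idb, folded D_op_eq_mult] and Drp = L2_mult(2)[OF _ idm idb, folded D_op_eq_mult]
  interpret prehilbert "L2 \<gamma> :: (complex \<Rightarrow> 'h) set hilb" by (rule prehilbert_L2)
  show ?thesis
  proof (unfold_locales)
    show "D_op \<gamma> \<in> bounded_ops (L2 \<gamma>) (L2 \<gamma> :: (complex \<Rightarrow> 'h) set hilb)"
      unfolding D_op_eq_mult by (rule bounded_ops_mult[OF idm idb]) (use R in simp)
    show "0 \<le> \<epsilon>" using \<epsilon> by simp
    fix j and F G :: "(complex \<Rightarrow> 'h) set"
    show "spectral_measure \<gamma> (\<delta> j) \<in> bounded_ops (L2 \<gamma>) (L2 \<gamma> :: (complex \<Rightarrow> 'h) set hilb)"
      unfolding spectral_measure_eq_mult by (rule bounded_ops_mult[OF ind indb]) simp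
    assume F: "F \<in> hcarrier (L2 \<gamma>)"
    show "spectral_measure \<gamma> (\<delta> j) (spectral_measure \<gamma> (\<delta> j) F) = spectral_measure \<gamma> (\<delta> j) F"
    proof (rule L2_eqI)
      show "AE z in arclength \<gamma>. rep (spectral_measure \<gamma> (\<delta> j) (spectral_measure \<gamma> (\<delta> j) F)) z = rep (spectral_measure \<gamma> (\<delta> j) F) z"
        using rp[OF F, of j] rp[OF car[OF F], of j j] by eventually_elim (simp add: indicator_def)
    qed (use F car in auto)
    show "spectral_measure \<gamma> (\<delta> j) (D_op \<gamma> F) = D_op \<gamma> (spectral_measure \<gamma> (\<delta> j) F)"
    proof (rule L2_eqI)
      show "AE z in arclength \<gamma>. rep (spectral_measure \<gamma> (\<delta> j) (D_op \<gamma> F)) z = rep (D_op \<gamma> (spectral_measure \<gamma> (\<delta> j) F)) z"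
        using rp[OF F, of j] rp[OF Dcar[OF F], of j] Drp[OF F] Drp[OF car[OF F], of j]
        by eventually_elim (simp add: scaleC_scaleC mult.commute)
    qed (use F car Dcar in auto)
    { assume j: "j < n"
      let ?E = "spectral_measure \<gamma> (\<delta> j) F"
      show "hnorm (L2 \<gamma>) (hadd (L2 \<gamma>) (D_op \<gamma> ?E) (hscale (L2 \<gamma>) (- l j) ?E)) \<le> \<epsilon> * hnorm (L2 \<gamma>) ?E"
      proof (rule hnorm_L2_le)
        note E = car[OF F, of j]
        note S = L2_scale[OF E, of "- l j"]
        show "AE z in arclength \<gamma>. norm (rep (hadd (L2 \<gamma>) (D_op \<gamma> ?E) (hscale (L2 \<gamma>) (- l j) ?E)) z) \<le> \<epsilon> * norm (rep ?E z)"
          using L2_add(2)[OF Dcar[OF E] S(1)] Drp[OF E] S(2) rp[OF F, of j]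
        proof eventually_elim
          case (elim z)
          then have "rep (hadd (L2 \<gamma>) (D_op \<gamma> ?E) (hscale (L2 \<gamma>) (- l j) ?E)) z = (z - l j) *\<^sub>C rep ?E z"
            by (simp add: scaleC_diff_left scaleC_minus_left)
          moreover have "cmod (z - l j) \<le> \<epsilon> \<or> rep ?E z = 0"
            using near j elim(4) by (auto simp: indicator_def)
          ultimately show ?case by (auto intro: mult_right_mono)
        qed
        show "hadd (L2 \<gamma>) (D_op \<gamma> ?E) (hscale (L2 \<gamma>) (- l j) ?E) \<in> hcarrier (L2 \<gamma>)"
          by (rule L2_add(1)[OF Dcar[OF E] S(1)])
      qed (use F car \<epsilon> in auto)
    }
    assume G: "G \<in> hcarrier (L2 \<gamma>)"
    show "hip (L2 \<gamma>) (spectral_measure \<gamma> (\<delta> j) F) G = hip (L2 \<gamma>) F (spectral_measure \<gamma> (\<delta> j) G)"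
      unfolding spectral_measure_eq_mult
      by (simp add: hip_mult_op_left[OF F G ind indb] hip_mult_op_right[OF F G ind indb])
    have i: "integrable (arclength \<gamma>) (\<lambda>z. complex_of_real (indicator (\<delta> j) z) * cinner (rep F z) (rep G z))" for j
    proof (rule Bochner_Integration.integrable_bound[OF integrable_cinner[OF square_integrable_rep[OF F] square_integrable_rep[OF G]]])
      show "(\<lambda>z. complex_of_real (indicator (\<delta> j) z) * cinner (rep F z) (rep G z)) \<in> borel_measurable (arclength \<gamma>)"
        by (intro borel_measurable_times ind borel_measurable_cinner strongly_measurable_rep F G)
    qed (simp add: indicator_def norm_mult)
    have "(\<Sum>j<n. hip (L2 \<gamma>) (spectral_measure \<gamma> (\<delta> j) F) G)
        = (\<Sum>j<n. LINT z|arclength \<gamma>. complex_of_real (indicator (\<delta> j) z) * cinner (rep F z) (rep G z))"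
      unfolding spectral_measure_eq_mult by (simp add: hip_mult_op_left[OF F G ind indb])
    also have "\<dots> = (LINT z|arclength \<gamma>. (\<Sum>j<n. complex_of_real (indicator (\<delta> j) z) * cinner (rep F z) (rep G z)))"
      by (rule Bochner_Integration.integral_sum[symmetric]) (rule i)
    also have "\<dots> = (LINT z|arclength \<gamma>. cinner (rep F z) (rep G z))"
    proof (rule integral_cong_AE)
      show "AE z in arclength \<gamma>. (\<Sum>j<n. complex_of_real (indicator (\<delta> j) z) * cinner (rep F z) (rep G z)) = cinner (rep F z) (rep G z)"
        using AE_path_image
      proof eventually_elim
        case (elim z)
        then obtain k where k: "k < n" "z \<in> \<delta> k" using U by blast
        have "indicator (\<delta> j) z = (if j = k then 1 else (0::real))" for j
        proof -
          have "\<delta> j \<inter> \<delta> k = {}" if "j \<noteq> k"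
            using \<delta> that by (simp add: borel_systems_def disjoint_family_on_def)
          then show ?thesis using k by (auto simp: indicator_def)
        qed
        then show ?case using k by (simp add: if_distrib[of complex_of_real] if_distrib[of "\<lambda>x. x * _"] cong: if_cong)
      qed
      show "(\<lambda>z. \<Sum>j<n. complex_of_real (indicator (\<delta> j) z) * cinner (rep F z) (rep G z)) \<in> borel_measurable (arclength \<gamma>)"
        using i by (intro borel_measurable_sum) auto
      show "(\<lambda>z. cinner (rep F z) (rep G z)) \<in> borel_measurable (arclength \<gamma>)"
        by (intro borel_measurable_cinner strongly_measurable_rep F G)
    qed
    finally show "(\<Sum>j<n. hip (L2 \<gamma>) (spectral_measure \<gamma> (\<delta> j) F) G) = hip (L2 \<gamma>) F G" by (simp add: hip_L2)
  qed
qed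

text \<open>By idempotence \<open>\<parallel>E j T f\<parallel>\<^sup>2 = \<langle>f, T\<^sup>* E j T f\<rangle>\<close>, so the norms of the operators \<open>T\<^sup>* E j T\<close> are admissible
  squares \<open>(a j)\<^sup>2\<close>.  A positive value of \<open>enn2real\<close> excludes an infinite norm.\<close>

lemma E_norm_pieces:
  fixes T :: "'a::chilbert_space \<Rightarrow> (complex \<Rightarrow> 'h::complex_inner) set"
  assumes T: "T \<in> bounded_ops whole (L2 \<gamma>)" and c: "enn2real (E_norm \<gamma> T) > 0"
    and \<delta>: "\<delta> \<in> borel_systems \<gamma>"
  obtains a where "\<forall>j. 0 \<le> a j \<and> (\<forall>f. hnorm (L2 \<gamma>) (spectral_measure \<gamma> (\<delta> j) (T f)) \<le> a j * norm f)"
    "(\<Sum>j<n. (a j)\<^sup>2) \<le> (enn2real (E_norm \<gamma> T))\<^sup>2"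
proof -
  interpret L: prehilbert "L2 \<gamma> :: (complex \<Rightarrow> 'h) set hilb" by (rule prehilbert_L2)
  note HA = prehilbert_whole[where 'a = 'a]
  define T' where "T' = adjoint_op whole (L2 \<gamma>) T"
  have T': "T' \<in> bounded_ops (L2 \<gamma>) whole"
    and adj: "\<And>x y. y \<in> hcarrier (L2 \<gamma>) \<Longrightarrow> hip (L2 \<gamma>) (T x) y = cinner x (T' y)"
  proof -
    obtain S where S: "S \<in> bounded_ops (L2 \<gamma>) whole"
      "\<And>x y. y \<in> hcarrier (L2 \<gamma>) \<Longrightarrow> hip (L2 \<gamma>) (T x) y = cinner x (S y)"
      using adjoint_exists[OF prehilbert_L2 T] by blast
    note ao = adjoint_op[of S "L2 \<gamma>" whole T, simplified, OF S]
    show "T' \<in> bounded_ops (L2 \<gamma>) whole" unfolding T'_def by (rule ao(1))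
    show "\<And>x y. y \<in> hcarrier (L2 \<gamma>) \<Longrightarrow> hip (L2 \<gamma>) (T x) y = cinner x (T' y)"
      unfolding T'_def by (rule ao(2))
  qed
  define q where "q \<delta> = opnorm whole whole (T' \<circ> spectral_measure \<gamma> \<delta> \<circ> T)" for \<delta>
  have sets: "\<delta> j \<in> sets borel" for j using \<delta> by (simp add: borel_systems_def)
  have Tc: "T f \<in> hcarrier (L2 \<gamma>)" for f using bounded_ops_closed[OF T] by simp
  note ind = borel_indicator[OF sets]
  have indb: "AE z in arclength \<gamma>. cmod (complex_of_real (indicator (\<delta> j) z)) \<le> 1" for j by (simp add: indicator_def)
  have Eb: "spectral_measure \<gamma> (\<delta> j) \<in> bounded_ops (L2 \<gamma>) (L2 \<gamma> :: (complex \<Rightarrow> 'h) set hilb)" for j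
    unfolding spectral_measure_eq_mult by (rule bounded_ops_mult[OF ind indb]) simp
  have Tb: "T' \<circ> spectral_measure \<gamma> (\<delta> j) \<circ> T \<in> bounded_ops whole whole" for j
    by (rule bounded_ops_comp[OF HA prehilbert_L2 HA bounded_ops_comp[OF prehilbert_L2 prehilbert_L2 HA T' Eb] T])
  have q0: "0 \<le> q (\<delta> j)" for j unfolding q_def by (rule opnorm_nonneg[OF HA HA Tb])
  have piece: "hnorm (L2 \<gamma>) (spectral_measure \<gamma> (\<delta> j) (T f)) \<le> sqrt (q (\<delta> j)) * norm f" for j f
  proof -
    let ?E = "spectral_measure \<gamma> (\<delta> j)"
    have E: "?E (T f) \<in> hcarrier (L2 \<gamma>)" by (rule L2_spectral_measure(1)[OF sets Tc])
    have EE: "hip (L2 \<gamma>) (?E (T f)) (?E (T f)) = hip (L2 \<gamma>) (T f) (?E (T f))"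
    proof -
      have "hip (L2 \<gamma>) (?E (T f)) (?E (T f)) = (LINT z|arclength \<gamma>. complex_of_real (indicator (\<delta> j) z) * cinner (rep (T f) z) (rep (?E (T f)) z))"
        unfolding spectral_measure_eq_mult
        by (rule hip_mult_op_left[OF Tc E[unfolded spectral_measure_eq_mult] ind indb])
      also have "\<dots> = hip (L2 \<gamma>) (T f) (?E (T f))"
        unfolding hip_L2
      proof (rule integral_cong_AE)
        show "AE z in arclength \<gamma>. complex_of_real (indicator (\<delta> j) z) * cinner (rep (T f) z) (rep (?E (T f)) z) = cinner (rep (T f) z) (rep (?E (T f)) z)"
          using L2_spectral_measure(2)[OF sets[of j] Tc[of f]] by eventually_elim (simp add: indicator_def)
      qed (intro borel_measurable_times ind borel_measurable_cinner strongly_measurable_rep Tc E)+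
      finally show ?thesis .
    qed
    have "(hnorm (L2 \<gamma>) (?E (T f)))\<^sup>2 = Re (cinner f (T' (?E (T f))))"
      by (simp add: L.hnorm_power2[OF E] EE adj[OF E])
    also have "\<dots> \<le> norm f * norm (T' (?E (T f)))"
      by (rule order_trans[OF complex_Re_le_cmod norm_cinner])
    also have "\<dots> \<le> norm f * (q (\<delta> j) * norm f)"
      using opnorm_bound[OF HA HA Tb, of f j] by (intro mult_left_mono) (auto simp: q_def)
    also have "\<dots> = (sqrt (q (\<delta> j)) * norm f)\<^sup>2" using q0[of j] by (simp add: power_mult_distrib power2_eq_square)
    finally show ?thesis by (rule power2_le_imp_le) (use q0[of j] in simp)
  qed
  define N where "N = (SUP \<delta>\<in>borel_systems \<gamma>. \<Sum>j. ennreal (q (\<delta> j)))"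
  have EN: "E_norm \<gamma> T = ennreal_sqrt N" by (simp add: E_norm_def N_def q_def T'_def)
  have Nf: "N \<noteq> \<infinity>" using c unfolding EN by (auto simp: ennreal_sqrt_def)
  have cN: "(enn2real (E_norm \<gamma> T))\<^sup>2 = enn2real N" using Nf unfolding EN by (simp add: ennreal_sqrt_def)
  have "ennreal (\<Sum>j<n. q (\<delta> j)) = (\<Sum>j<n. ennreal (q (\<delta> j)))" using q0 by simp
  also have "\<dots> \<le> (\<Sum>j. ennreal (q (\<delta> j)))" by (rule sum_le_suminf) auto
  also have "\<dots> \<le> N" unfolding N_def by (rule SUP_upper[OF \<delta>])
  finally have "enn2real (ennreal (\<Sum>j<n. q (\<delta> j))) \<le> enn2real N"
    using Nf by (intro enn2real_mono) (auto simp: less_top)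
  then have "(\<Sum>j<n. q (\<delta> j)) \<le> (enn2real (E_norm \<gamma> T))\<^sup>2"
    using q0 by (simp add: cN sum_nonneg)
  then show ?thesis
    using piece q0 by (intro that[of "\<lambda>j. sqrt (q (\<delta> j))"]) auto
qed

lemma column_E_bound_E_norm:
  fixes T :: "'a::chilbert_space \<Rightarrow> (complex \<Rightarrow> 'h::complex_inner) set"
  assumes T: "T \<in> bounded_ops whole (L2 \<gamma>)" and c: "enn2real (E_norm \<gamma> T) > 0"
  shows "column_E_bound (L2 \<gamma>) (D_op \<gamma>) (path_image \<gamma>) T (enn2real (E_norm \<gamma> T))"
  unfolding column_E_bound_def
proof (intro allI impI)
  fix \<epsilon> :: real assume \<epsilon>: "\<epsilon> > 0"
  obtain n \<delta> l where *: "\<delta> \<in> borel_systems \<gamma>" "\<forall>j\<ge>n. \<delta> j = {}" "(\<Union>j<n. \<delta> j) = path_image \<gamma>"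
    "\<forall>j<n. l j \<in> path_image \<gamma> \<and> (\<forall>z\<in>\<delta> j. cmod (z - l j) \<le> \<epsilon>)" using fine_borel_system[OF \<epsilon>] .
  obtain a where a: "\<forall>j. 0 \<le> a j \<and> (\<forall>f. hnorm (L2 \<gamma>) (spectral_measure \<gamma> (\<delta> j) (T f)) \<le> a j * norm f)"
    "(\<Sum>j<n. (a j)\<^sup>2) \<le> (enn2real (E_norm \<gamma> T))\<^sup>2" using E_norm_pieces[OF T c *(1)] .
  show "\<exists>n E l a. spectral_partition (L2 \<gamma>) (D_op \<gamma>) \<epsilon> n E l \<and>
       (\<forall>j<n. l j \<in> path_image \<gamma> \<and> 0 \<le> a j \<and> (\<forall>f. hnorm (L2 \<gamma>) (E j (T f)) \<le> a j * norm f)) \<and>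
       (\<Sum>j<n. (a j)\<^sup>2) \<le> (enn2real (E_norm \<gamma> T))\<^sup>2"
    by (intro exI[of _ n] exI[of _ "\<lambda>j. spectral_measure \<gamma> (\<delta> j)"] exI[of _ l] exI[of _ a] conjI
        spectral_partition_L2[OF *(1,3) \<epsilon> *(4)]) (use a *(4) in auto)
qed

text \<open>The bounds of the pieces of the adjoint \<open>S\<close> pass to \<open>T\<close> through \<open>\<langle>T (E j F), v\<rangle> = \<langle>E j F, E j (S v)\<rangle>\<close>.\<close>

lemma row_E_bound_E_norm_dual:
  fixes T :: "(complex \<Rightarrow> 'h::complex_inner) set \<Rightarrow> 'a::chilbert_space"
  assumes T': "T' \<in> bounded_ops whole (L2 \<gamma>)"
    and adj: "\<forall>F\<in>hcarrier (L2 \<gamma>). \<forall>x. cinner (T F) x = hip (L2 \<gamma>) F (T' x)"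
    and c: "enn2real (E_norm_dual \<gamma> T) > 0"
  shows "row_E_bound (L2 \<gamma>) (D_op \<gamma>) (path_image \<gamma>) T (enn2real (E_norm_dual \<gamma> T))"
  unfolding row_E_bound_def
proof (intro allI impI)
  fix \<epsilon> :: real assume \<epsilon>: "\<epsilon> > 0"
  define S where "S = adjoint_op (L2 \<gamma>) whole T"
  have S: "S \<in> bounded_ops whole (L2 \<gamma>)"
    and adjS: "\<And>F x. F \<in> hcarrier (L2 \<gamma>) \<Longrightarrow> cinner (T F) x = hip (L2 \<gamma>) F (S x)"
  proof -
    note ao = adjoint_op[of T' whole "L2 \<gamma>" T, simplified, OF T' adj[rule_format]]
    show "S \<in> bounded_ops whole (L2 \<gamma>)" unfolding S_def by (rule ao(1))
    show "\<And>F x. F \<in> hcarrier (L2 \<gamma>) \<Longrightarrow> cinner (T F) x = hip (L2 \<gamma>) F (S x)"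
      unfolding S_def by (rule ao(2))
  qed
  have c': "enn2real (E_norm \<gamma> S) > 0" and cS: "enn2real (E_norm_dual \<gamma> T) = enn2real (E_norm \<gamma> S)"
    using c by (simp_all add: E_norm_dual_def S_def)
  obtain n \<delta> l where *: "\<delta> \<in> borel_systems \<gamma>" "\<forall>j\<ge>n. \<delta> j = {}" "(\<Union>j<n. \<delta> j) = path_image \<gamma>"
    "\<forall>j<n. l j \<in> path_image \<gamma> \<and> (\<forall>z\<in>\<delta> j. cmod (z - l j) \<le> \<epsilon>)" using fine_borel_system[OF \<epsilon>] .
  obtain a where a: "\<forall>j. 0 \<le> a j \<and> (\<forall>f. hnorm (L2 \<gamma>) (spectral_measure \<gamma> (\<delta> j) (S f)) \<le> a j * norm f)"
    "(\<Sum>j<n. (a j)\<^sup>2) \<le> (enn2real (E_norm \<gamma> S))\<^sup>2" using E_norm_pieces[OF S c' *(1)] .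
  have sp: "spectral_partition (L2 \<gamma> :: (complex \<Rightarrow> 'h) set hilb) (D_op \<gamma>) \<epsilon> n (\<lambda>j. spectral_measure \<gamma> (\<delta> j)) l"
    by (rule spectral_partition_L2[OF *(1,3) \<epsilon> *(4)])
  interpret sp: spectral_partition "L2 \<gamma> :: (complex \<Rightarrow> 'h) set hilb" "D_op \<gamma>" \<epsilon> n "\<lambda>j. spectral_measure \<gamma> (\<delta> j)" l
    by (rule sp)
  have "norm (T (spectral_measure \<gamma> (\<delta> j) F)) \<le> a j * hnorm (L2 \<gamma>) (spectral_measure \<gamma> (\<delta> j) F)"
    if j: "j < n" and F: "F \<in> hcarrier (L2 \<gamma>)" for j F
  proof -
    let ?E = "spectral_measure \<gamma> (\<delta> j)"
    define v where "v = T (?E F)"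
    have Sv: "S v \<in> hcarrier (L2 \<gamma>)" using bounded_ops_closed[OF S] by simp
    have E: "?E F \<in> hcarrier (L2 \<gamma>)" "?E (S v) \<in> hcarrier (L2 \<gamma>)" using sp.E_closed[OF j] F Sv by auto
    have "complex_of_real ((norm v)\<^sup>2) = cinner (T (?E F)) v" unfolding v_def[symmetric] by (rule cinner_self[symmetric])
    also have "\<dots> = hip (L2 \<gamma>) (?E (?E F)) (S v)" using adjS[OF E(1)] sp.E_idem[OF j F] by simp
    also have "\<dots> = hip (L2 \<gamma>) (?E F) (?E (S v))" by (rule sp.E_sym[OF j E(1) Sv])
    finally have "cmod (complex_of_real ((norm v)\<^sup>2)) \<le> hnorm (L2 \<gamma>) (?E F) * hnorm (L2 \<gamma>) (?E (S v))"
      using sp.Cauchy_Schwarz[OF E] by simp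
    also have "\<dots> \<le> hnorm (L2 \<gamma>) (?E F) * (a j * norm v)"
      using a(1) E by (intro mult_left_mono) auto
    finally have "norm v * norm v \<le> (a j * hnorm (L2 \<gamma>) (?E F)) * norm v"
      by (simp only: norm_of_real) (simp add: power2_eq_square mult_ac)
    then show ?thesis unfolding v_def[symmetric] using a(1) E by (cases "v = 0") auto
  qed
  then show "\<exists>n E l a. spectral_partition (L2 \<gamma>) (D_op \<gamma>) \<epsilon> n E l \<and>
       (\<forall>j<n. l j \<in> path_image \<gamma> \<and> 0 \<le> a j \<and>
          (\<forall>x\<in>hcarrier (L2 \<gamma>). norm (T (E j x)) \<le> a j * hnorm (L2 \<gamma>) (E j x))) \<and>
       (\<Sum>j<n. (a j)\<^sup>2) \<le> (enn2real (E_norm_dual \<gamma> T))\<^sup>2"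
    by (intro exI[of _ n] exI[of _ "\<lambda>j. spectral_measure \<gamma> (\<delta> j)"] exI[of _ l] exI[of _ a] conjI sp)
      (use a *(4) cS in auto)
qed

end

section \<open>The block diagonalization\<close>

lemma op_holomorphic_on_continuous: "op_holomorphic_on F S \<Longrightarrow> continuous_on S F"
  unfolding op_holomorphic_on_def
  by (intro continuous_at_imp_continuous_on ballI) (auto dest!: bspec intro: has_derivative_continuous)

theorem corollary4p10:
  fixes \<alpha> \<beta> c \<nu>\<^sub>b \<nu>\<^sub>c s :: real
    and A :: "'a::chilbert_space \<Rightarrow> 'a"
    and \<bb> :: "complex \<Rightarrow> 'h::chilbert_space \<Rightarrow>\<^sub>L 'a"
    and \<cc> :: "complex \<Rightarrow> 'a \<Rightarrow>\<^sub>L 'h"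
    and \<D> :: "complex set"
    and \<gamma> :: "real \<Rightarrow> complex"
    and X :: "'a \<Rightarrow> (complex \<Rightarrow> 'h) set"
    and Y :: "(complex \<Rightarrow> 'h) set \<Rightarrow> 'a"
  defines "HA \<equiv> (whole :: 'a hilb)"
    and "HD \<equiv> (L2 \<gamma> :: (complex \<Rightarrow> 'h) set hilb)"
    and "B \<equiv> B_op \<gamma> \<bb>"
    and "C \<equiv> C_op \<gamma> \<cc>"
    and "D \<equiv> (D_op \<gamma> :: (complex \<Rightarrow> 'h) set \<Rightarrow> _)"
  defines "d \<equiv> setdist (op_spectrum HA A) (path_image \<gamma>)"
    and "b0 \<equiv> enn2real (E_norm_dual \<gamma> B)"
    and "c0 \<equiv> enn2real (E_norm \<gamma> C)"
  defines "H \<equiv> hsum HA HD"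
    and "L \<equiv> block_op HA HD A B C D"
    and "Q \<equiv> block_op HA HD (op_zero HA) Y X (op_zero HD)"
  assumes "\<alpha> < \<beta>"
    and "self_adjoint_op HA A"
    and "op_spectrum HA A \<subseteq> open_interval \<alpha> \<beta>"
    and "open \<D>" "connected \<D>" "open_interval \<alpha> \<beta> \<subseteq> \<D>"
        "complex_of_real \<alpha> \<notin> \<D>" "complex_of_real \<beta> \<notin> \<D>"
    and "op_holomorphic_on \<bb> \<D>" "op_holomorphic_on \<cc> \<D>"
    and "c > 0" "0 \<le> \<nu>\<^sub>b" "\<nu>\<^sub>b < 1 / 2" "0 \<le> \<nu>\<^sub>c" "\<nu>\<^sub>c < 1 / 2"
    and "\<And>\<omega>. \<omega> \<in> {complex_of_real \<alpha>, complex_of_real \<beta>} \<Longrightarrow>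
           \<exists>U. open U \<and> \<omega> \<in> U \<and>
             (\<forall>\<mu>\<in>\<D> \<inter> U. norm (\<bb> \<mu>) \<le> c * cmod (\<mu> - \<omega>) powr (- \<nu>\<^sub>b) \<and>
                        norm (\<cc> \<mu>) \<le> c * cmod (\<mu> - \<omega>) powr (- \<nu>\<^sub>c))"
    and "s \<in> {1, -1}"
    and "contour_of_sign \<D> \<alpha> \<beta> s \<gamma>"
    and "E_norm_dual \<gamma> B * E_norm \<gamma> C < ennreal (d\<^sup>2 / 4)"
    and "riccati_solution HA HD A B C D X"
    and "\<not> op_eq HD B (op_zero HA) \<Longrightarrow> opnorm HA HD X < (d - sqrt (b0 * c0)) / b0"
    and "riccati_solution HD HA D C B A Y"
    and "\<not> op_eq HA C (op_zero HD) \<Longrightarrow> opnorm HD HA Y < (d - sqrt (b0 * c0)) / c0"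
  shows "boundedly_invertible H (op_add H id Q)
    \<and> boundedly_invertible H (op_diff H id Q)
    \<and> op_eq H L
        (op_add H id Q
          \<circ> block_op HA HD (op_add HA A (B \<circ> X)) (op_zero HA) (op_zero HD) (op_add HD D (C \<circ> Y))
          \<circ> op_inv H (op_add H id Q))
    \<and> op_eq H L
        (op_inv H (op_diff H id Q)
          \<circ> block_op HA HD (op_diff HA A (Y \<circ> C)) (op_zero HA) (op_zero HD) (op_diff HD D (X \<circ> B))
          \<circ> op_diff H id Q)"
proof -
  have contour: "arc \<gamma>" "piecewise_smooth \<gamma>" "\<gamma> 0 = complex_of_real \<alpha>" "\<gamma> 1 = complex_of_real \<beta>"
    and inner: "\<gamma> ` {0<..<1} \<subseteq> \<D>"
    using \<open>contour_of_sign \<D> \<alpha> \<beta> s \<gamma>\<close> \<open>open_interval \<alpha> \<beta> \<subseteq> \<D>\<close>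
    unfolding contour_of_sign_def signed_part_def pathstart_def pathfinish_def by blast+
  interpret contour_operators \<gamma> \<D>
    by unfold_locales (use contour inner \<open>open \<D>\<close> in auto)
  have lin: "\<And>z. z \<in> \<D> \<Longrightarrow> blinfun_apply (\<bb> z) \<in> bounded_ops whole whole"
     "\<And>z. z \<in> \<D> \<Longrightarrow> blinfun_apply (\<cc> z) \<in> bounded_ops whole whole"
    using \<open>op_holomorphic_on \<bb> \<D>\<close> \<open>op_holomorphic_on \<cc> \<D>\<close> by (auto simp: op_holomorphic_on_def)
  note cont = op_holomorphic_on_continuous[OF \<open>op_holomorphic_on \<bb> \<D>\<close>]
    op_holomorphic_on_continuous[OF \<open>op_holomorphic_on \<cc> \<D>\<close>]
  have endpoint: "\<exists>U. open U \<and> \<omega> \<in> U \<and>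
      (\<forall>\<mu>\<in>\<D> \<inter> U. norm (\<bb> \<mu>) \<le> c * cmod (\<mu> - \<omega>) powr (- \<nu>\<^sub>b) \<and>
                 norm (\<cc> \<mu>) \<le> c * cmod (\<mu> - \<omega>) powr (- \<nu>\<^sub>c))" if "\<omega> \<in> {\<gamma> 0, \<gamma> 1}" for \<omega>
    by (rule assms) (use that contour in auto)
  have si: "square_integrable (arclength \<gamma>) (extend0 \<D> \<bb>)" "square_integrable (arclength \<gamma>) (extend0 \<D> \<cc>)"
    unfolding extend0_def[abs_def]
    using \<open>c > 0\<close> endpoint
    by (intro square_integrable_of_endpoint_bounds[OF open_S cont(1) inner_S \<open>0 \<le> \<nu>\<^sub>b\<close> \<open>\<nu>\<^sub>b < 1 / 2\<close>, of c]
        square_integrable_of_endpoint_bounds[OF open_S cont(2) inner_S \<open>0 \<le> \<nu>\<^sub>c\<close> \<open>\<nu>\<^sub>c < 1 / 2\<close>, of c]; meson less_imp_le)+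
  have K: "prehilbert HD" unfolding HD_def by (rule prehilbert_L2)
  obtain B' where B: "B \<in> bounded_ops HD HA" and B': "B' \<in> bounded_ops whole (L2 \<gamma>)"
    "\<forall>F\<in>hcarrier (L2 \<gamma>). \<forall>x. cinner (B F) x = hip (L2 \<gamma>) F (B' x)"
    using bounded_ops_B_op[OF lin(1) cont(1) si(1)] unfolding B_def HD_def HA_def by metis
  have C: "C \<in> bounded_ops HA HD"
    unfolding C_def HD_def HA_def by (rule bounded_ops_C_op[OF lin(2) si(2)])
  have part: "\<exists>n E l. spectral_partition HD D \<epsilon> n E l \<and> (\<forall>j<n. l j \<in> path_image \<gamma>)" if \<epsilon>: "\<epsilon> > 0" for \<epsilon>
  proof -
    obtain n \<delta> l where *: "\<delta> \<in> borel_systems \<gamma>" "\<forall>j\<ge>n. \<delta> j = {}" "(\<Union>j<n. \<delta> j) = path_image \<gamma>"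
      "\<forall>j<n. l j \<in> path_image \<gamma> \<and> (\<forall>z\<in>\<delta> j. cmod (z - l j) \<le> \<epsilon>)" using fine_borel_system[OF \<epsilon>] .
    show ?thesis
      unfolding HD_def D_def using spectral_partition_L2[OF *(1,3) \<epsilon> *(4)] *(4) by blast
  qed
  then have D: "D \<in> bounded_ops HD HD"
    using spectral_partition.D zero_less_one by blast
  have "0 < ennreal (d\<^sup>2 / 4)"
    using \<open>E_norm_dual \<gamma> B * E_norm \<gamma> C < ennreal (d\<^sup>2 / 4)\<close> by (rule le_less_trans[OF zero_le])
  then have "d \<noteq> 0" by auto
  moreover have "0 \<le> d" unfolding d_def by (rule setdist_pos_le)
  ultimately have d: "d > 0" by simp
  interpret riccati_pair A HD B C D X Y d "path_image \<gamma>"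
  proof (rule riccati_pair.intro)
    show "d \<le> dist \<mu> z" if "z \<in> op_spectrum whole A" "\<mu> \<in> path_image \<gamma>" for z \<mu>
      using setdist_le_dist[OF that] by (simp add: d_def HA_def dist_commute)
    show "op_spectrum whole A \<subseteq> \<real>"
      using \<open>op_spectrum HA A \<subseteq> open_interval \<alpha> \<beta>\<close> by (auto simp: HA_def open_interval_def)
    show "self_adjoint_op whole A" "riccati_solution whole HD A B C D X" "riccati_solution HD whole D C B A Y"
      using \<open>self_adjoint_op HA A\<close> \<open>riccati_solution HA HD A B C D X\<close> \<open>riccati_solution HD HA D C B A Y\<close>
      unfolding HA_def by blast+
    show "prehilbert HD" "B \<in> bounded_ops HD whole" "C \<in> bounded_ops whole HD" "D \<in> bounded_ops HD HD" "d > 0"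
      using K B C D d unfolding HA_def by blast+
  qed
  have nonneg: "0 \<le> b0" "0 \<le> c0" by (simp_all add: b0_def c0_def)
  \<comment> \<open>A vanishing norm would turn the bound on the solution into \<open>r / 0 = 0\<close>.\<close>
  have b: "0 < b0 \<and> row_E_bound HD D (path_image \<gamma>) B b0 \<and> opnorm whole HD X < (d - sqrt (b0 * c0)) / b0"
    if "\<not> op_eq HD B (op_zero whole)"
  proof -
    have "opnorm HA HD X < (d - sqrt (b0 * c0)) / b0"
      by (rule assms) (use that in \<open>unfold HA_def\<close>)
    then have X_less: "opnorm whole HD X < (d - sqrt (b0 * c0)) / b0" unfolding HA_def .
    have b0: "0 < b0"
      using X_less nonneg(1) opnorm_nonneg[OF prehilbert_whole K X_bounded] by (cases "b0 = 0") auto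
    then have "row_E_bound HD D (path_image \<gamma>) B b0"
      unfolding HD_def D_def b0_def by (rule row_E_bound_E_norm_dual[OF B'])
    then show ?thesis using X_less b0 by blast
  qed
  have c: "0 < c0 \<and> column_E_bound HD D (path_image \<gamma>) C c0 \<and> opnorm HD whole Y < (d - sqrt (b0 * c0)) / c0"
    if "\<not> op_eq whole C (op_zero HD)"
  proof -
    have "opnorm HD HA Y < (d - sqrt (b0 * c0)) / c0"
      by (rule assms) (use that in \<open>unfold HA_def\<close>)
    then have Y_less: "opnorm HD whole Y < (d - sqrt (b0 * c0)) / c0" unfolding HA_def .
    have c0: "0 < c0"
      using Y_less nonneg(2) opnorm_nonneg[OF K prehilbert_whole Y_bounded] by (cases "c0 = 0") auto
    then have "column_E_bound HD D (path_image \<gamma>) C c0"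
      unfolding HD_def D_def c0_def by (rule column_E_bound_E_norm[OF C[unfolded HD_def HA_def]])
    then show ?thesis using Y_less c0 by blast
  qed
  obtain q where q: "\<And>u. norm (Y (X u)) \<le> q * norm u" "0 \<le> q" "q < 1"
    using YX_strict_contraction[OF part nonneg b c] by blast
  show ?thesis
    unfolding H_def L_def Q_def HA_def
    by (rule Riccati_block_diagonalization[OF K A_bounded B[unfolded HA_def] C[unfolded HA_def] D X Y q])
qed

end
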